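(* Let $p(z)=a_dz^d+\dots+a_1z+a_0\in\mathbb{Z}[z]$ with $d\ge 1$ and $a_d>0$ be such that $2\mid p(1)p(2)$. Then for every 2-colouring $\phi$ of $[n]$, the number of monochromatic solutions $\{x,y,z\}\in[n]^{(3)}$ to $x+y=p(z)$ is at least $n^{2/d^3-o(1)}$, where $o(1)$ denotes a quantity tending to $0$ as $n\to\infty$ that depends only on $p$ and $n$ (and not on $\phi$). Moreover, for every $n$ there is a 2-colouring of $[n]$ for which the number of monochromatic solutions is only $O(n^{2/d^2})$, where the implied constant depends only on $p$.
   Context: $[n]=\{1,\dots,n\}$, and $[n]^{(3)}$ denotes the family of 3-element subsets of $[n]$. A 2-colouring of $[n]$ is a function $\phi:[n]\to\{-1,1\}$. A solution $\{x,y,z\}$ of $x+y=p(z)$ is monochromatic if $\phi(x)=\phi(y)=\phi(z)$. *)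

theory Defs
  imports Complex_Main "HOL-Library.FuncSet" "HOL-Computational_Algebra.Polynomial"
begin

definition two_colouring :: "nat \<Rightarrow> (nat \<Rightarrow> int) \<Rightarrow> bool" where
  "two_colouring n \<phi> \<longleftrightarrow> \<phi> \<in> {1..n} \<rightarrow> {-1, 1}"

text \<open>A solution is a three-element subset of \<open>{1..n}\<close> which can be labelled \<open>{x, y, z}\<close> so that
  \<open>x + y = p(z)\<close>; a set admitting several such labellings is counted once.\<close>

definition solutions :: "int poly \<Rightarrow> nat \<Rightarrow> nat set set" where
  "solutions p n =
     {S. S \<subseteq> {1..n} \<and> card S = 3 \<and>
         (\<exists>x y z. S = {x, y, z} \<and> int x + int y = poly p (int z))}"

definition monochromatic :: "(nat \<Rightarrow> int) \<Rightarrow> nat set \<Rightarrow> bool" where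
  "monochromatic \<phi> S \<longleftrightarrow> (\<forall>u\<in>S. \<forall>v\<in>S. \<phi> u = \<phi> v)"

definition num_mono_solutions :: "int poly \<Rightarrow> nat \<Rightarrow> (nat \<Rightarrow> int) \<Rightarrow> nat" where
  "num_mono_solutions p n \<phi> = card {S \<in> solutions p n. monochromatic \<phi> S}"

end

theory Submission
  imports Defs
begin

text \<open>If \<open>z\<close> and \<open>z'\<close> have different colours and \<open>x + y = p(z)\<close>, \<open>x' + y = p(z')\<close>, then, barring
  monochromatic solutions, \<open>x'\<close> inherits the colour \<open>c\<close> of \<open>z\<close> from \<open>x\<close>: the colour class of \<open>c\<close> is closed under
  the shift by \<open>p(z') - p(z)\<close>.

  Let \<open>d \<ge> 2\<close> and suppose that at most a small multiple of \<open>A\<close> numbers lie in monochromatic solutions, where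
  \<open>A\<close> is of order \<open>n\<close> to the power \<open>1 / d\<^sup>2\<close>. Unless the colouring is constant on \<open>[4 * A, p(4 * A)]\<close>, which
  is absurd, the colour changes from \<open>c\<close> to the other one between some \<open>s\<close> and \<open>s + 1\<close> in this range, with
  many \<open>x \<le> 4 * A\<close> of colour \<open>c\<close>. If \<open>c\<close> recurs shortly after \<open>s\<close>, then there are shifts in both directions, the
  colouring is periodic on an interval and agrees with its reflection \<open>x \<mapsto> p(s) - x\<close>, which is impossible.
  Otherwise all differences \<open>p(s + i) - p(s)\<close> for small \<open>i\<close> are shifts for \<open>c\<close>. As nonnegative combinations
  they yield every large number in a suitable residue class, because iterated differences of \<open>p\<close> of bounded step
  serve as digits of a mixed radix representation; so \<open>c\<close> spreads from \<open>x\<close> to \<open>p(s) - x'\<close> with \<open>x'\<close> of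
  colour \<open>c\<close>, which gives a monochromatic solution. The parity hypothesis provides a residue class
  with \<open>2 * x \<equiv> p(z)\<close>.

  For \<open>d = 1\<close> the shifts are used in density form: they show that the lower part of a residue class modulo the
  leading coefficient is almost monochromatic, so a positive proportion of all solutions is monochromatic.

  For the upper bound colour \<open>(a, b]\<close> differently from its complement, where \<open>p(a)\<close> is about \<open>2 * b\<close> and \<open>p(b)\<close>
  is about \<open>2 * n\<close>: a monochromatic solution has \<open>z \<le> a\<close> and \<open>min x y \<le> a\<close>.\<close>

section \<open>Differences of polynomials\<close>

text \<open>For \<open>d \<ge> 2\<close> the argument yields the order \<open>n\<close> to the power
  \<open>1 / d\<^sup>2\<close>, and \<open>2 * d\<^sup>2 \<le> d ^ 3\<close> turns it into the
  claimed exponent. For \<open>d = 1\<close> it would yield only a linear count where a quadratic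
  one is claimed, hence the separate density argument. The size of \<open>A\<close> reflects that a
  colour change may occur as late as \<open>p(4 * A)\<close> and that \<open>p\<close> near that
  place must still be at most \<open>n\<close>. Two obstacles shape the nonlinear case. A shift is
  reliable only while the numbers it visits avoid monochromatic solutions; this is met by having
  more candidate starting points than exceptions, so that some climb meets none. The modulus
  \<open>H\<close>, \<open>d!\<close> times the leading coefficient, is the constant
  \<open>d\<close>-th difference of step 1.\<close>

definition poly_diff :: "int \<Rightarrow> int poly \<Rightarrow> int poly" where
  "poly_diff k q = pcompose q [:k, 1:] - q"

lemma poly_poly_diff: "poly (poly_diff k q) s = poly q (s + k) - poly q s"
  by (simp add: poly_diff_def poly_pcompose add.commute)

lemma poly_diff_pCons:
  "poly_diff k (pCons c q) = pCons 0 (poly_diff k q) + smult k (pcompose q [:k, 1:])"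
  by (simp add: poly_diff_def pcompose_pCons algebra_simps)

lemma coeff_pcompose_shift_top:
  fixes q :: "int poly"
  assumes "degree q \<le> n"
  shows "coeff (pcompose q [:k, 1:]) n = coeff q n"
proof (cases "degree q = n")
  case True
  have "lead_coeff (pcompose q [:k, 1:]) = lead_coeff q"
    by (subst lead_coeff_comp) auto
  then show ?thesis using True by (simp add: degree_pcompose)
next
  case False
  then show ?thesis using assms by (simp add: coeff_eq_0 degree_pcompose)
qed

text \<open>For \<open>q = c + X * q1\<close> the difference is \<open>X\<close> times that of
  \<open>q1\<close> plus \<open>k * q1(X + k)\<close>. An upper bound for the degree, rather than
  its value, lets the induction pass to any \<open>q1\<close>.\<close>

lemma poly_diff_coeff:
  assumes "degree q \<le> Suc n"
  shows "degree (poly_diff k q) \<le> n \<and> coeff (poly_diff k q) n = int (Suc n) * k * coeff q (Suc n)"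
  using assms
proof (induction n arbitrary: q)
  case 0
  obtain c q1 where q: "q = pCons c q1" by (cases q)
  with 0 have "degree q1 = 0" by (auto split: if_splits)
  then obtain e where "q1 = [:e:]" by (auto elim: degree_eq_zeroE)
  with q show ?case by (simp add: poly_diff_def pcompose_pCons algebra_simps)
next
  case (Suc n)
  obtain c q1 where q: "q = pCons c q1" by (cases q)
  with Suc.prems have d: "degree q1 \<le> Suc n" by (auto split: if_splits)
  note IH = Suc.IH[OF d]
  have "degree (poly_diff k q) \<le> Suc n"
    unfolding q poly_diff_pCons
    by (intro degree_add_le) (use IH d in \<open>auto simp: degree_pcompose degree_pCons_eq_if intro!: order_trans[OF degree_smult_le]\<close>)
  moreover have "coeff (poly_diff k q) (Suc n) = int (Suc (Suc n)) * k * coeff q (Suc (Suc n))"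
    unfolding q poly_diff_pCons
    using IH coeff_pcompose_shift_top[OF d, of k] by (simp add: algebra_simps)
  ultimately show ?case by blast
qed

lemma poly_diff_lead:
  assumes "degree q = Suc n" "lead_coeff q > 0" "k > 0"
  shows "degree (poly_diff k q) = n" "lead_coeff (poly_diff k q) = int (Suc n) * k * lead_coeff q"
proof -
  have *: "degree (poly_diff k q) \<le> n" "coeff (poly_diff k q) n = int (Suc n) * k * coeff q (Suc n)"
    using poly_diff_coeff[of q n k] assms by auto
  have "coeff (poly_diff k q) n > 0" using * assms by simp
  then show "degree (poly_diff k q) = n" using *(1) le_degree[of "poly_diff k q" n] by simp
  then show "lead_coeff (poly_diff k q) = int (Suc n) * k * lead_coeff q" using * assms by simp
qed

text \<open>Each difference multiplies the leading coefficient by \<open>k\<close> and the current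
  degree; the quotient of factorials is the resulting falling factorial.\<close>

lemma poly_diff_iter_lead:
  assumes "degree q = d" "lead_coeff q > 0" "k > 0" "l \<le> d"
  shows "degree ((poly_diff k ^^ l) q) = d - l \<and>
    lead_coeff ((poly_diff k ^^ l) q) = (fact d div fact (d - l)) * k ^ l * lead_coeff q"
  using assms(4)
proof (induction l)
  case 0
  then show ?case using assms by simp
next
  case (Suc l)
  let ?q = "(poly_diff k ^^ l) q"
  obtain m where m: "d - l = Suc m" "d - Suc l = m" using Suc.prems by (metis Suc_diff_Suc Suc_le_lessD)
  have IH: "degree ?q = Suc m" "lead_coeff ?q = (fact d div fact (Suc m)) * k ^ l * lead_coeff q"
    using Suc m by auto
  have dv: "(fact (Suc m) :: int) dvd fact d" using m by (intro fact_dvd) auto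
  have pos: "(fact d div fact (Suc m) :: int) > 0"
    using dv by (meson fact_gt_zero pos_imp_zdiv_pos_iff zdvd_imp_le)
  have lp: "lead_coeff ?q > 0" using IH pos assms by simp
  have e: "int (Suc m) * (fact d div fact (Suc m)) = fact d div fact m"
  proof -
    obtain x :: int where x: "fact d = fact (Suc m) * x" using dv by blast
    have "(fact d :: int) = fact m * (int (Suc m) * x)" using x by (simp add: algebra_simps)
    then show ?thesis using x
      by (metis fact_nonzero nonzero_mult_div_cancel_left)
  qed
  have "lead_coeff (poly_diff k ?q) = (int (Suc m) * (fact d div fact (Suc m))) * k ^ Suc l * lead_coeff q"
    using poly_diff_lead(2)[OF IH(1) lp assms(3)] IH(2) by (simp add: algebra_simps)
  then show ?case using poly_diff_lead(1)[OF IH(1) lp assms(3)] m e by simp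
qed

text \<open>Beyond \<open>2 * B + 1\<close>, with \<open>B\<close> the sum of the absolute values of
  the lower coefficients, the lower terms amount to at most half of the leading one.\<close>

lemma poly_bounds:
  fixes q :: "int poly"
  assumes "lead_coeff q > 0"
  obtains s0 where "s0 \<ge> 1"
    "\<And>s. s \<ge> s0 \<Longrightarrow> lead_coeff q * s ^ degree q \<le> 2 * poly q s"
    "\<And>s. s \<ge> s0 \<Longrightarrow> poly q s \<le> 2 * lead_coeff q * s ^ degree q"
proof -
  define e where "e = degree q"
  define L where "L = lead_coeff q"
  define B where "B = (\<Sum>i<e. \<bar>coeff q i\<bar>)"
  have L: "L \<ge> 1" using assms L_def by simp
  have B0: "B \<ge> 0" unfolding B_def by (intro sum_nonneg) auto
  have key: "2 * \<bar>poly q s - L * s ^ e\<bar> \<le> L * s ^ e" if s: "s \<ge> 2 * B + 1" for s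
  proof (cases "e = 0")
    case True
    then obtain c where "q = [:c:]" unfolding e_def by (auto elim: degree_eq_zeroE)
    then show ?thesis using True L L_def by simp
  next
    case False
    have s1: "s \<ge> 1" using s B0 by simp
    have "poly q s = (\<Sum>i\<le>e. coeff q i * s ^ i)" unfolding e_def by (rule poly_altdef)
    also have "\<dots> = (\<Sum>i<e. coeff q i * s ^ i) + L * s ^ e"
      unfolding L_def e_def by (simp add: lessThan_Suc_atMost[symmetric])
    finally have "\<bar>poly q s - L * s ^ e\<bar> = \<bar>\<Sum>i<e. coeff q i * s ^ i\<bar>" by simp
    also have "\<dots> \<le> (\<Sum>i<e. \<bar>coeff q i * s ^ i\<bar>)" by (rule sum_abs)
    also have "\<dots> \<le> (\<Sum>i<e. \<bar>coeff q i\<bar> * s ^ (e - 1))"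
      using s1 by (intro sum_mono) (auto simp: abs_mult intro!: mult_left_mono power_increasing)
    also have "\<dots> = B * s ^ (e - 1)" unfolding B_def by (simp add: sum_distrib_right)
    finally have "2 * \<bar>poly q s - L * s ^ e\<bar> \<le> (2 * B) * s ^ (e - 1)" by simp
    also have "\<dots> \<le> s * s ^ (e - 1)" using s s1 by (intro mult_right_mono) auto
    also have "\<dots> = s ^ e" using False by (metis power_eq_if)
    also have "\<dots> \<le> L * s ^ e" using L s1 by (simp add: mult_le_cancel_right1)
    finally show ?thesis .
  qed
  have aux: "Y \<le> 2 * X" "X \<le> 2 * Y" if "2 * \<bar>X - Y\<bar> \<le> Y" "0 \<le> Y" for X Y :: int
    using that by presburger+
  show ?thesis
  proof (rule that[of "2 * B + 1"])
    show "2 * B + 1 \<ge> 1" using B0 by simp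
  next
    fix s assume s: "s \<ge> 2 * B + 1"
    have pos: "0 \<le> L * s ^ e" using L s B0 by simp
    show "lead_coeff q * s ^ degree q \<le> 2 * poly q s"
      using aux(1)[OF key[OF s] pos] unfolding L_def e_def .
    show "poly q s \<le> 2 * lead_coeff q * s ^ degree q"
      using aux(2)[OF key[OF s] pos] unfolding L_def e_def mult.assoc .
  qed
qed

lemma eventually_poly_lower:
  fixes q :: "int poly"
  assumes "lead_coeff q > 0"
  shows "\<forall>\<^sub>F s in at_top. lead_coeff q * s ^ degree q \<le> 2 * poly q s"
  using poly_bounds[OF assms] unfolding eventually_at_top_linorder by metis

lemma eventually_poly_upper:
  fixes q :: "int poly"
  assumes "lead_coeff q > 0"
  shows "\<forall>\<^sub>F s in at_top. poly q s \<le> 2 * lead_coeff q * s ^ degree q"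
  using poly_bounds[OF assms] unfolding eventually_at_top_linorder by metis

section \<open>Nonnegative combinations of forward differences\<close>

definition fwd :: "int poly \<Rightarrow> int \<Rightarrow> int \<Rightarrow> int" where
  "fwd p s i = poly p (s + i) - poly p s"

text \<open>The coefficients depend on \<open>l\<close> alone. As they do not grow with
  \<open>k\<close>, making them nonnegative costs only a multiple of \<open>k\<close>, whereas the
  \<open>l\<close>-th difference itself grows like \<open>k ^ l\<close>.\<close>

lemma poly_diff_iter_fwd:
  "\<exists>e :: nat \<Rightarrow> int. \<forall>k p s. poly ((poly_diff k ^^ Suc l) p) s = (\<Sum>i=1..Suc l. e i * fwd p s (k * int i))"
proof (induction l)
  case 0
  show ?case by (rule exI[of _ "\<lambda>_. 1"]) (simp add: fwd_def poly_poly_diff)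
next
  case (Suc l)
  then obtain e :: "nat \<Rightarrow> int" where
    e: "\<And>k p s. poly ((poly_diff k ^^ Suc l) p) s = (\<Sum>i=1..Suc l. e i * fwd p s (k * int i))" by blast
  \<comment> \<open>Differencing turns \<open>F i\<close> into \<open>F (Suc i) - F 1 - F i\<close>:
    the coefficients move up by one, the old ones are subtracted, and the negated total collects at
    index 1.\<close>
  define e' where "e' j = (if j \<ge> 2 then e (j - 1) else - (\<Sum>i=1..Suc l. e i)) - (if j \<le> Suc l then e j else 0)" for j
  have "poly ((poly_diff k ^^ Suc (Suc l)) p) s = (\<Sum>i=1..Suc (Suc l). e' i * fwd p s (k * int i))" for k p s
  proof -
    let ?F = "\<lambda>j. fwd p s (k * int j)"
    have sh: "fwd p (s + k) (k * int i) = ?F (Suc i) - ?F 1" for i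
      by (simp add: fwd_def algebra_simps)
    have "poly ((poly_diff k ^^ Suc (Suc l)) p) s =
        poly ((poly_diff k ^^ Suc l) p) (s + k) - poly ((poly_diff k ^^ Suc l) p) s"
      by (simp add: poly_poly_diff)
    also have "\<dots> = (\<Sum>i=1..Suc l. e i * (?F (Suc i) - ?F 1)) - (\<Sum>i=1..Suc l. e i * ?F i)"
      unfolding e sh ..
    also have "(\<Sum>i=1..Suc l. e i * (?F (Suc i) - ?F 1)) =
        (\<Sum>i=1..Suc l. e i * ?F (Suc i)) - (\<Sum>i=1..Suc l. e i) * ?F 1"
      by (simp only: right_diff_distrib sum_subtractf sum_distrib_right)
    also have "(\<Sum>i=1..Suc l. e i * ?F (Suc i)) = (\<Sum>j=2..Suc (Suc l). e (j - 1) * ?F j)"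
      by (rule sum.reindex_bij_witness[of _ "\<lambda>j. j - 1" Suc]) auto
    also have "\<dots> - (\<Sum>i=1..Suc l. e i) * ?F 1 =
        (\<Sum>j=1..Suc (Suc l). (if j \<ge> 2 then e (j - 1) else - (\<Sum>i=1..Suc l. e i)) * ?F j)"
    proof -
      have "{1..Suc (Suc l)} = insert 1 {2..Suc (Suc l)}" by auto
      then show ?thesis by (simp add: algebra_simps)
    qed
    also have "(\<Sum>i=1..Suc l. e i * ?F i) = (\<Sum>i=1..Suc (Suc l). (if i \<le> Suc l then e i else 0) * ?F i)"
      by simp
    also have "(\<Sum>j=1..Suc (Suc l). (if j \<ge> 2 then e (j - 1) else - (\<Sum>i=1..Suc l. e i)) * ?F j) - \<dots>
        = (\<Sum>i=1..Suc (Suc l). e' i * ?F i)"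
      unfolding e'_def left_diff_distrib sum_subtractf ..
    finally show ?thesis .
  qed
  then show ?case by blast
qed

text \<open>The additive monoid generated by the shifts from \<open>s\<close> to
  \<open>s + 1\<close>, ..., \<open>s + h\<close>: the displacements open to a colour that
  \<open>s\<close> has and the next \<open>h\<close> numbers lack.\<close>

definition combos :: "int poly \<Rightarrow> nat \<Rightarrow> int \<Rightarrow> int set" where
  "combos p h s = {u. \<exists>r :: nat \<Rightarrow> nat. u = (\<Sum>i=1..h. int (r i) * fwd p s (int i))}"

lemma combos_add: "u \<in> combos p h s \<Longrightarrow> v \<in> combos p h s \<Longrightarrow> u + v \<in> combos p h s"
proof -
  assume "u \<in> combos p h s" "v \<in> combos p h s"
  then obtain r1 r2 :: "nat \<Rightarrow> nat" where "u = (\<Sum>i=1..h. int (r1 i) * fwd p s (int i))"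
    "v = (\<Sum>i=1..h. int (r2 i) * fwd p s (int i))" unfolding combos_def by blast
  then have "u + v = (\<Sum>i=1..h. int (r1 i + r2 i) * fwd p s (int i))"
    by (simp add: sum.distrib algebra_simps)
  then show ?thesis unfolding combos_def by (intro CollectI exI[of _ "\<lambda>i. r1 i + r2 i"])
qed

lemma combos_0: "0 \<in> combos p h s"
  unfolding combos_def by (intro CollectI exI[of _ "\<lambda>_. 0"]) simp

lemma combos_mult_fwd:
  assumes "c \<ge> 0" "i \<le> h"
  shows "c * fwd p s (int i) \<in> combos p h s"
proof (cases "i = 0")
  case True
  then show ?thesis using combos_0 by (simp add: fwd_def)
next
  case False
  have "c * fwd p s (int i) = (\<Sum>j=1..h. int (if j = i then nat c else 0) * fwd p s (int j))"
    using False assms by (simp add: if_distrib if_distribR sum.delta cong: if_cong)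
  then show ?thesis unfolding combos_def by (intro CollectI exI)
qed

lemma combos_sum:
  assumes "\<And>i. i \<in> I \<Longrightarrow> f i \<in> combos p h s"
  shows "sum f I \<in> combos p h s"
  using assms by (induction I rule: infinite_finite_induct) (auto simp: combos_0 combos_add)

lemma combos_mono:
  assumes "u \<in> combos p h s" "h \<le> h'"
  shows "u \<in> combos p h' s"
proof -
  obtain r where "u = (\<Sum>i=1..h. int (r i) * fwd p s (int i))" using assms(1) unfolding combos_def by blast
  then show ?thesis using assms(2) by (auto intro!: combos_sum combos_mult_fwd)
qed

lemma fwd_bounds:
  assumes "degree p = d" "d \<ge> 1" "lead_coeff p > 0" "k \<ge> 1"
  shows "\<forall>\<^sub>F s in at_top. int d * k * lead_coeff p * s ^ (d - 1) \<le> 2 * fwd p s k \<and>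
    fwd p s k \<le> 2 * (int d * k * lead_coeff p) * s ^ (d - 1)"
proof -
  have d: "degree p = Suc (d - 1)" using assms by simp
  note q = poly_diff_lead[OF d assms(3), of k]
  have l: "lead_coeff (poly_diff k p) > 0" using q(2) assms by simp
  have q': "degree (poly_diff k p) = d - 1" "coeff (poly_diff k p) (d - 1) = int d * k * lead_coeff p"
    using q assms by auto
  have f: "poly (poly_diff k p) s = fwd p s k" for s by (simp add: poly_poly_diff fwd_def)
  show ?thesis
    using eventually_poly_lower[OF l] eventually_poly_upper[OF l]
    unfolding q' f by eventually_elim simp
qed

text \<open>A multiple \<open>r\<close> of the \<open>l\<close>-th difference has coefficients
  \<open>r * e i\<close> of either sign. With \<open>T\<close> a multiple \<open>C0\<close> of the
  sum of all shifts involved, adding \<open>R * T\<close> raises each coefficient by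
  \<open>R * C0\<close>, which outweighs \<open>r * e i\<close>. It matters that \<open>C\<close> is
  fixed before \<open>k\<close>.\<close>

lemma combos_level:
  assumes p: "degree p = d" "lead_coeff p > 0" and l: "1 \<le> l" "l \<le> d"
  obtains C :: int where "C \<ge> 0"
    "\<And>k. k \<ge> (1::nat) \<Longrightarrow> \<forall>\<^sub>F s in at_top. \<exists>T. 0 \<le> T \<and> T \<le> C * int k * s ^ (d - 1) \<and>
       (\<forall>R r. 0 \<le> r \<longrightarrow> r \<le> R \<longrightarrow> R * T + r * poly ((poly_diff (int k) ^^ l) p) s \<in> combos p (l * k) s)"
proof -
  obtain e :: "nat \<Rightarrow> int" where
    e: "\<And>k p s. poly ((poly_diff k ^^ l) p) s = (\<Sum>i=1..l. e i * fwd p s (k * int i))"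
    using poly_diff_iter_fwd[of "l - 1"] l by auto
  define C0 where "C0 = (\<Sum>i=1..l. \<bar>e i\<bar>)"
  have C0: "C0 \<ge> 0" unfolding C0_def by (intro sum_nonneg) auto
  have eC: "\<bar>e i\<bar> \<le> C0" if "i \<in> {1..l}" for i
    unfolding C0_def using that by (intro member_le_sum) auto
  define C where "C = C0 * (\<Sum>i=1..l. 2 * int d * int i * lead_coeff p)"
  have C: "C \<ge> 0" unfolding C_def using C0 p by (intro mult_nonneg_nonneg sum_nonneg) auto
  have "\<forall>\<^sub>F s in at_top. \<exists>T. 0 \<le> T \<and> T \<le> C * int k * s ^ (d - 1) \<and>
       (\<forall>R r. 0 \<le> r \<longrightarrow> r \<le> R \<longrightarrow> R * T + r * poly ((poly_diff (int k) ^^ l) p) s \<in> combos p (l * k) s)"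
    if k: "k \<ge> 1" for k :: nat
  proof -
    have ev: "\<forall>\<^sub>F s in at_top. \<forall>i\<in>{1..l}. int d * (int k * int i) * lead_coeff p * s ^ (d - 1) \<le> 2 * fwd p s (int k * int i) \<and>
        fwd p s (int k * int i) \<le> 2 * (int d * (int k * int i) * lead_coeff p) * s ^ (d - 1)"
      by (intro eventually_ball_finite ballI fwd_bounds) (use p l k in \<open>auto simp flip: of_nat_mult\<close>)
    show ?thesis using ev eventually_ge_at_top[of 1]
    proof eventually_elim
      case (elim s)
      define T where "T = C0 * (\<Sum>i=1..l. fwd p s (int k * int i))"
      have F0: "fwd p s (int k * int i) \<ge> 0" if "i \<in> {1..l}" for i
      proof -
        have "0 \<le> int d * (int k * int i) * lead_coeff p * s ^ (d - 1)" using elim p by simp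
        also have "\<dots> \<le> 2 * fwd p s (int k * int i)" using elim(1) that by blast
        finally show ?thesis by simp
      qed
      have "0 \<le> T" unfolding T_def using C0 F0 by (intro mult_nonneg_nonneg sum_nonneg) auto
      moreover have "T \<le> C * int k * s ^ (d - 1)"
      proof -
        have "T \<le> C0 * (\<Sum>i=1..l. 2 * (int d * (int k * int i) * lead_coeff p) * s ^ (d - 1))"
          unfolding T_def using elim(1) C0 by (intro mult_left_mono sum_mono) auto
        also have "\<dots> = C * int k * s ^ (d - 1)"
          unfolding C_def by (simp add: sum_distrib_left sum_distrib_right algebra_simps)
        finally show ?thesis .
      qed
      moreover have "R * T + r * poly ((poly_diff (int k) ^^ l) p) s \<in> combos p (l * k) s"
        if r: "0 \<le> r" "r \<le> R" for R r
      proof -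
        have "R * T + r * poly ((poly_diff (int k) ^^ l) p) s =
           (\<Sum>i=1..l. (R * C0 + r * e i) * fwd p s (int (k * i)))"
          unfolding T_def e by (simp add: sum_distrib_left sum.distrib algebra_simps)
        also have "\<dots> \<in> combos p (l * k) s"
        proof (intro combos_sum combos_mult_fwd)
          fix i assume i: "i \<in> {1..l}"
          have "- (r * e i) \<le> r * \<bar>e i\<bar>" using r
            by (metis abs_ge_minus_self mult_left_mono mult_minus_right)
          also have "\<dots> \<le> R * C0" using r eC[OF i] by (intro mult_mono) auto
          finally show "0 \<le> R * C0 + r * e i" by simp
          show "k * i \<le> l * k" using i by (simp add: mult.commute)
        qed
        finally show ?thesis .
      qed
      ultimately show ?case by blast
    qed
  qed
  with C that show ?thesis by blast
qed

text \<open>Downward induction on \<open>l\<close>: a number of size \<open>s\<^sup>d\<^sup>-\<^sup>l\<^sup>+\<^sup>1\<close> is divided by an \<open>l\<close>-th difference of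
  step \<open>k\<close>. The signed coefficients are made nonnegative by adding \<open>b\<close>, whose relative cost \<open>k\<^sup>1\<^sup>-\<^sup>l\<close>
  is small for large \<open>k\<close>.\<close>

lemma combos_fill:
  assumes p: "degree p = d" "lead_coeff p > 0" and H: "H = fact d * lead_coeff p"
    and l: "1 \<le> l" "l \<le> d" and K: "0 \<le> K" and m: "1 \<le> m"
  shows "\<exists>h. \<forall>\<^sub>F s in at_top. \<exists>b\<in>combos p h s. H dvd b \<and> 0 \<le> b \<and> m * b \<le> s ^ d \<and>
    (\<forall>v. 0 \<le> v \<longrightarrow> v \<le> K * s ^ (d - l) \<longrightarrow> H dvd v \<longrightarrow> b + v \<in> combos p h s)"
  using l(2) l(1) K m
proof (induction l arbitrary: K m rule: inc_induct)
  case base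
  have "0 < fact d * lead_coeff p" using p by (intro mult_pos_pos) auto
  then have H1: "H \<ge> 1" using H by simp
  obtain C where C: "C \<ge> 0" "\<And>k. k \<ge> (1::nat) \<Longrightarrow> \<forall>\<^sub>F s in at_top. \<exists>T. 0 \<le> T \<and> T \<le> C * int k * s ^ (d - 1) \<and>
       (\<forall>R r. 0 \<le> r \<longrightarrow> r \<le> R \<longrightarrow> R * T + r * poly ((poly_diff (int k) ^^ d) p) s \<in> combos p (d * k) s)"
    using combos_level[OF p base(1) order_refl] by blast
  have deg: "degree ((poly_diff 1 ^^ d) p) = 0" "lead_coeff ((poly_diff 1 ^^ d) p) = H"
    using poly_diff_iter_lead[OF p, of 1 d] H by auto
  then have c: "(poly_diff 1 ^^ d) p = [:H:]" by (metis degree_eq_zeroE lead_coeff_pCons(2) pCons_0_0 lead_coeff_pCons(1))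
  have "\<forall>\<^sub>F s in at_top. \<exists>b\<in>combos p d s. H dvd b \<and> 0 \<le> b \<and> m * b \<le> s ^ d \<and>
    (\<forall>v. 0 \<le> v \<longrightarrow> v \<le> K * s ^ (d - d) \<longrightarrow> H dvd v \<longrightarrow> b + v \<in> combos p d s)"
    using C(2)[of 1, OF order_refl] eventually_ge_at_top[of "m * K * H * C + 1"]
  proof eventually_elim
    case (elim s)
    then obtain T where T: "0 \<le> T" "T \<le> C * s ^ (d - 1)"
      "\<And>R r. 0 \<le> r \<Longrightarrow> r \<le> R \<Longrightarrow> R * T + r * H \<in> combos p d s"
      using c by auto
    have s: "s \<ge> 1" using elim(2) C(1) base H1 by (smt (verit) mult_nonneg_nonneg)
    have "(K * H) * T \<in> combos p d s" using T(3)[of 0 "K * H"] base H1 by simp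
    moreover have "m * (K * H * T) \<le> s ^ d"
    proof -
      have "m * (K * H * T) \<le> m * (K * H * (C * s ^ (d - 1)))"
        using T base H1 by (intro mult_left_mono mult_nonneg_nonneg) auto
      also have "\<dots> = (m * K * H * C) * s ^ (d - 1)" by (simp add: algebra_simps)
      also have "\<dots> \<le> s * s ^ (d - 1)" using elim(2) s by (intro mult_right_mono) auto
      also have "\<dots> = s ^ d" using base by (metis One_nat_def Suc_pred less_eq_Suc_le power_Suc)
      finally show ?thesis .
    qed
    moreover have "K * H * T + v \<in> combos p d s" if v: "0 \<le> v" "v \<le> K" "H dvd v" for v
    proof -
      obtain r where r: "v = H * r" using v by blast
      have "0 \<le> r" using r v H1 by (simp add: zero_le_mult_iff)
      moreover have "r \<le> K * H"
      proof -
        have "r \<le> H * r" using \<open>0 \<le> r\<close> H1 by (simp add: mult_le_cancel_right1)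
        also have "\<dots> \<le> K" using r v by simp
        also have "\<dots> \<le> K * H" using H1 base by (simp add: mult_le_cancel_left1)
        finally show ?thesis .
      qed
      ultimately show ?thesis using T(3)[of r "K * H"] r by (simp add: mult.commute)
    qed
    ultimately show ?case using T(1) base H1
      by (intro bexI[of _ "K * H * T"]) auto
  qed
  then show ?case by blast
next
  case (step n)
  define l where "l = Suc n"
  have KP: "0 \<le> K" "1 \<le> m" using step.prems by auto
  have l: "1 \<le> l" "l \<le> d" "2 \<le> l" using step l_def by auto
  have "0 < fact d * lead_coeff p" using p by (intro mult_pos_pos) auto
  then have H1: "H \<ge> 1" using H by simp
  obtain C where C: "C \<ge> 0" "\<And>k. k \<ge> (1::nat) \<Longrightarrow> \<forall>\<^sub>F s in at_top. \<exists>T. 0 \<le> T \<and> T \<le> C * int k * s ^ (d - 1) \<and>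
       (\<forall>R r. 0 \<le> r \<longrightarrow> r \<le> R \<longrightarrow> R * T + r * poly ((poly_diff (int k) ^^ l) p) s \<in> combos p (l * k) s)"
    using combos_level[OF p l(1,2)] by blast
  \<comment> \<open>By \<open>c1\<close> the cost \<open>b1\<close> shrinks like \<open>k\<close> to
    the power \<open>1 - l\<close>, and \<open>l \<ge> 2\<close>; this \<open>k\<close> brings it
    down to half of the permitted \<open>s ^ d / m\<close>.\<close>
  define k where "k = nat (4 * m * H * K * C + 1)"
  have "0 \<le> 4 * m * H * K * C" using KP C H1 by (intro mult_nonneg_nonneg) auto
  then have k: "int k = 4 * m * H * K * C + 1" "k \<ge> 1" unfolding k_def by linarith+
  note k1 = k(2)
  define L where "L = fact d div fact (d - l) * int k ^ l * lead_coeff p"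
  define q where "q = (poly_diff (int k) ^^ l) p"
  have q: "degree q = d - l" "lead_coeff q = L"
    using poly_diff_iter_lead[OF p, of "int k" l] k1 l unfolding q_def L_def by auto
  have "(fact (d - l) :: int) dvd fact d" by (intro fact_dvd) auto
  then have "(fact d div fact (d - l) :: int) > 0"
    by (meson fact_gt_zero pos_imp_zdiv_pos_iff zdvd_imp_le)
  then have f1: "1 \<le> (fact d div fact (d - l) :: int) * lead_coeff p" using p(2)
    by (smt (verit) mult_pos_pos)
  have Lk: "int k ^ l \<le> L"
    unfolding L_def using mult_right_mono[OF f1, of "int k ^ l"] by (simp add: algebra_simps)
  have L0: "L > 0" using Lk k1 by (smt (verit) of_nat_0_less_iff zero_less_power less_eq_Suc_le One_nat_def)
  have lq: "lead_coeff q > 0" using q L0 by simp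
  \<comment> \<open>A remainder modulo \<open>H * D\<close> is at most
    \<open>2 * H * L * s ^ (d - l)\<close>. The doubled \<open>m\<close> reserves the other half of
    the permitted cost for it.\<close>
  obtain h' where h': "\<forall>\<^sub>F s in at_top. \<exists>b\<in>combos p h' s. H dvd b \<and> 0 \<le> b \<and> (2 * m) * b \<le> s ^ d \<and>
    (\<forall>v. 0 \<le> v \<longrightarrow> v \<le> (2 * H * L) * s ^ (d - l) \<longrightarrow> H dvd v \<longrightarrow> b + v \<in> combos p h' s)"
    using step.IH[of "2 * H * L" "2 * m"] step.prems H1 L0 l_def by auto
  define h where "h = max (l * k) h'"
  have "\<forall>\<^sub>F s in at_top. \<exists>b\<in>combos p h s. H dvd b \<and> 0 \<le> b \<and> m * b \<le> s ^ d \<and>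
    (\<forall>v. 0 \<le> v \<longrightarrow> v \<le> K * s ^ (d - n) \<longrightarrow> H dvd v \<longrightarrow> b + v \<in> combos p h s)"
    using C(2)[OF k1] h' eventually_poly_lower[OF lq] eventually_poly_upper[OF lq] eventually_ge_at_top[of 1]
  proof eventually_elim
    case (elim s)
    define D where "D = poly q s"
    obtain T where T: "0 \<le> T" "T \<le> C * int k * s ^ (d - 1)"
      "\<And>R r. 0 \<le> r \<Longrightarrow> r \<le> R \<Longrightarrow> R * T + r * D \<in> combos p (l * k) s"
      using elim(1) unfolding D_def q_def by blast
    obtain b' where b': "b' \<in> combos p h' s" "H dvd b'" "0 \<le> b'" "(2 * m) * b' \<le> s ^ d"
      "\<And>v. 0 \<le> v \<Longrightarrow> v \<le> (2 * H * L) * s ^ (d - l) \<Longrightarrow> H dvd v \<Longrightarrow> b' + v \<in> combos p h' s"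
      using elim(2) by blast
    have DL: "L * s ^ (d - l) \<le> 2 * D" and DU: "D \<le> 2 * L * s ^ (d - l)"
      using elim(3,4) q unfolding D_def by auto
    have sp: "s ^ (d - l) > 0" using elim(5) by simp
    have D0: "D > 0" using DL mult_pos_pos[OF L0 sp] by linarith
    \<comment> \<open>A bound for the digit \<open>r\<close> below, from
      \<open>v \<le> K * s ^ (d - n)\<close>, \<open>L * s ^ (d - l) \<le> 2 * D\<close> and
      \<open>int k ^ l \<le> L\<close>.\<close>
    define R0 where "R0 = (2 * K * s) div int k ^ l"
    have kl: "int k ^ l > 0" using k1 by simp
    have "0 \<le> 2 * K * s" using KP elim(5) by simp
    then have R00: "0 \<le> R0" unfolding R0_def using kl by (simp only: pos_imp_zdiv_nonneg_iff)
    have "int k ^ l * R0 = 2 * K * s - (2 * K * s) mod int k ^ l"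
      unfolding R0_def by (simp add: minus_mod_eq_mult_div)
    moreover have "(2 * K * s) mod int k ^ l \<ge> 0" using kl by (rule pos_mod_sign)
    ultimately have R01: "int k ^ l * R0 \<le> 2 * K * s" by linarith
    note R0 = R00 R01
    define b1 where "b1 = (H * R0) * T"
    have b10: "0 \<le> b1" unfolding b1_def using H1 R0 T by simp
    have dd: "s * s ^ (d - 1) = s ^ d" using l by (metis One_nat_def Suc_pred less_eq_Suc_le order_trans power_Suc)
    have c1: "int k ^ (l - 1) * b1 \<le> 2 * H * K * C * s ^ d"
    proof -
      have "int k * (int k ^ (l - 1) * b1) = (int k ^ l * R0) * (H * T)"
        unfolding b1_def using l(1) by (simp add: power_eq_if algebra_simps)
      also have "\<dots> \<le> (2 * K * s) * (H * (C * int k * s ^ (d - 1)))"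
        by (rule mult_mono[OF R01 mult_left_mono[OF T(2)]]) (use T H1 KP elim(5) in auto)
      also have "\<dots> = int k * (2 * H * K * C * (s * s ^ (d - 1)))" by (simp add: algebra_simps)
      finally show ?thesis using k1 dd by simp
    qed
    have c2: "2 * m * b1 \<le> s ^ d"
    proof -
      have "int k * (2 * m * b1) \<le> int k ^ (l - 1) * (2 * m * b1)"
        using l(3) k1 b10 KP by (intro mult_right_mono) (auto intro: self_le_power)
      also have "\<dots> = 2 * m * (int k ^ (l - 1) * b1)" by (simp add: algebra_simps)
      also have "\<dots> \<le> 2 * m * (2 * H * K * C * s ^ d)" using c1 KP by (intro mult_left_mono) auto
      also have "\<dots> = (4 * m * H * K * C) * s ^ d" by (simp add: algebra_simps)
      also have "\<dots> \<le> int k * s ^ d" using k(1) elim(5) by (intro mult_right_mono) auto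
      finally show ?thesis using k1 by simp
    qed
    have m1: "b1 \<in> combos p (l * k) s" unfolding b1_def using T(3)[of 0 "H * R0"] H1 R0 by simp
    have "b1 + b' + v \<in> combos p h s" if v: "0 \<le> v" "v \<le> K * s ^ (d - n)" "H dvd v" for v
    proof -
      \<comment> \<open>The digit is a multiple of \<open>H\<close>, so the remainder
        \<open>w\<close> inherits divisibility by \<open>H\<close> from \<open>v\<close>, as the
        induction hypothesis demands.\<close>
      define r where "r = H * (v div (H * D))"
      define w where "w = v mod (H * D)"
      have HD: "H * D > 0" using H1 D0 by simp
      have vw: "v = r * D + w" unfolding r_def w_def by (metis Groups.mult_ac(1,2) div_mult_mod_eq)
      have w0: "0 \<le> w" "w < H * D" unfolding w_def using HD by auto
      have r0: "0 \<le> r" unfolding r_def using HD v H1 by (simp add: pos_imp_zdiv_nonneg_iff)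
      have "int k ^ l * r \<le> 2 * K * s"
      proof -
        have "(int k ^ l * r) * s ^ (d - l) \<le> r * (L * s ^ (d - l))"
          using mult_right_mono[OF mult_right_mono[OF Lk r0], of "s ^ (d - l)"] sp by (simp add: algebra_simps)
        also have "\<dots> \<le> r * (2 * D)" using DL r0 by (intro mult_left_mono)
        also have "\<dots> \<le> 2 * v" using vw w0 by simp
        also have "\<dots> \<le> 2 * (K * s ^ (d - n))" using v by simp
        also have "d - n = Suc (d - l)" using l unfolding l_def by simp
        finally have "(int k ^ l * r) * s ^ (d - l) \<le> (2 * K * s) * s ^ (d - l)" by (simp add: algebra_simps)
        then show ?thesis using sp by simp
      qed
      then have "(int k ^ l * r) div int k ^ l \<le> R0" unfolding R0_def using kl by (intro zdiv_mono1)
      then have "r \<le> R0" using k1 by simp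
      also have "\<dots> \<le> H * R0" using H1 R0 by (simp add: mult_le_cancel_right1)
      finally have A: "b1 + r * D \<in> combos p (l * k) s" unfolding b1_def using T(3) r0 by blast
      have "H dvd w" unfolding w_def using v(3) by (simp add: dvd_mod)
      moreover have "w \<le> (2 * H * L) * s ^ (d - l)"
      proof -
        have "w \<le> H * D" using w0 by simp
        also have "\<dots> \<le> H * (2 * L * s ^ (d - l))" using DU H1 by (intro mult_left_mono) auto
        finally show ?thesis by (simp add: algebra_simps)
      qed
      ultimately have B: "b' + w \<in> combos p h' s" using b'(5) w0 by blast
      have "(b1 + r * D) + (b' + w) \<in> combos p h s"
        using combos_mono[OF A, of h] combos_mono[OF B, of h] combos_add unfolding h_def by auto
      then show ?thesis using vw by (simp add: algebra_simps)
    qed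
    moreover have "b1 + b' \<in> combos p h s"
      using combos_mono[OF m1, of h] combos_mono[OF b'(1), of h] combos_add unfolding h_def by auto
    moreover have "H dvd b1 + b'" using b'(2) unfolding b1_def by (simp add: dvd_add)
    moreover have "m * (b1 + b') \<le> s ^ d" using c2 b'(4) by (simp add: algebra_simps)
    ultimately show ?case using b10 b'(3) by (intro bexI[of _ "b1 + b'"]) auto
  qed
  then show ?case by blast
qed

text \<open>The residue of \<open>u\<close> is supplied by \<open>(H - 1) * fwd p s i\<close>, which
  is congruent to \<open>- fwd p s i\<close> modulo \<open>H\<close>. What is left is a multiple of
  \<open>H\<close>; copies of \<open>H * fwd p s 1\<close> reduce it to a remainder within the reach
  of \<open>combos_fill\<close>. The two fixed costs are at most \<open>s ^ d / 8\<close> each,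
  while \<open>u \<ge> s ^ d / 4\<close>.\<close>

lemma combos_large:
  assumes p: "degree p = d" "1 \<le> d" "lead_coeff p > 0" and H: "int H = fact d * lead_coeff p"
  shows "\<exists>h. \<forall>\<^sub>F s in at_top. \<forall>u i. poly p s \<le> 2 * u \<longrightarrow> i \<le> H \<longrightarrow> int H dvd u + fwd p s (int i) \<longrightarrow> u \<in> combos p h s"
proof -
  define a where "a = lead_coeff p"
  have a: "a \<ge> 1" using p a_def by simp
  have "0 < fact d * lead_coeff p" using p by (intro mult_pos_pos) auto
  then have H1: "H \<ge> 1" using H by simp
  define K where "K = int H * (2 * (int d * a))"
  have K: "0 \<le> K" unfolding K_def using a by simp
  obtain h0 where h0: "\<forall>\<^sub>F s in at_top. \<exists>b\<in>combos p h0 s. int H dvd b \<and> 0 \<le> b \<and> 8 * b \<le> s ^ d \<and>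
    (\<forall>v. 0 \<le> v \<longrightarrow> v \<le> K * s ^ (d - 1) \<longrightarrow> int H dvd v \<longrightarrow> b + v \<in> combos p h0 s)"
    using combos_fill[OF p(1,3) H order_refl p(2) K, of 8] by auto
  define h where "h = max h0 H"
  have fwd_ev: "\<forall>\<^sub>F s in at_top. \<forall>i\<in>{1..H}. int d * int i * lead_coeff p * s ^ (d - 1) \<le> 2 * fwd p s (int i) \<and>
        fwd p s (int i) \<le> 2 * (int d * int i * lead_coeff p) * s ^ (d - 1)"
    by (intro eventually_ball_finite ballI fwd_bounds) (use p in auto)
  have "\<forall>\<^sub>F s in at_top. \<forall>u i. poly p s \<le> 2 * u \<longrightarrow> i \<le> H \<longrightarrow> int H dvd u + fwd p s (int i) \<longrightarrow> u \<in> combos p h s"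
    using h0 fwd_ev eventually_poly_lower[OF p(3)] eventually_ge_at_top[of "16 * int H * int H * int d * a + 1"]
  proof eventually_elim
    case (elim s)
    have "0 \<le> 16 * int H * int H * int d * a" using a by simp
    then have s1: "s \<ge> 1" and s8: "16 * int H * int H * int d * a \<le> s"
      using elim(4) by linarith+
    have F1: "int d * a * s ^ (d - 1) \<le> 2 * fwd p s 1" "fwd p s 1 \<le> 2 * (int d * a) * s ^ (d - 1)"
      using elim(2) H1 a_def by (auto dest: bspec[of _ _ 1])
    have "0 < int d * a * s ^ (d - 1)" using p a s1 by simp
    then have F1p: "fwd p s 1 > 0" using F1 by linarith
    obtain b where b: "b \<in> combos p h0 s" "int H dvd b" "0 \<le> b" "8 * b \<le> s ^ d"
      "\<And>v. 0 \<le> v \<Longrightarrow> v \<le> K * s ^ (d - 1) \<Longrightarrow> int H dvd v \<Longrightarrow> b + v \<in> combos p h0 s"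
      using elim(1) by blast
    have dd: "s * s ^ (d - 1) = s ^ d" using p by (metis One_nat_def Suc_pred less_eq_Suc_le power_Suc)
    have "u \<in> combos p h s" if u: "poly p s \<le> 2 * u" and i: "i \<le> H" and dv: "int H dvd u + fwd p s (int i)" for u i
    proof -
      have su: "s ^ d \<le> 4 * u"
      proof -
        have "s ^ d \<le> a * s ^ d" using a s1 by (simp add: mult_le_cancel_right1)
        also have "\<dots> \<le> 2 * poly p s" using elim(3) p a_def by simp
        finally show ?thesis using u by simp
      qed
      have Fi: "0 \<le> fwd p s (int i)" "8 * ((int H - 1) * fwd p s (int i)) \<le> s ^ d"
      proof -
        show F0: "0 \<le> fwd p s (int i)"
        proof (cases "i = 0")
          case False
          then have "int d * int i * a * s ^ (d - 1) \<le> 2 * fwd p s (int i)" using elim(2) i a_def by auto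
          moreover have "0 \<le> int d * int i * a * s ^ (d - 1)" using a s1 by simp
          ultimately show ?thesis by linarith
        qed (simp add: fwd_def)
        show "8 * ((int H - 1) * fwd p s (int i)) \<le> s ^ d"
        proof (cases "i = 0")
          case False
          then have "fwd p s (int i) \<le> 2 * (int d * int i * a) * s ^ (d - 1)" using elim(2) i a_def by auto
          also have "\<dots> \<le> 2 * (int d * int H * a) * s ^ (d - 1)"
            using i a s1 by (intro mult_right_mono mult_left_mono) auto
          finally have "(int H - 1) * fwd p s (int i) \<le> int H * (2 * (int d * int H * a) * s ^ (d - 1))"
            using F0 H1 by (intro mult_mono) auto
          then have "8 * ((int H - 1) * fwd p s (int i)) \<le> (16 * int H * int H * int d * a) * s ^ (d - 1)"
            by (simp add: algebra_simps)
          also have "\<dots> \<le> s * s ^ (d - 1)" using s8 s1 by (intro mult_right_mono) auto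
          finally show ?thesis using dd by simp
        qed (use s1 in \<open>simp add: fwd_def\<close>)
      qed
      define y where "y = u - (int H - 1) * fwd p s (int i) - b"
      have y0: "0 \<le> y"
      proof -
        have "0 \<le> u - X - b" if "s ^ d \<le> 4 * u" "8 * X \<le> s ^ d" "8 * b \<le> s ^ d" "0 \<le> b" for X
          using that by linarith
        from this[OF su Fi(2) b(4,3)] show ?thesis unfolding y_def .
      qed
      have "y = (u + fwd p s (int i)) - int H * fwd p s (int i) - b" unfolding y_def by (simp add: algebra_simps)
      then have Hy: "int H dvd y" using dv b(2) by (simp add: dvd_diff)
      define v where "v = y mod (int H * fwd p s 1)"
      have HF: "int H * fwd p s 1 > 0" using H1 F1p by simp
      have v0: "0 \<le> v" "v < int H * fwd p s 1" unfolding v_def using HF by auto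
      have "v \<le> int H * (2 * (int d * a) * s ^ (d - 1))"
        using v0 mult_left_mono[OF F1(2), of "int H"] by linarith
      then have vK: "v \<le> K * s ^ (d - 1)" unfolding K_def by (simp add: algebra_simps)
      have "int H dvd v" unfolding v_def using Hy by (simp add: dvd_mod)
      then have "b + v \<in> combos p h0 s" using b(5) v0 vK by blast
      then have 1: "b + v \<in> combos p h s" using combos_mono h_def by (meson max.cobounded1)
      have 2: "(int H - 1) * fwd p s (int i) \<in> combos p h s"
        using H1 i h_def by (intro combos_mult_fwd) auto
      have "int H * (y div (int H * fwd p s 1)) \<ge> 0" using y0 HF H1 by (simp add: pos_imp_zdiv_nonneg_iff)
      then have 3: "int H * (y div (int H * fwd p s 1)) * fwd p s (int 1) \<in> combos p h s"
        using H1 h_def by (intro combos_mult_fwd) auto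
      have "y = int H * (y div (int H * fwd p s 1)) * fwd p s (int 1) + v"
        unfolding v_def by (simp add: algebra_simps flip: mult.assoc) 
      then have "u = (int H - 1) * fwd p s (int i) + (int H * (y div (int H * fwd p s 1)) * fwd p s (int 1) + (b + v))"
        unfolding y_def by linarith
      then show ?thesis using 1 2 3 combos_add by metis
    qed
    then show ?case by blast
  qed
  then show ?thesis by blast
qed

section \<open>Colour changes\<close>

text \<open>Numbers of an interval of length \<open>D\<close> are pairwise incongruent modulo
  \<open>D\<close>, so each exception lies on the progression of at most one of them.\<close>

lemma card_hits_progression:
  fixes E Y :: "int set" and D b :: int
  assumes "finite E" "Y \<subseteq> {a..<a + D}"
  shows "card {x \<in> Y. \<exists>j. x + b + j * D \<in> E} \<le> card E"
proof -
  define Z where "Z = {x \<in> Y. \<exists>j. x + b + j * D \<in> E}"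
  have "\<exists>e. e \<in> E \<and> D dvd e - b - x" if x: "x \<in> Z" for x
  proof -
    obtain j where "x + b + j * D \<in> E" using x unfolding Z_def by blast
    then show ?thesis by (intro exI[of _ "x + b + j * D"]) simp
  qed
  then obtain f where f: "\<And>x. x \<in> Z \<Longrightarrow> f x \<in> E \<and> D dvd f x - b - x"
    using bchoice[of Z "\<lambda>x e. e \<in> E \<and> D dvd e - b - x"] by blast
  have "inj_on f Z"
  proof (rule inj_onI)
    fix x x' assume x: "x \<in> Z" "x' \<in> Z" "f x = f x'"
    have "D dvd (f x - b - x') - (f x - b - x)" 
      using dvd_diff[of D "f x - b - x'" "f x - b - x"] f[OF x(1)] f[OF x(2)] x(3) by auto
    then have dv: "D dvd x - x'" by simp
    have "x \<in> {a..<a + D}" "x' \<in> {a..<a + D}" using x assms(2) Z_def by blast+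
    then have "\<bar>x - x'\<bar> < D" by auto
    then show "x = x'" using dv dvd_imp_le_int[of "x - x'" D] by force
  qed
  then have "card Z \<le> card E" using f assms(1) by (intro card_inj_on_le[of f]) auto
  then show ?thesis unfolding Z_def .
qed

text \<open>Pigeonhole: of \<open>card E + 1\<close> disjoint blocks of length \<open>L\<close>, one
  misses \<open>E\<close>.\<close>

lemma free_interval:
  fixes E :: "int set"
  assumes "finite E" "L > 0"
  obtains w where "a \<le> w" "w + L \<le> a + (int (card E) + 1) * L" "{w..<w + L} \<inter> E = {}"
proof -
  define B where "B i = {a + int i * L..<a + int i * L + L}" for i :: nat
  have "\<exists>i\<le>card E. B i \<inter> E = {}"
  proof (rule ccontr)
    assume "\<not> (\<exists>i\<le>card E. B i \<inter> E = {})"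
    then have "\<forall>i\<in>{..card E}. \<exists>e. e \<in> B i \<inter> E" by blast
    then obtain f where f: "\<forall>i\<in>{..card E}. f i \<in> B i \<inter> E" by metis
    have "inj_on f {..card E}"
    proof (rule inj_onI)
      fix i j assume ij: "i \<in> {..card E}" "j \<in> {..card E}" "f i = f j"
      have "f i \<in> B i" "f j \<in> B j" using f ij by blast+
      then have "int i * L < (int j + 1) * L" "int j * L < (int i + 1) * L"
        using ij(3) unfolding B_def by (auto simp: algebra_simps)
      then have "int i < int j + 1" "int j < int i + 1" using assms(2) by (simp_all only: mult_less_cancel_right_pos)
      then show "i = j" by simp
    qed
    then have "card {..card E} \<le> card E"
      using f assms(1) by (intro card_inj_on_le[of f]) auto
    then show False by simp
  qed
  then obtain i where i: "i \<le> card E" "B i \<inter> E = {}" by blast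
  show ?thesis
  proof (rule that[of "a + int i * L"])
    show "a \<le> a + int i * L" using assms(2) by simp
    have "(int i + 1) * L \<le> (int (card E) + 1) * L" using i assms(2) by (intro mult_right_mono) auto
    then show "a + int i * L + L \<le> a + (int (card E) + 1) * L" by (simp add: algebra_simps)
    show "{a + int i * L..<a + int i * L + L} \<inter> E = {}" using i B_def by simp
  qed
qed

text \<open>A set that is mapped into itself by both a shift up and a shift down is mapped onto itself by
  the rotation of an interval whose length is the sum of the shifts.\<close>

lemma shift_invariant:
  fixes D D' w L :: int
  assumes D: "0 < D" "0 < D'" "D + D' \<le> L"
    and up: "\<And>x. w \<le> x \<Longrightarrow> x + D < w + L \<Longrightarrow> Q x \<Longrightarrow> Q (x + D)"
    and down: "\<And>x. w \<le> x - D' \<Longrightarrow> x < w + L \<Longrightarrow> Q x \<Longrightarrow> Q (x - D')"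
  shows "w \<le> x \<Longrightarrow> x + D < w + L \<Longrightarrow> Q (x + D) = Q x"
    and "w \<le> x \<Longrightarrow> x + D' < w + L \<Longrightarrow> Q (x + D') = Q x"
proof -
  \<comment> \<open>On a window of length \<open>D + D'\<close> the map \<open>f\<close> is
    injective and sends the finite set \<open>C\<close> into itself, hence onto itself; this gives
    the converse implications.\<close>
  have rot: "f ` C = C \<and> inj_on f {v..<v + D + D'}"
    if v: "w \<le> v" "v + D + D' \<le> w + L"
      and f: "f = (\<lambda>x. if x < v + D' then x + D else x - D')" and C: "C = {x \<in> {v..<v + D + D'}. Q x}" for v f C
  proof -
    have inj: "inj_on f {v..<v + D + D'}" unfolding f inj_on_def using D by auto
    have sub: "f ` C \<subseteq> C"
    proof
      fix y assume "y \<in> f ` C"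
      then obtain x where x: "x \<in> C" "y = f x" by blast
      show "y \<in> C"
      proof (cases "x < v + D'")
        case True
        then show ?thesis using x up[of x] v D unfolding C f by auto
      next
        case False
        then show ?thesis using x down[of x] v D unfolding C f by auto
      qed
    qed
    have "inj_on f C" using inj C by (auto intro: inj_on_subset)
    moreover have "finite C" by (rule finite_subset[of _ "{v..<v + D + D'}"]) (auto simp: C)
    ultimately have "f ` C = C" using endo_inj_surj sub by blast
    then show ?thesis using inj by blast
  qed
  have main: "Q (f x) = Q x" if v: "w \<le> v" "v + D + D' \<le> w + L" "x \<in> {v..<v + D + D'}"
      and f: "f = (\<lambda>x. if x < v + D' then x + D else x - D')" for v f x
  proof -
    define C where "C = {x \<in> {v..<v + D + D'}. Q x}"
    have r: "f ` C = C" "inj_on f {v..<v + D + D'}" using rot[OF v(1,2) f C_def] by auto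
    have fx: "f x \<in> {v..<v + D + D'}" using v(3) f D by auto
    show ?thesis
    proof
      assume "Q (f x)"
      then have "f x \<in> f ` C" using r fx C_def by blast
      then obtain y where y: "y \<in> C" "f x = f y" by blast
      then have "x = y" using r(2) v(3) C_def by (auto dest: inj_onD)
      then show "Q x" using y C_def by blast
    next
      assume "Q x"
      then have "f x \<in> C" using r(1) v(3) C_def by blast
      then show "Q (f x)" using C_def by blast
    qed
  qed
  show "Q (x + D) = Q x" if x: "w \<le> x" "x + D < w + L"
  proof -
    \<comment> \<open>The window starts at \<open>x\<close> unless it would stick out; it then ends
      at the upper end of the interval, and \<open>x + D < w + L\<close> still places
      \<open>x\<close> among its first \<open>D'\<close> members.\<close>
    define v where "v = min x (w + L - D - D')"
    have "w \<le> v" "v + D + D' \<le> w + L" "x \<in> {v..<v + D + D'}" "x < v + D'" using x D unfolding v_def by auto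
    then show ?thesis using main[of v x, OF _ _ _ refl] by simp
  qed
  show "Q (x + D') = Q x" if x: "w \<le> x" "x + D' < w + L"
  proof -
    define v where "v = min x (w + L - D - D')"
    have "w \<le> v" "v + D + D' \<le> w + L" "x + D' \<in> {v..<v + D + D'}" "\<not> x + D' < v + D'" using x D unfolding v_def by auto
    then show ?thesis using main[of v "x + D'", OF _ _ _ refl] by simp
  qed
qed

text \<open>Euclid's algorithm by subtraction, in the manner of Fine and Wilf: if \<open>g\<close>
  and \<open>D\<close> are periods, so is \<open>D - g\<close>, because \<open>L \<ge> 2 * M\<close>
  leaves room either to go up by \<open>D\<close> before going down by \<open>g\<close> or the other
  way round.\<close>

lemma common_period:
  fixes w L M :: int and Q :: "int \<Rightarrow> bool"
  defines "per \<equiv> \<lambda>D. \<forall>x. w \<le> x \<longrightarrow> x + D < w + L \<longrightarrow> Q (x + D) = Q x"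
  assumes L: "2 * M \<le> L" and D0: "0 < D0" "D0 \<le> M" "per D0"
  obtains g where "0 < g" "per g" "\<And>D. 0 < D \<Longrightarrow> D \<le> M \<Longrightarrow> per D \<Longrightarrow> g dvd D"
proof -
  define g where "g = int (LEAST k. 0 < k \<and> per (int k))"
  have ex: "\<exists>k. 0 < k \<and> per (int k)" using D0 by (intro exI[of _ "nat D0"]) auto
  have g: "0 < g" "per g" using LeastI_ex[OF ex] unfolding g_def by auto
  have least: "g \<le> D" if "0 < D" "per D" for D
    unfolding g_def using Least_le[of "\<lambda>k. 0 < k \<and> per (int k)" "nat D"] that by auto
  have "g dvd D" if "0 < D" "D \<le> M" "per D" for D
    using that
  proof (induction "nat D" arbitrary: D rule: less_induct)
    case less
    have gD: "g \<le> D" using least less.prems by blast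
    show ?case
    proof (cases "g = D")
      case False
      have "per (D - g)" unfolding per_def
      proof (intro allI impI)
        fix x assume x: "w \<le> x" "x + (D - g) < w + L"
        show "Q (x + (D - g)) = Q x"
        proof (cases "x + D < w + L")
          case True
          then have "Q (x + D) = Q x" using less.prems(3) x unfolding per_def by blast
          moreover have "Q (x + (D - g) + g) = Q (x + (D - g))"
            using g(2)[unfolded per_def, rule_format, of "x + (D - g)"] x True gD by simp
          ultimately show ?thesis by simp
        next
          case False
          then have lo: "w \<le> x - g" using L less.prems gD by linarith
          have "Q (x - g + g) = Q (x - g)" using g(2)[unfolded per_def, rule_format, of "x - g"] x lo gD g(1) False less.prems by simp
          moreover have "Q (x - g + D) = Q (x - g)"
            using less.prems(3)[unfolded per_def, rule_format, of "x - g"] x lo by (simp add: algebra_simps)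
          ultimately show ?thesis by (simp add: algebra_simps)
        qed
      qed
      then have "g dvd D - g" using less.hyps[of "D - g"] less.prems g gD False by auto
      then show ?thesis using dvd_add[of g "D - g" g] by simp
    qed simp
  qed
  with g that show ?thesis by blast
qed

text \<open>\<open>E\<close> stands for the numbers in monochromatic solutions. All three members of
  such a solution lie in \<open>E\<close>, so the assumption may speak of \<open>x\<close> alone. It
  is stable under enlarging \<open>E\<close>, which later admits the midpoints \<open>x\<close> with
  \<open>2 * x = P z\<close>.\<close>

locale sparse_colouring =
  fixes P :: "int \<Rightarrow> int" and n :: int and red :: "int \<Rightarrow> bool" and E :: "int set"
  assumes finE: "finite E"
    and no_mono: "\<lbrakk>x \<notin> E; 1 \<le> x; x \<le> n; 1 \<le> y; y \<le> n; 1 \<le> z; z \<le> n; x \<noteq> y; x \<noteq> z; y \<noteq> z;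
      x + y = P z; red x = red y; red y = red z\<rbrakk> \<Longrightarrow> False"
begin

section \<open>Spreading a colour by shifts\<close>

lemma colour_shift:
  assumes "red z = c" "red z' = (\<not> c)" "red x = c" "x \<notin> E" "x' \<notin> E" "y = P z - x" "y = P z' - x'"
    and "1 \<le> x" "x \<le> n" "1 \<le> x'" "x' \<le> n" "1 \<le> y" "y \<le> n" "1 \<le> z" "z \<le> n" "1 \<le> z'" "z' \<le> n"
    and "x \<noteq> y" "x \<noteq> z" "y \<noteq> z" "x' \<noteq> y" "x' \<noteq> z'" "y \<noteq> z'"
  shows "red x' = c"
proof (rule ccontr)
  assume r: "red x' \<noteq> c"
  have "x + y = P z" "x' + y = P z'" using assms(6,7) by simp_all
  then have "red y \<noteq> c" "red y = c"
    using no_mono[of x y z] no_mono[of x' y z'] assms(1-5,8-) r by metis+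
  then show False by simp
qed

text \<open>A union bound over the \<open>h\<close> progressions. The offsets \<open>b i\<close> can
  be fixed in advance because the displacement before each stage of a climb does not depend on where
  the climb starts.\<close>

lemma avoiding_start:
  fixes b F :: "nat \<Rightarrow> int"
  assumes "Y \<subseteq> {a..<a + D}" "\<And>i. i \<in> {1..h} \<Longrightarrow> D \<le> F i" "h * card E < card Y"
  obtains x where "x \<in> Y" "\<And>i j. i \<in> {1..h} \<Longrightarrow> x + b i + j * F i \<notin> E"
proof -
  define Z where "Z i = {x \<in> Y. \<exists>j. x + b i + j * F i \<in> E}" for i
  have finY: "finite Y" using assms(1) finite_subset by blast
  have "card (\<Union>i\<in>{1..h}. Z i) \<le> (\<Sum>i\<in>{1..h}. card (Z i))" by (intro card_UN_le) auto
  also have "\<dots> \<le> (\<Sum>i\<in>{1..h}. card E)"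
  proof (intro sum_mono)
    fix i assume i: "i \<in> {1..h}"
    have "Y \<subseteq> {a..<a + F i}" using assms(1) assms(2)[OF i] by force
    then show "card (Z i) \<le> card E" unfolding Z_def by (rule card_hits_progression[OF finE])
  qed
  also have "\<dots> = h * card E" by simp
  finally have "card (\<Union>i\<in>{1..h}. Z i) < card Y" using assms(3) by simp
  moreover have "finite (\<Union>i\<in>{1..h}. Z i)" using finY Z_def by auto
  ultimately have "\<not> Y \<subseteq> (\<Union>i\<in>{1..h}. Z i)" using card_mono by (meson not_le)
  then obtain x where "x \<in> Y" "\<forall>i\<in>{1..h}. x \<notin> Z i" by blast
  then show ?thesis using that unfolding Z_def by blast
qed

text \<open>The colour \<open>c\<close> climbs from a small \<open>x\<close> of that colour up to \<open>P s - (\<sigma> - x)\<close>, where it completes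
  a monochromatic solution with \<open>s\<close> and \<open>\<sigma> - x\<close>.\<close>

lemma no_clean_change:
  fixes F :: "nat \<Rightarrow> int" and r :: "nat \<Rightarrow> nat"
  assumes s: "1 \<le> s" "s + int h \<le> n" "P s \<le> n" "2 * s < P s" and h: "1 \<le> h"
    and F: "\<And>i. F i = P (s + int i) - P s" "\<And>i. i \<in> {1..h} \<Longrightarrow> F 1 \<le> F i" "s \<le> F 1"
    and col: "red s = c" "\<And>i. i \<in> {1..h} \<Longrightarrow> red (s + int i) = (\<not> c)"
    and mid: "\<And>x i. i \<le> h \<Longrightarrow> 2 * x = P (s + int i) \<Longrightarrow> x \<in> E"
    and Y: "\<And>x. x \<in> Y \<Longrightarrow> int h < x \<and> x < s \<and> red x = c \<and> int h < \<sigma> - x \<and> \<sigma> - x < s \<and> red (\<sigma> - x) = c"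
    and cY: "h * card E < card Y"
    and u: "P s - \<sigma> = (\<Sum>i=1..h. int (r i) * F i)"
  shows False
proof -
  \<comment> \<open>The climb has \<open>h\<close> stages; stage \<open>i\<close> consists of
    \<open>r i\<close> steps of length \<open>F i\<close>, and \<open>b i\<close> is the
    displacement after it.\<close>
  define b where "b i = (\<Sum>i'=1..i. int (r i') * F i')" for i
  have Fp: "F i > 0" if "i \<in> {1..h}" for i using F(2)[OF that] F(3) s by linarith
  have bS: "b i = b (i - 1) + int (r i) * F i" if "i \<in> {1..h}" for i
    using that unfolding b_def by (cases i) auto
  obtain x where x: "x \<in> Y" and av: "\<And>i j. i \<in> {1..h} \<Longrightarrow> x + b (i - 1) + j * F i \<notin> E"
  proof (rule avoiding_start[of Y 1 "s" h F "\<lambda>i. b (i - 1)"])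
    show "Y \<subseteq> {1..<1 + s}" using Y by force
    show "s \<le> F i" if "i \<in> {1..h}" for i using F(2)[OF that] F(3) by linarith
    show "h * card E < card Y" by (rule cY)
  qed (use that in blast)
  define x' where "x' = \<sigma> - x"
  have xx: "int h < x" "x < s" "red x = c" "int h < x'" "x' < s" "red x' = c" using Y[OF x] x'_def by auto
  have Fnn: "0 \<le> int (r i) * F i" if "i \<in> {1..h}" for i using Fp[OF that] by simp
  have bmono: "b i \<le> b h" if "i \<le> h" for i
    unfolding b_def using that by (intro sum_mono2 Fnn) auto
  have top: "x + b h = P s - x'" using u unfolding b_def x'_def by simp
  \<comment> \<open>The second part of the invariant keeps the current place away from
    \<open>s\<close>: it is either \<open>x < s\<close> or at least
    \<open>x + F 1 > s\<close>.\<close>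
  have climb: "red (x + b (i - 1) + int j * F i) = c \<and>
      (x + b (i - 1) + int j * F i = x \<or> x + b (i - 1) + int j * F i \<ge> x + F 1)"
    if i: "i \<in> {1..h}" and start: "red (x + b (i - 1)) = c" "b (i - 1) = 0 \<or> b (i - 1) \<ge> F 1" and j: "j \<le> r i" for i j
    using j
  proof (induction j)
    case 0
    then show ?case using start by auto
  next
    case (Suc j)
    define w where "w = x + b (i - 1) + int j * F i"
    have w: "red w = c" "w = x \<or> w \<ge> x + F 1" using Suc unfolding w_def by auto
    have w': "x + b (i - 1) + int (Suc j) * F i = w + F i" unfolding w_def by (simp add: algebra_simps)
    have "int (Suc j) * F i \<le> int (r i) * F i" using Suc Fp[OF i] by (intro mult_right_mono) auto
    then have "w + F i \<le> x + b i" unfolding w'[symmetric] bS[OF i] by simp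
    also have "\<dots> \<le> P s - x'" using bmono[of i] i top by simp
    finally have wt: "w + F i \<le> P s - x'" .
    have wE: "w \<notin> E" unfolding w_def by (rule av[OF i])
    have wE': "w + F i \<notin> E" using av[OF i, of "int (Suc j)"] unfolding w' .
    note wE = wE wE'
    have F1i: "F 1 \<le> F i" using F(2)[OF i] .
    have m: "2 * w \<noteq> P s" "2 * (w + F i) \<noteq> P (s + int i)"
      using mid[of 0 w] mid[of i "w + F i"] wE i by auto
    \<comment> \<open>The partner \<open>P s - w\<close> is at least \<open>x' + F i\<close>, hence
      beyond \<open>s + h\<close>, as \<open>x' > h\<close> and \<open>F i \<ge> s\<close>; likewise
      \<open>w + F i > s + h\<close>. Since midpoints lie in \<open>E\<close>, the partner also
      differs from both \<open>w\<close> and \<open>w + F i\<close>.\<close>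
    have "red (w + F i) = c"
    proof (rule colour_shift[of s c "s + int i" w "w + F i" "P s - w"])
      show "P s - w = P (s + int i) - (w + F i)" using F(1)[of i] by simp
      show "red (s + int i) = (\<not> c)" using col(2)[OF i] .
      show "w \<noteq> P s - w"
      proof
        assume "w = P s - w"
        then have "2 * w = P s" by linarith
        with m show False by simp
      qed
      show "w + F i \<noteq> P s - w"
      proof
        assume "w + F i = P s - w"
        then have "2 * (w + F i) = P (s + int i)" using F(1)[of i] by (simp add: algebra_simps)
        with m show False by simp
      qed
      show "w \<noteq> s" using w(2) xx F(3) h by linarith
    qed (use col w wE wt F1i F(3) xx s i h in \<open>auto\<close>)
    then show ?case using w w' F1i xx Fp[OF i] by auto
  qed
  have "red (x + b i) = c \<and> (b i = 0 \<or> b i \<ge> F 1)" if "i \<le> h" for i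
    using that
  proof (induction i)
    case 0
    then show ?case using xx by (simp add: b_def)
  next
    case (Suc i)
    then show ?case using climb[of "Suc i" "r (Suc i)"] bS[of "Suc i"] by (auto simp: add.assoc)
  qed
  then have "red (P s - x') = c" using top by fastforce
  moreover have "P s - x' \<notin> E" using av[of h "int (r h)"] bS[of h] h top by (simp add: add.assoc)
  ultimately show False using no_mono[of "P s - x'" x' s] xx s col(1) by auto
qed

text \<open>Since \<open>c\<close> occurs on both sides of the other colour, both colours are preserved by shifts in both
  directions, hence periodic on intervals free of exceptions; the reflection \<open>x \<mapsto> P z - x\<close>, which
  exchanges the colours, contradicts this.\<close>

lemma no_double_change:
  fixes F :: "nat \<Rightarrow> int"
  assumes s: "1 \<le> s" "s + int h \<le> n" "P (s + int h) \<le> n"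
    and F: "\<And>i. F i = P (s + int i) - P s" "F h \<le> M"
    and gap: "\<And>z z'. s \<le> z \<Longrightarrow> z < z' \<Longrightarrow> z' \<le> s + int h \<Longrightarrow> int H * (int (card E) + 1) \<le> P z' - P z"
    and col: "red s = c" "red (s + 1) = (\<not> c)" "red (s + int j) = c" "1 \<le> j" "j \<le> h"
    and mid: "\<And>x i. i \<le> h \<Longrightarrow> 2 * x = P (s + int i) \<Longrightarrow> x \<in> E"
    and H: "1 \<le> H" "\<And>g. (\<And>i. i \<le> h \<Longrightarrow> g dvd F i) \<Longrightarrow> g dvd int H"
    and even: "even (P s) \<or> even (P (s + 1))"
    and room: "2 * (s + int h + 1) + 2 * ((int (card E) + 1) * (2 * M)) \<le> P s"
  shows False
proof -
  have Hg: "0 < int H * (int (card E) + 1)" using H(1) by simp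
  have mono: "P z < P z'" if "s \<le> z" "z < z'" "z' \<le> s + int h" for z z' using gap[OF that] Hg by linarith
  have F1: "0 < F 1" using mono[of s "s + 1"] col F(1) by simp
  have h1: "1 \<le> h" using col by simp
  have Fh: "F i \<le> M" if "i \<le> h" for i
    using mono[of "s + int i" "s + int h"] F that by (cases "i = h") auto
  have M: "0 < M" using F1 Fh[of 1] h1 by linarith
  \<comment> \<open>Every shift used is at most \<open>M\<close>, so this length serves both the
    rotations, which need the sum of two shifts, and the common period.\<close>
  define L where "L = 2 * M"
  have L0: "0 < L" using M L_def by simp
  obtain w where w: "s + int h + 1 \<le> w" "w + L \<le> s + int h + 1 + (int (card E) + 1) * L" "{w..<w + L} \<inter> E = {}"
    using free_interval[OF finE, of L] M L_def by auto
  \<comment> \<open>The window stays below half of \<open>P s\<close>; thus the partner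
    \<open>P z - x\<close> of a point of the window lies above it.\<close>
  have hi: "2 * w + 2 * L \<le> P s" 
  proof -
    have "2 * a \<le> q" if "a \<le> b + X" "2 * b + 2 * X \<le> q" for a b X q :: int using that by linarith
    from this[OF w(2) room[folded L_def]] show ?thesis by (simp only: distrib_left)
  qed
  have Pj: "P s \<le> P z \<and> P z - P s \<le> M \<and> P z \<le> n" if "s \<le> z" "z \<le> s + int h" for z
  proof (intro conjI)
    show "P s \<le> P z" using mono[of s z] that by (cases "z = s") auto
    show "P z \<le> n" using mono[of z "s + int h"] that s by (cases "z = s + int h") auto
    have "P z - P s = F (nat (z - s))" using F(1) that by simp
    then show "P z - P s \<le> M" using Fh[of "nat (z - s)"] that by auto
  qed
  have shift: "red x' = e" if z: "s \<le> z" "z \<le> s + int h" "s \<le> z'" "z' \<le> s + int h" "red z = e" "red z' = (\<not> e)"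
    and x: "red x = e" "w \<le> x" "x < w + L" "w \<le> x'" "x' < w + L" "x' - x = P z' - P z" for z z' x x' e
  proof (rule colour_shift[of z e z' x x' "P z - x"])
    have "x \<notin> E" "x' \<notin> E" using x w(3) by auto
    then show "x \<notin> E" "x' \<notin> E" .
    have *: "P s \<le> P z" "P z \<le> n" "P s \<le> P z'" "P z' \<le> n" using Pj z by blast+
    have y: "s + int h < P z - x" "x < P z - x" "x' < P z - x" using x * hi w(1) L0 by linarith+
    show "x \<noteq> P z - x" "x' \<noteq> P z - x" "P z - x \<noteq> z" "P z - x \<noteq> z'" using y z by linarith+
    show "P z - x = P z' - x'" using x by linarith
    show "x \<le> n" "x' \<le> n" "P z - x \<le> n" "1 \<le> P z - x" "1 \<le> x" "1 \<le> x'" "x \<noteq> z" "x' \<noteq> z'"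
      using x y * w(1) z s L0 by linarith+
    show "1 \<le> z" "z \<le> n" "1 \<le> z'" "z' \<le> n" using z s by linarith+
    show "red z = e" "red z' = (\<not> e)" "red x = e" using z x by blast+
  qed simp
  define per where "per D = (\<forall>x. w \<le> x \<longrightarrow> x + D < w + L \<longrightarrow> (red (x + D) = c) = (red x = c))" for D
  \<comment> \<open>A downward shift for \<open>c\<close>: it leads from \<open>s + j\<close>, which
    has the colour \<open>c\<close>, to \<open>s + 1\<close>, which lacks it.\<close>
  define D' where "D' = P (s + int j) - P (s + 1)"
  have j2: "2 \<le> j" using col by (cases "j = 1") auto
  have D': "0 < D'" "D' \<le> M"
    using mono[of "s + 1" "s + int j"] Pj[of "s + 1"] Pj[of "s + int j"] j2 col unfolding D'_def by auto
  have per_up: "per (P z' - P z) \<and> per D'" if z: "s \<le> z" "z < z'" "z' \<le> s + int h" "red z = c" "red z' = (\<not> c)" for z z'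
  proof -
    have a: "0 < P z' - P z" "P z' - P z + D' \<le> L"
      using mono[OF z(1-3)] Pj[of z] Pj[of z'] z D' L_def by auto
    have up: "red (x + (P z' - P z)) = c" if "w \<le> x" "x + (P z' - P z) < w + L" "red x = c" for x
      by (rule shift[of z z' c x]) (use that z a in \<open>simp_all\<close>)
    have down: "red (x - D') = c" if "w \<le> x - D'" "x < w + L" "red x = c" for x
      by (rule shift[of "s + int j" "s + 1" c x]) (use that col D' in \<open>simp_all add: D'_def\<close>)
    show ?thesis unfolding per_def
      using shift_invariant[of "P z' - P z" D' L w "\<lambda>x. red x = c", OF a(1) D'(1) a(2) up down] by blast
  qed
  have per_down: "per (P z' - P z)" if z: "s \<le> z" "z < z'" "z' \<le> s + int h" "red z = (\<not> c)" "red z' = c" for z z'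
  proof -
    have a: "0 < P z' - P z" "F 1 + (P z' - P z) \<le> L"
      using mono[OF z(1-3)] Pj[of z] Pj[of z'] z Fh[of 1] h1 L_def by auto
    have up: "red (x + F 1) = c" if "w \<le> x" "x + F 1 < w + L" "red x = c" for x
      by (rule shift[of s "s + 1" c x]) (use that col h1 F1 F(1)[of 1] in \<open>simp_all\<close>)
    have down: "red (x - (P z' - P z)) = c" if "w \<le> x - (P z' - P z)" "x < w + L" "red x = c" for x
      by (rule shift[of z' z c x]) (use that z a in \<open>simp_all\<close>)
    show ?thesis unfolding per_def
      using shift_invariant(2)[of "F 1" "P z' - P z" L w "\<lambda>x. red x = c", OF F1 a(1) a(2) up down] by blast
  qed
  have pF1: "per (F 1)" using per_up[of s "s + 1"] col h1 F(1) by auto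
  obtain g where g: "0 < g" "per g" "\<And>D. 0 < D \<Longrightarrow> D \<le> M \<Longrightarrow> per D \<Longrightarrow> g dvd D"
    using common_period[of M L "F 1" w "\<lambda>x. red x = c"] pF1 F1 Fh[of 1] h1 L_def unfolding per_def by auto
  have gopp: "g dvd P z' - P z" if z: "s \<le> z" "z \<le> s + int h" "s \<le> z'" "z' \<le> s + int h" "red z = c" "red z' = (\<not> c)" for z z'
  proof (cases z z' rule: linorder_cases)
    case less
    then show ?thesis using g(3)[of "P z' - P z"] per_up[of z z'] mono[of z z'] Pj[of z] Pj[of z'] z by auto
  next
    case equal
    then show ?thesis by simp
  next
    case greater
    then have "g dvd P z - P z'" using g(3)[of "P z - P z'"] per_down[of z' z] mono[of z' z] Pj[of z] Pj[of z'] z by auto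
    then show ?thesis by (simp add: dvd_diff_commute)
  qed
  \<comment> \<open>If \<open>z\<close> has the colour of \<open>s\<close>, the two are compared
    through \<open>s + 1\<close>, which is opposite to both.\<close>
  have gs: "g dvd P z - P s" if z: "s \<le> z" "z \<le> s + int h" for z
  proof (cases "red z = c")
    case True
    have "g dvd (P (s + 1) - P s) - (P (s + 1) - P z)"
      by (rule dvd_diff[OF gopp gopp]) (use z True col h1 in auto)
    then show ?thesis by simp
  next
    case False
    then show ?thesis using gopp[of s z] z col by auto
  qed
  then have "g dvd int H" using F(1) by (intro H(2)) auto
  then have gH: "g \<le> int H" using H(1) by (intro zdvd_imp_le) auto
  \<comment> \<open>A fixed point modulo \<open>g\<close> of the reflection
    \<open>x \<mapsto> P s - x\<close>. It exists because one of \<open>P s\<close> and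
    \<open>P (s + 1)\<close> is even and the two agree modulo \<open>g\<close>.\<close>
  obtain w0 where w0: "g dvd 2 * w0 - P s"
  proof -
    obtain i :: nat where i: "i \<le> h" "even (P (s + int i))" using even h1
      by (metis add.right_neutral le0 of_nat_0 of_nat_1)
    then obtain v where "P (s + int i) = 2 * v" by blast
    then show ?thesis using gs[of "s + int i"] i that[of v] by simp
  qed
  define x1 where "x1 = w + (w0 - w) mod g"
  have "g dvd (w0 - w) - (w0 - w) mod g" by (rule dvd_minus_mod)
  then have "g dvd (w0 - w) mod g - (w0 - w)" by (simp only: dvd_diff_commute)
  moreover have "x1 - w0 = (w0 - w) mod g - (w0 - w)" unfolding x1_def by simp
  ultimately have x1d: "g dvd x1 - w0" by metis
  have x1w: "w \<le> x1" "x1 < w + g" unfolding x1_def using g(1) by auto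
  note x1 = x1w x1d
  have same: "red y = red x1" if y: "w \<le> y" "y < w + L" "g dvd y - w0" for y
  proof -
    have st: "(red (w + t + int k * g) = c) = (red (w + t) = c)" if "0 \<le> t" "w + t + int k * g < w + L" for t k
      using that
    proof (induction k)
      case (Suc k)
      have e: "w + t + int (Suc k) * g = (w + t + int k * g) + g" by (simp add: algebra_simps)
      have "(red (w + t + int k * g + g) = c) = (red (w + t + int k * g) = c)"
        using g(2)[unfolded per_def, rule_format, of "w + t + int k * g"] Suc.prems e g(1) by auto
      moreover have "(red (w + t + int k * g) = c) = (red (w + t) = c)" using Suc e g(1) by auto
      ultimately show ?case using e by metis
    qed simp
    have "g dvd (y - w0) - (x1 - w0)" using y(3) x1(3) by (rule dvd_diff)
    then have "g dvd y - x1" by simp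
    then obtain k where k: "y - x1 = g * k" by (rule dvdE)
    have "k \<ge> 0"
    proof (rule ccontr)
      assume "\<not> k \<ge> 0"
      then have "g * k \<le> g * (-1)" using g(1) by (intro mult_left_mono) auto
      then show False using k y(1) x1(2) by simp
    qed
    then have "y = w + (x1 - w) + int (nat k) * g" using k by (simp add: algebra_simps)
    then show ?thesis using st[of "x1 - w" "nat k"] x1 y by auto
  qed
  \<comment> \<open>The colour changes in both senses between \<open>s\<close> and
    \<open>s + j\<close>, so there is an upward shift for the colour of \<open>x1\<close>, whichever
    it is.\<close>
  obtain z z' where z: "s \<le> z" "z < z'" "z' \<le> s + int h" "red z = red x1" "red z' = (\<not> red x1)"
  proof (cases "red x1 = c")
    case True
    then show ?thesis using that[of s "s + 1"] col h1 by auto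
  next
    case False
    then show ?thesis using that[of "s + 1" "s + int j"] col j2 by auto
  qed
  have nz: "nat (z - s) \<le> h" "nat (z' - s) \<le> h" using z by (simp_all add: nat_le_iff)
  define D where "D = P z' - P z"
  have D: "0 < D" "D \<le> M" "int H * (int (card E) + 1) \<le> D" "g dvd D"
    using mono[OF z(1-3)] Pj[of z] Pj[of z'] z gap[OF z(1-3)] dvd_diff[OF gs[of z'] gs[of z]] unfolding D_def
    by auto
  \<comment> \<open>These are \<open>card E + 1\<close> starting points in the class of
    \<open>w0\<close>, one more than \<open>E\<close> can spoil. Their spacing is
    \<open>g \<le> H\<close>, so \<open>gap\<close> makes room for them in \<open>D\<close>
    places.\<close>
  define Y where "Y = (\<lambda>i. x1 + g * int i) ` {..card E}"
  have "inj_on (\<lambda>i. x1 + g * int i) {..card E}" using g(1) by (auto simp: inj_on_def)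
  then have cY: "card Y = card E + 1" unfolding Y_def by (simp add: card_image)
  have Yr: "w \<le> y \<and> y < w + D \<and> g dvd y - w0" if "y \<in> Y" for y
  proof -
    have "y \<in> (\<lambda>i. x1 + g * int i) ` {..card E}" using that unfolding Y_def .
    then obtain i where i: "i \<le> card E" "y = x1 + g * int i" by (elim imageE) simp
    have "g * int i + g \<le> g * (int (card E) + 1)" using i g(1) by (simp add: distrib_left mult_left_mono)
    also have "\<dots> \<le> int H * (int (card E) + 1)" using gH by (intro mult_right_mono) auto
    finally have "y < w + D" using i(2) x1(2) D(3) by linarith
    moreover have "g dvd (x1 - w0) + g * int i" by (rule dvd_add[OF x1(3)]) simp
    moreover have "y - w0 = (x1 - w0) + g * int i" using i(2) by simp
    moreover have "0 \<le> g * int i" using g(1) by simp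
    then have "w \<le> y" using i(2) x1(1) by linarith
    ultimately show ?thesis by metis
  qed
  obtain y where y: "y \<in> Y" and av: "\<And>k. y + k * D \<notin> E"
  proof -
    obtain y where "y \<in> Y" "\<And>i k. i \<in> {1..1::nat} \<Longrightarrow> y + 0 + k * D \<notin> E"
    proof (rule avoiding_start[of Y w D 1 "\<lambda>_. D" "\<lambda>_. 0"])
      show "Y \<subseteq> {w..<w + D}" using Yr by force
      show "1 * card E < card Y" using cY by simp
    qed (use that in auto)
    then show ?thesis using that[of y] by auto
  qed
  have yw: "w \<le> y" "y < w + D" "g dvd y - w0" using Yr[OF y] by auto
  have yc: "red y = red x1" using same[of y] yw D L_def by auto
  have zb: "P s \<le> P z" "P z \<le> n" "P z' \<le> n" 
    using Pj[of z] Pj[of z'] z by auto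
  have climb: "red (y + int k * D) = red x1" if "y + int k * D \<le> P z - w" for k
    using that
  proof (induction k)
    case 0
    then show ?case using yc by simp
  next
    case (Suc k)
    define v where "v = y + int k * D"
    have e: "y + int (Suc k) * D = v + D" unfolding v_def by (simp add: algebra_simps)
    have vr: "red v = red x1" using Suc e D(1) unfolding v_def by auto
    have "0 \<le> int k * D" using D(1) by simp
    then have vy: "w \<le> v" using yw unfolding v_def by linarith
    have vE: "v \<notin> E" unfolding v_def by (rule av)
    have vE': "v + D \<notin> E" using av[of "int (Suc k)"] unfolding e .
    note vE = vE vE'
    have m: "2 * v \<noteq> P z" "2 * (v + D) \<noteq> P z'"
      using mid[of "nat (z - s)" v] mid[of "nat (z' - s)" "v + D"] vE z nz by auto
    have top: "v + D \<le> P z - w" using Suc.prems e by simp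
    have "red (v + D) = red x1"
    proof (rule colour_shift[of z "red x1" z' v "v + D" "P z - v"])
      show "v \<noteq> P z - v"
      proof
        assume "v = P z - v"
        then have "2 * v = P z" by linarith
        with m show False by simp
      qed
      show "v + D \<noteq> P z - v"
      proof
        assume "v + D = P z - v"
        then have "2 * (v + D) = P z'" unfolding D_def by (simp add: algebra_simps)
        with m show False by simp
      qed
      show "P z - v = P z' - (v + D)" unfolding D_def by simp
    qed (use z vr vE top vy w(1) zb s D(1) in auto)
    then show ?case using e by simp
  qed
  \<comment> \<open>The climb ends where the partner \<open>v' = P z - v\<close> falls into the
    first \<open>D\<close> places of the window. As \<open>2 * w0\<close>, \<open>P s\<close> and
    \<open>P z\<close> agree modulo \<open>g\<close>, \<open>v'\<close> is again in the class of
    \<open>w0\<close>, so \<open>v\<close>, \<open>v'\<close> and \<open>z\<close> share a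
    colour.\<close>
  define k where "k = (P z - w - y) div D"
  have k0: "0 \<le> k" unfolding k_def using D yw hi zb L_def by (simp add: pos_imp_zdiv_nonneg_iff)
  have kd: "P z - w - y = k * D + (P z - w - y) mod D" unfolding k_def by simp
  have md: "0 \<le> (P z - w - y) mod D" "(P z - w - y) mod D < D" using D(1) by auto
  define v where "v = y + k * D"
  define v' where "v' = P z - v"
  have v': "w \<le> v'" "v' < w + D" using kd md unfolding v'_def v_def by linarith+
  have rv: "red v = red x1" using climb[of "nat k"] k0 v' unfolding v'_def v_def by auto
  have "g dvd v' - w0"
  proof -
    have "v' - w0 = (P z - P s) - (2 * w0 - P s) - (y - w0) - k * D" unfolding v'_def v_def by simp
    moreover have "g dvd \<dots>"
      by (rule dvd_diff[OF dvd_diff[OF dvd_diff[OF gs w0] yw(3)] dvd_mult[OF D(4)]]) (use z in auto)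
    ultimately show ?thesis by metis
  qed
  then have rv': "red v' = red x1" using same[of v'] v' D L_def by auto
  have "v \<notin> E" using av v_def by blast
  moreover have "2 * v \<noteq> P z" using mid[of "nat (z - s)" v] z nz \<open>v \<notin> E\<close> by auto
  moreover have "w \<le> v" using yw k0 D(1) unfolding v_def by (simp add: add_increasing2)
  ultimately show False using no_mono[of v v' z] rv rv' z w(1) v' zb s unfolding v'_def by auto
qed

end

section \<open>Nonlinear polynomials\<close>

lemma diff_dvd_poly_diff: "(x - y) dvd poly p x - poly p (y :: int)"
proof (induction p)
  case (pCons a p)
  obtain k where k: "poly p x - poly p y = (x - y) * k" using pCons.IH by (rule dvdE)
  have "poly (pCons a p) x - poly (pCons a p) y = (x - y) * poly p x + y * (poly p x - poly p y)"
    by (simp add: algebra_simps)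
  then show ?case using k by simp
qed simp

lemma card_residue_class:
  fixes B c0 :: int and A H :: nat
  assumes "1 \<le> H"
  shows "A div H \<le> card {x \<in> {B..<B + int A}. int H dvd x - c0}"
proof -
  define f where "f i = B + (c0 - B) mod int H + int H * int i" for i :: nat
  have "inj_on f {..<A div H}" unfolding f_def inj_on_def using assms by auto
  moreover have "f ` {..<A div H} \<subseteq> {x \<in> {B..<B + int A}. int H dvd x - c0}"
  proof
    fix x assume "x \<in> f ` {..<A div H}"
    then obtain i where i: "i < A div H" "x = f i" by (elim imageE) simp
    have m: "0 \<le> (c0 - B) mod int H" "(c0 - B) mod int H < int H" using assms by auto
    have "H * (i + 1) \<le> H * (A div H)" using i by (intro mult_left_mono) auto
    also have "\<dots> \<le> A" by simp
    finally have "int H * int i + int H \<le> int A" by (metis distrib_left mult.right_neutral of_nat_1 of_nat_add of_nat_le_iff of_nat_mult)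
    then have "x < B + int A" using m i(2) unfolding f_def by linarith
    moreover have "B \<le> x" using m i(2) unfolding f_def by simp
    moreover have "int H dvd x - c0"
    proof -
      have "int H dvd (c0 - B) - (c0 - B) mod int H" by (rule dvd_minus_mod)
      then have "int H dvd int H * int i - ((c0 - B) - (c0 - B) mod int H)"
        by (rule dvd_diff[OF dvd_triv_left])
      moreover have "x - c0 = int H * int i - ((c0 - B) - (c0 - B) mod int H)" using i(2) unfolding f_def by simp
      ultimately show ?thesis by metis
    qed
    ultimately show "x \<in> {x \<in> {B..<B + int A}. int H dvd x - c0}" by simp
  qed
  ultimately have "card {..<A div H} \<le> card {x \<in> {B..<B + int A}. int H dvd x - c0}"
    by (intro card_inj_on_le[of f]) (auto intro: finite_subset[of _ "{B..<B + int A}"])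
  then show ?thesis by simp
qed

text \<open>Pigeonhole on the sums of ordered pairs, which lie in \<open>{1..2 * N}\<close>. With a
  popular sum \<open>\<sigma>\<close>, a climb of the fixed height \<open>P s - \<sigma>\<close>
  leads from many different \<open>x\<close> to the partner of another member of
  \<open>X\<close>.\<close>

lemma popular_sum:
  fixes X :: "int set"
  assumes X: "X \<subseteq> {1..int N}" and q: "2 * N * q < card X * card X"
  obtains \<sigma> where "q < card {x \<in> X. \<sigma> - x \<in> X}"
proof (rule ccontr)
  assume "\<not> thesis"
  then have le: "card {x \<in> X. \<sigma> - x \<in> X} \<le> q" for \<sigma> using that by (meson not_le)
  have fX: "finite X" using X finite_subset by blast
  let ?S = "SIGMA \<sigma>:{1..int (2 * N)}. {x \<in> X. \<sigma> - x \<in> X}"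
  have "card (X \<times> X) \<le> card ?S"
  proof (rule card_inj_on_le)
    show "inj_on (\<lambda>(x, x'). (x + x', x)) (X \<times> X)" by (auto simp: inj_on_def)
    show "(\<lambda>(x, x'). (x + x', x)) ` (X \<times> X) \<subseteq> ?S"
    proof clarsimp
      fix x x' assume "x \<in> X" "x' \<in> X"
      then have "1 \<le> x" "x \<le> int N" "1 \<le> x'" "x' \<le> int N" using X by auto
      then show "1 \<le> x + x' \<and> x + x' \<le> 2 * int N" by linarith
    qed
    show "finite ?S" using fX by (intro finite_SigmaI) auto
  qed
  also have "\<dots> = (\<Sum>\<sigma>\<in>{1..int (2 * N)}. card {x \<in> X. \<sigma> - x \<in> X})" using fX by (intro card_SigmaI) auto
  also have "\<dots> \<le> (\<Sum>\<sigma>\<in>{1..int (2 * N)}. q)" by (intro sum_mono le)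
  also have "\<dots> = 2 * N * q" by (simp only: sum_constant card_atLeastAtMost_int) (simp add: nat_mult_distrib)
  finally show False using q by (simp add: card_cartesian_product)
qed

lemma increments_ge:
  fixes P :: "int \<Rightarrow> int"
  assumes inc: "\<And>z. s \<le> z \<Longrightarrow> z \<le> P (z + 1) - P z" and s: "0 \<le> s" and z: "s \<le> z" "z < z'"
  shows "z \<le> P z' - P z"
  using z(2)
proof (induction z' rule: int_gr_induct)
  case base
  then show ?case using inc z by simp
next
  case (step i)
  then show ?case using inc[of i] s z by simp
qed

text \<open>For \<open>d \<ge> 2\<close> the first difference has positive degree, so a single shift
  at \<open>s\<close> has length at least \<open>s\<close>; for linear \<open>p\<close> it would be
  bounded.\<close>

lemma eventually_growth:
  assumes p: "degree p = d" "2 \<le> d" "lead_coeff p > 0"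
  shows "\<forall>\<^sub>F s in at_top. s \<le> fwd p s 1 \<and> 64 * s \<le> poly p s"
proof -
  define a where "a = lead_coeff p"
  have a: "1 \<le> a" using p a_def by simp
  have "\<forall>\<^sub>F s in at_top. int d * 1 * lead_coeff p * s ^ (d - 1) \<le> 2 * fwd p s 1 \<and>
    fwd p s 1 \<le> 2 * (int d * 1 * lead_coeff p) * s ^ (d - 1)"
    using p by (intro fwd_bounds) auto
  then show ?thesis using eventually_poly_lower[OF p(3)] eventually_ge_at_top[of 128]
  proof eventually_elim
    case (elim s)
    have s1: "1 \<le> s" "128 \<le> s" using elim by linarith+
    have "2 * s \<le> int d * a * s" using p(2) a s1 mult_mono[of 2 "int d" 1 a] by (intro mult_right_mono) auto
    also have "\<dots> \<le> int d * a * s ^ (d - 1)"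
      using p(2) a s1 by (intro mult_left_mono) (auto intro: self_le_power)
    also have "\<dots> \<le> 2 * fwd p s 1" using elim a_def by simp
    finally have 1: "s \<le> fwd p s 1" by simp
    have "128 * s \<le> s * s" using s1 by (intro mult_right_mono) auto
    also have "\<dots> = s ^ 2" by (simp add: power2_eq_square)
    also have "\<dots> \<le> s ^ d" using s1 p by (intro power_increasing) auto
    also have "\<dots> \<le> a * s ^ d" using a s1 by (simp add: mult_le_cancel_right1)
    also have "\<dots> \<le> 2 * poly p s" using elim p a_def by simp
    finally show ?case using 1 by simp
  qed
qed

text \<open>A change away from \<open>c\<close> is impossible once many numbers of size about
  \<open>A\<close> have the colour \<open>c\<close> and lie in the class of \<open>c0\<close>. As
  \<open>2 * c0 = p(ze)\<close>, sums of two of them are values of \<open>p\<close> modulo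
  \<open>H\<close>. The return of \<open>c\<close> within \<open>h\<close> places decides which of
  the two exclusion lemmas applies.\<close>

lemma no_colour_change:
  fixes p :: "int poly"
  assumes p: "degree p = d" "2 \<le> d" "lead_coeff p > 0" and H: "int H = fact d * lead_coeff p"
    and ze: "poly p ze = 2 * c0"
    and ev: "even (poly p 1 * poly p 2)"
  shows "\<exists>h K A0. \<forall>A\<ge>A0. \<forall>s n red E c X.
    sparse_colouring (poly p) n red E \<longrightarrow> X \<subseteq> {int A..<s} \<inter> {..4 * int A} \<longrightarrow> int A \<le> s \<longrightarrow>
    (\<forall>x\<in>X. red x = c \<and> int H dvd x - c0) \<longrightarrow> A \<le> 8 * H * card X \<longrightarrow> K * card E \<le> A \<longrightarrow>
    red s = c \<longrightarrow> red (s + 1) = (\<not> c) \<longrightarrow> poly p (s + int h) \<le> n \<longrightarrow> False"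
proof -
  define a where "a = lead_coeff p"
  have a: "1 \<le> a" using p a_def by simp
  have "0 < fact d * lead_coeff p" using p by (intro mult_pos_pos) auto
  then have H1: "1 \<le> H" using H by simp
  obtain h0 where h0: "\<forall>\<^sub>F s in at_top. \<forall>u i. poly p s \<le> 2 * u \<longrightarrow> i \<le> H \<longrightarrow> int H dvd u + fwd p s (int i) \<longrightarrow> u \<in> combos p h0 s"
    using combos_large[OF p(1) _ p(3) H] p(2) by auto
  define h where "h = h0 + d"
  have h1: "1 \<le> h" "d \<le> h" "h0 \<le> h" unfolding h_def using p by auto
  \<comment> \<open>The summands pay, in this order, for the popular sum, for a free window below
    half of \<open>p(s)\<close>, and for starting points spaced by up to \<open>H\<close>.\<close>
  define K where "K = 1024 * H * H * h + 64 * d * h + 2 * H"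
  define K1 where "K1 = (h + 2) * K + h"
  have "\<forall>\<^sub>F s in at_top. int d * int h * lead_coeff p * s ^ (d - 1) \<le> 2 * fwd p s (int h) \<and>
    fwd p s (int h) \<le> 2 * (int d * int h * lead_coeff p) * s ^ (d - 1)"
    using p h1 by (intro fwd_bounds) auto
  then have "\<forall>\<^sub>F s in at_top. (\<forall>u i. poly p s \<le> 2 * u \<longrightarrow> i \<le> H \<longrightarrow> int H dvd u + fwd p s (int i) \<longrightarrow> u \<in> combos p h0 s) \<and>
     s \<le> fwd p s 1 \<and> fwd p s (int h) \<le> 2 * (int d * int h * a) * s ^ (d - 1) \<and> a * s ^ d \<le> 2 * poly p s \<and> 64 * int h + 128 \<le> s"
    using h0 eventually_growth[OF p] eventually_poly_lower[OF p(3)] eventually_ge_at_top[of "64 * int h + 128"]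
    by eventually_elim (use p a_def in simp)
  then obtain s0 where s0: "\<And>s. s \<ge> s0 \<Longrightarrow> (\<forall>u i. poly p s \<le> 2 * u \<longrightarrow> i \<le> H \<longrightarrow> int H dvd u + fwd p s (int i) \<longrightarrow> u \<in> combos p h0 s) \<and>
     s \<le> fwd p s 1 \<and> fwd p s (int h) \<le> 2 * (int d * int h * a) * s ^ (d - 1) \<and> a * s ^ d \<le> 2 * poly p s \<and> 64 * int h + 128 \<le> s"
    unfolding eventually_at_top_linorder by blast
  have main: False
    if A: "nat s0 + 4 * K1 + 1 \<le> A" and sc: "sparse_colouring (poly p) n red E0" and X: "X \<subseteq> {int A..<s} \<inter> {..4 * int A}" and As: "int A \<le> s"
      and Xc: "\<forall>x\<in>X. red x = c \<and> int H dvd x - c0" and cX: "A \<le> 8 * H * card X" and KA: "4 * K * card E0 \<le> A"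
      and col: "red s = c" "red (s + 1) = (\<not> c)" and n: "poly p (s + int h) \<le> n" for A s n red E0 c X
  proof -
    have ss0: "s0 \<le> s" using A As by auto
    note S = s0[OF ss0]
    have S1: "64 * int h + 128 \<le> s" using S by blast
    have inc: "\<And>z. s \<le> z \<Longrightarrow> z \<le> poly p (z + 1) - poly p z" using s0 ss0 unfolding fwd_def by (meson order_trans)
    note inc' = increments_ge[of s "poly p", OF inc]
    define M where "M = fwd p s (int h)"
    define mids where "mids = {x. \<exists>i\<le>h. 2 * x = poly p (s + int i)}"
    \<comment> \<open>The at most \<open>h + 1\<close> midpoints are added to exclude equal
      summands; \<open>K1\<close> in the threshold for \<open>A\<close> absorbs them.\<close>
    define E where "E = E0 \<union> mids"
    have ms: "mids \<subseteq> (\<lambda>i. poly p (s + int i) div 2) ` {..h}" unfolding mids_def by force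
    have fm: "finite mids" using ms finite_surj by blast
    have "card mids \<le> card ((\<lambda>i. poly p (s + int i) div 2) ` {..h})" by (intro card_mono ms) simp
    also have "\<dots> \<le> h + 1" using card_image_le[of "{..h}"] by (metis Suc_eq_plus1 card_atMost finite_atMost)
    finally have cE: "card E \<le> card E0 + (h + 1)" unfolding E_def using card_Un_le[of E0 mids] by linarith
    interpret sparse_colouring "poly p" n red E
    proof
      show "finite E" unfolding E_def using sc fm sparse_colouring.finE by blast
      show False if "x \<notin> E" "1 \<le> x" "x \<le> n" "1 \<le> y" "y \<le> n" "1 \<le> z" "z \<le> n" "x \<noteq> y" "x \<noteq> z" "y \<noteq> z"
        "x + y = poly p z" "red x = red y" "red y = red z" for x y z
        using sparse_colouring.no_mono[OF sc, of x y z] that E_def by auto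
    qed
    have KE: "K * (card E + 1) \<le> A" 
    proof -
      have "2 * (K * (card E + 1)) \<le> 2 * (K * (card E0 + (h + 2)))" using cE by (intro mult_left_mono) auto
      also have "\<dots> = 2 * (K * card E0) + 2 * ((h + 2) * K)" by (simp add: algebra_simps)
      also have "\<dots> \<le> 2 * A"
      proof -
        have "4 * (K * card E0) \<le> A" using KA by (simp add: algebra_simps)
        moreover have "(h + 2) * K \<le> K1" unfolding K1_def by simp
        ultimately show ?thesis using A by linarith
      qed
      finally show ?thesis by simp
    qed
    have mono: "poly p z < poly p z'" if "s \<le> z" "z < z'" for z z' using inc'[of z z'] that S1 by linarith
    have d2: "s * s ^ (d - 1) = s ^ d" using p by (metis One_nat_def Suc_pred less_eq_Suc_le numeral_2_eq_2 order_trans power_Suc zero_less_one lessI less_imp_le)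
    have Ps: "s ^ d \<le> 2 * poly p s"
    proof -
      have "1 * s ^ d \<le> a * s ^ d" using a S1 by (intro mult_right_mono) auto
      then show ?thesis using S by linarith
    qed
    have sd: "128 * s \<le> s ^ d"
    proof -
      have "128 * s \<le> s * s" using S1 by (intro mult_right_mono) auto
      also have "\<dots> = s ^ 2" by (simp add: power2_eq_square)
      also have "\<dots> \<le> s ^ d" using S1 p by (intro power_increasing) auto
      finally show ?thesis .
    qed
    have P64: "64 * s \<le> poly p s" using Ps sd by linarith
    have Psn: "poly p s \<le> n" using n mono[of s "s + int h"] h1 by simp
    have shn: "s + int h \<le> n" using Psn P64 S1 by linarith
    show False
    proof (cases "\<exists>j\<in>{1..h}. red (s + int j) = c")
      case True
      then obtain j where j: "1 \<le> j" "j \<le> h" "red (s + int j) = c" by auto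
      show False
      proof (rule no_double_change[of s h "\<lambda>i. fwd p s (int i)" M H c j])
        show "1 \<le> s" using S1 by simp
        show "s + int h \<le> n" by (rule shn)
        show "poly p (s + int h) \<le> n" by (rule n)
        show "\<And>i. fwd p s (int i) = poly p (s + int i) - poly p s" by (simp add: fwd_def)
        show "fwd p s (int h) \<le> M" unfolding M_def by simp
        show "red s = c" "red (s + 1) = (\<not> c)" "red (s + int j) = c" "1 \<le> j" "j \<le> h" using col j by auto
        show "\<And>x i. i \<le> h \<Longrightarrow> 2 * x = poly p (s + int i) \<Longrightarrow> x \<in> E" unfolding E_def mids_def by blast
        show "1 \<le> H" by (rule H1)
        have pz: "even (poly p 1) \<or> even (poly p 2)" using ev by simp
        show "even (poly p s) \<or> even (poly p (s + 1))"
        proof -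
          \<comment> \<open>The parity of \<open>p(x)\<close> depends on that of \<open>x\<close>
            only, and \<open>s\<close>, \<open>s + 1\<close> represent both parities, just as 1 and
            2 do.\<close>
          have par: "even (poly p x)" if "even (x - y)" "even (poly p y)" for x y
            using dvd_add[OF dvd_trans[OF that(1) diff_dvd_poly_diff[of x y p]] that(2)] by simp
          show ?thesis using pz par[of s 1] par[of s 2] par[of "s + 1" 1] par[of "s + 1" 2]
            by (cases "even s") auto
        qed
        show "int H * (int (card E) + 1) \<le> poly p z' - poly p z" if z: "s \<le> z" "z < z'" "z' \<le> s + int h" for z z'
        proof -
          have "H * (card E + 1) \<le> K * (card E + 1)" unfolding K_def by (intro mult_right_mono) auto
          then have "H * (card E + 1) \<le> A" using KE by linarith
          then have "int H * (int (card E) + 1) \<le> int A"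
            by (metis of_nat_1 of_nat_add of_nat_le_iff of_nat_mult)
          then show ?thesis using inc'[of z z'] z As S1 by linarith
        qed
        \<comment> \<open>The constant \<open>d\<close>-th difference \<open>H\<close> is an integer
          combination of the \<open>fwd p s i\<close> with \<open>i \<le> d \<le> h\<close>.\<close>
        show "g dvd int H" if g: "\<And>i. i \<le> h \<Longrightarrow> g dvd fwd p s (int i)" for g
        proof -
          obtain e :: "nat \<Rightarrow> int" where e: "\<And>k p s. poly ((poly_diff k ^^ d) p) s = (\<Sum>i=1..d. e i * fwd p s (k * int i))"
            using poly_diff_iter_fwd[of "d - 1"] p(2) by auto
          have "degree ((poly_diff 1 ^^ d) p) = 0" "lead_coeff ((poly_diff 1 ^^ d) p) = int H"
            using poly_diff_iter_lead[OF p(1,3), of 1 d] H by auto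
          then have "(poly_diff 1 ^^ d) p = [:int H:]" by (metis degree_eq_zeroE lead_coeff_pCons(2) pCons_0_0 lead_coeff_pCons(1))
          then have "int H = (\<Sum>i=1..d. e i * fwd p s (1 * int i))" using e[of 1 p s] by simp
          also have "g dvd \<dots>" using g h1 by (intro dvd_sum dvd_mult) auto
          finally show ?thesis .
        qed
        show "2 * (s + int h + 1) + 2 * ((int (card E) + 1) * (2 * M)) \<le> poly p s"
        proof -
          have "32 * d * h * (card E + 1) \<le> K * (card E + 1)" unfolding K_def by (intro mult_right_mono) auto
          then have "32 * d * h * (card E + 1) \<le> A" using KE by linarith
          then have "int (32 * d * h * (card E + 1)) \<le> int A" by (simp only: of_nat_le_iff)
          then have b: "32 * int d * int h * (int (card E) + 1) \<le> s" using As by (simp add: distrib_left)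
          have "(int (card E) + 1) * (2 * M) \<le> (int (card E) + 1) * (2 * (2 * (int d * int h * a) * s ^ (d - 1)))"
            unfolding M_def using S by (intro mult_left_mono) auto
          then have "8 * ((int (card E) + 1) * (2 * M)) \<le> (32 * int d * int h * (int (card E) + 1)) * (a * s ^ (d - 1))"
            by (simp add: algebra_simps)
          also have "\<dots> \<le> s * (a * s ^ (d - 1))" using b a S1 by (intro mult_right_mono) auto
          also have "\<dots> = a * s ^ d" using d2 by (metis mult.left_commute)
          also have "\<dots> \<le> 2 * poly p s" using S by blast
          finally have "8 * ((int (card E) + 1) * (2 * M)) \<le> 2 * poly p s" .
          then have "4 * ((int (card E) + 1) * (2 * M)) \<le> poly p s" by linarith
          moreover have "2 * (s + int h + 1) \<le> 32 * s" using S1 by (simp add: algebra_simps)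
          ultimately show ?thesis using P64 by linarith
        qed
      qed
    next
      case False
      have q: "2 * (4 * A) * (h * card E) < card X * card X"
      proof -
        have "K * (card E + 1) \<le> A" by (rule KE)
        moreover have "1024 * H * H * h \<le> K" unfolding K_def by simp
        ultimately have "1024 * H * H * h * (card E + 1) \<le> A" by (meson mult_le_mono1 order_trans)
        then have "2 * (512 * H * H * (h * card E)) < 2 * A" using h1 H1 A by (simp add: algebra_simps)
        then have 1: "512 * H * H * (h * card E) < A" by simp
        have A1: "0 < A" using A by simp
        have "(8 * H * 8 * H) * (2 * (4 * A) * (h * card E)) = A * (512 * H * H * (h * card E))" by (simp add: algebra_simps)
        also have "\<dots> < A * A" using 1 A1 by simp
        also have "\<dots> \<le> (8 * H * card X) * (8 * H * card X)" using cX by (intro mult_mono) auto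
        also have "\<dots> = (8 * H * 8 * H) * (card X * card X)" by (simp add: algebra_simps)
        finally show ?thesis by (simp only: nat_mult_less_cancel_disj)
      qed
      have X1: "X \<subseteq> {1..int (4 * A)}" using X A by force
      obtain \<sigma> where \<sigma>: "h * card E < card {x \<in> X. \<sigma> - x \<in> X}" by (rule popular_sum[OF X1 q])
      define Y where "Y = {x \<in> X. \<sigma> - x \<in> X}"
      have "card Y \<noteq> 0" using \<sigma> unfolding Y_def[symmetric] by simp
      then have "Y \<noteq> {}" by auto
      then obtain y where y: "y \<in> X" "\<sigma> - y \<in> X" using Y_def by blast
      have "int H dvd (y - c0) + ((\<sigma> - y) - c0)" by (rule dvd_add) (use y Xc in auto)
      then have H\<sigma>: "int H dvd \<sigma> - poly p ze" using ze by simp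
      have "y \<le> 4 * int A" "\<sigma> - y \<le> 4 * int A" using y X by auto
      then have "\<sigma> \<le> 8 * int A" by linarith
      then have \<sigma>s: "\<sigma> \<le> 8 * s" using As by simp
      \<comment> \<open>\<open>s + i0\<close> is congruent to \<open>ze\<close> modulo
        \<open>H\<close>, so \<open>p(s + i0)\<close> is congruent to \<open>p(ze) = 2 * c0\<close>
        and thus to \<open>\<sigma>\<close>. This is the residue condition under which
        \<open>p(s) - \<sigma>\<close> is a combination of shifts.\<close>
      define i0 where "i0 = nat ((ze - s) mod int H)"
      have i0: "int i0 = (ze - s) mod int H" "i0 \<le> H" unfolding i0_def using H1
        by (auto simp: nat_le_iff intro: less_imp_le)
      have "int H dvd (ze - s) - (ze - s) mod int H" by (rule dvd_minus_mod)
      then have "int H dvd ze - (s + int i0)" using i0(1) by (simp add: algebra_simps)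
      then have "int H dvd poly p ze - poly p (s + int i0)" using diff_dvd_poly_diff dvd_trans by blast
      then have "int H dvd poly p (s + int i0) - poly p ze" by (subst dvd_diff_commute)
      then have "int H dvd (poly p (s + int i0) - poly p ze) - (\<sigma> - poly p ze)"
        by (rule dvd_diff[OF _ H\<sigma>])
      then have "int H dvd (poly p s - \<sigma>) + fwd p s (int i0)" by (simp add: fwd_def)
      moreover have "poly p s \<le> 2 * (poly p s - \<sigma>)" using \<sigma>s P64 S1 by (simp add: algebra_simps)
      ultimately have "poly p s - \<sigma> \<in> combos p h0 s" using S i0(2) by blast
      then have "poly p s - \<sigma> \<in> combos p h s" using combos_mono h1 by blast
      then obtain r :: "nat \<Rightarrow> nat" where r: "poly p s - \<sigma> = (\<Sum>i=1..h. int (r i) * fwd p s (int i))"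
        unfolding combos_def by blast
      have hA: "h < A" using A unfolding K1_def by simp
      show False
      proof (rule no_clean_change[of s h "\<lambda>i. fwd p s (int i)" c Y \<sigma> r])
        show "1 \<le> s" using S1 by simp
        show "s + int h \<le> n" by (rule shn)
        show "poly p s \<le> n" by (rule Psn)
        show "2 * s < poly p s" using P64 S1 by linarith
        show "1 \<le> h" by (rule h1)
        show "\<And>i. fwd p s (int i) = poly p (s + int i) - poly p s" by (simp add: fwd_def)
        show "fwd p s (int 1) \<le> fwd p s (int i)" if "i \<in> {1..h}" for i
          using that mono[of "s + 1" "s + int i"] by (cases "i = 1") (auto simp: fwd_def)
        show "s \<le> fwd p s (int 1)" using S by simp
        show "red s = c" by (rule col)
        show "red (s + int i) = (\<not> c)" if "i \<in> {1..h}" for i using False that by blast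
        show "\<And>x i. i \<le> h \<Longrightarrow> 2 * x = poly p (s + int i) \<Longrightarrow> x \<in> E" unfolding E_def mids_def by blast
        show "h * card E < card Y" using \<sigma> Y_def by simp
        show "poly p s - \<sigma> = (\<Sum>i = 1..h. int (r i) * fwd p s (int i))" by (rule r)
        show "int h < x \<and> x < s \<and> red x = c \<and> int h < \<sigma> - x \<and> \<sigma> - x < s \<and> red (\<sigma> - x) = c" if "x \<in> Y" for x
        proof -
          have "x \<in> X" "\<sigma> - x \<in> X" using that Y_def by auto
          then show ?thesis using X Xc hA by force
        qed
      qed
    qed
  qed
  then show ?thesis by (intro exI[of _ h] exI[of _ "4 * K"] exI[of _ "nat s0 + 4 * K1 + 1"] allI impI)
      (rule main, assumption+)
qed

text \<open>The majority colour \<open>c\<close> of the class in \<open>[A, 2 * A)\<close> cannot be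
  left from \<open>2 * A\<close> on. If it occurs in \<open>[2 * A, 4 * A]\<close>, it persists;
  otherwise the opposite colour fills that range, is plentiful there and cannot be left after
  \<open>4 * A\<close>. Both ways the colouring is constant on
  \<open>[4 * A, p(4 * A)]\<close>.\<close>

lemma no_sparse_colouring:
  fixes p :: "int poly"
  assumes p: "degree p = d" "2 \<le> d" "lead_coeff p > 0" and ev: "even (poly p 1 * poly p 2)"
  shows "\<exists>h K A0. \<forall>A\<ge>A0. \<forall>n red E. sparse_colouring (poly p) n red E \<longrightarrow> K * card E \<le> A \<longrightarrow>
    poly p (poly p (4 * int A) + int h) \<le> n \<longrightarrow> False"
proof -
  define H where "H = nat (fact d * lead_coeff p)"
  have Hpos: "0 < fact d * lead_coeff p" using p by (intro mult_pos_pos) auto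
  then have H: "int H = fact d * lead_coeff p" and H1: "1 \<le> H" unfolding H_def by linarith+
  obtain ze c0 where ze: "poly p ze = 2 * c0" using ev by (metis dvdE even_mult_iff)
  obtain h K A0 where nc: "\<And>A s n red E c X. A \<ge> A0 \<Longrightarrow>
    sparse_colouring (poly p) n red E \<Longrightarrow> X \<subseteq> {int A..<s} \<inter> {..4 * int A} \<Longrightarrow> int A \<le> s \<Longrightarrow>
    (\<forall>x\<in>X. red x = c \<and> int H dvd x - c0) \<Longrightarrow> A \<le> 8 * H * card X \<Longrightarrow> K * card E \<le> A \<Longrightarrow>
    red s = c \<Longrightarrow> red (s + 1) = (\<not> c) \<Longrightarrow> poly p (s + int h) \<le> n \<Longrightarrow> False"
    using no_colour_change[OF p H ze ev] by metis
  obtain s0 where s0: "\<And>s. s0 \<le> s \<Longrightarrow> s \<le> fwd p s 1 \<and> 64 * s \<le> poly p s"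
    using eventually_growth[OF p] unfolding eventually_at_top_linorder by blast
  have main: False if A: "A0 + nat s0 + 2 * H + 10 \<le> A" and sc: "sparse_colouring (poly p) n red E"
    and KE: "(K + 1) * card E \<le> A" and n: "poly p (poly p (4 * int A) + int h) \<le> n" for A n red E
  proof -
    interpret sparse_colouring "poly p" n red E by (rule sc)
    define S where "S = poly p (4 * int A)"
    have A': "A0 \<le> A" "s0 \<le> int A" "10 \<le> int A" "2 * H \<le> A" using A by auto
    have S256: "256 * int A \<le> S" unfolding S_def using s0[of "4 * int A"] A' by simp
    have mono: "poly p z < poly p z'" if "int A \<le> z" "z < z'" for z z'
      using increments_ge[of "int A" "poly p" z z'] s0 A' that unfolding fwd_def by fastforce
    have big: "64 * z \<le> poly p z" if "int A \<le> z" for z using s0[of z] A' that by simp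
    have "64 * (S + int h) \<le> n" using order_trans[OF big n[folded S_def]] S256 A' by simp
    then have Sn: "S + int h \<le> n" using S256 A' by simp
    have KE': "K * card E \<le> A" "card E \<le> A" using KE by (simp_all add: algebra_simps)
    have top: "poly p (s + int h) \<le> n" if "int A \<le> s" "s \<le> S" for s
      using mono[of "s + int h" "S + int h"] n that unfolding S_def by (cases "s = S") (auto simp: S_def)
    have half: "\<exists>X. X \<subseteq> {x \<in> {B..<B + int A}. int H dvd x - c0} \<and> (\<forall>x\<in>X. red x = c) \<and> A \<le> 8 * H * card X"
      if "A div H \<le> 2 * card {x \<in> {B..<B + int A}. int H dvd x - c0 \<and> red x = c}" for B c
    proof -
      have "A \<le> H * (A div H) + H" using H1
        using mult_div_mod_eq[of H A] mod_less_divisor[of H A] by linarith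
      then have "A \<le> 2 * (H * (A div H))" using A'(4) by linarith
      also have "\<dots> \<le> 2 * (H * (2 * card {x \<in> {B..<B + int A}. int H dvd x - c0 \<and> red x = c}))"
        using that by (intro mult_left_mono) auto
      finally have "A \<le> 8 * H * card {x \<in> {B..<B + int A}. int H dvd x - c0 \<and> red x = c}" by simp
      then show ?thesis by (intro exI[of _ "{x \<in> {B..<B + int A}. int H dvd x - c0 \<and> red x = c}"]) auto
    qed
    have persist: "red t = c" if "u \<le> t" "t \<le> v" "red u = c" "\<And>s. u \<le> s \<Longrightarrow> s < v \<Longrightarrow> red s = c \<Longrightarrow> red (s + 1) = c" for u v t c
      using that(1,2)
    proof (induction t rule: int_ge_induct)
      case (step i)
      then show ?case using that(4)[of i] by simp
    qed (use that in simp)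
    \<comment> \<open>The contradiction uses \<open>z = 4 * A\<close>: more numbers \<open>x\<close>
      keep both \<open>x\<close> and \<open>S - x\<close> in the constant range than
      \<open>E\<close> and the midpoint can exclude.\<close>
    have mono_end: False if e: "\<And>t. 4 * int A \<le> t \<Longrightarrow> t \<le> S \<Longrightarrow> red t = e" for e
    proof -
      define J where "J = {4 * int A + 1..<S - 4 * int A}"
      have "card (E \<union> {S div 2}) \<le> A + 1" using KE'(2) card_Un_le[of E "{S div 2}"] by simp
      moreover have "A + 1 < card J" unfolding J_def using S256 A' by simp
      ultimately have "\<not> J \<subseteq> E \<union> {S div 2}" using finE card_mono[of "E \<union> {S div 2}" J] by auto
      then obtain x where x: "x \<in> J" "x \<notin> E" "x \<noteq> S div 2" by blast
      have r: "red x = e" "red (S - x) = e" "red (4 * int A) = e" using x(1) S256 unfolding J_def by (auto intro!: e)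
      have "x \<noteq> S - x" using x(3) by auto
      then show False using no_mono[of x "S - x" "4 * int A"] x r Sn S256 A' unfolding J_def S_def by auto
    qed
    define Z where "Z = {x \<in> {int A..<int A + int A}. int H dvd x - c0}"
    have "card Z \<le> card {x \<in> Z. red x} + card {x \<in> Z. \<not> red x}"
    proof -
      have "Z = {x \<in> Z. red x} \<union> {x \<in> Z. \<not> red x}" by blast
      then show ?thesis using card_Un_le[of "{x \<in> Z. red x}" "{x \<in> Z. \<not> red x}"] by metis
    qed
    moreover have "A div H \<le> card Z" unfolding Z_def by (rule card_residue_class[OF H1])
    ultimately have "A div H \<le> 2 * card {x \<in> Z. red x = True} \<or> A div H \<le> 2 * card {x \<in> Z. red x = False}" by auto
    then obtain c where c: "A div H \<le> 2 * card {x \<in> Z. red x = c}" by blast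
    have "{x \<in> Z. red x = c} = {x \<in> {int A..<int A + int A}. int H dvd x - c0 \<and> red x = c}" unfolding Z_def by auto
    then obtain X where X: "X \<subseteq> {x \<in> {int A..<int A + int A}. int H dvd x - c0}" "\<forall>x\<in>X. red x = c" "A \<le> 8 * H * card X"
      using half[of "int A" c] c by auto
    have stay: "red (s + 1) = c" if s: "2 * int A \<le> s" "s < S" "red s = c" for s
    proof (rule ccontr)
      assume "red (s + 1) \<noteq> c"
      moreover have "X \<subseteq> {int A..<s} \<inter> {..4 * int A}" using X(1) s by force
      moreover have "\<forall>x\<in>X. red x = c \<and> int H dvd x - c0" using X by blast
      ultimately show False using nc[OF A'(1) sc, of X s c] X(3) KE'(1) s top[of s] A' by auto
    qed
    show False
    proof (cases "\<exists>t. 2 * int A \<le> t \<and> t \<le> 4 * int A \<and> red t = c")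
      case True
      then obtain t where t: "2 * int A \<le> t" "t \<le> 4 * int A" "red t = c" by blast
      have "red u = c" if "4 * int A \<le> u" "u \<le> S" for u
        by (rule persist[of t u S c]) (use t that stay in auto)
      then show False using mono_end by blast
    next
      case False
      then have F: "red t = (\<not> c)" if "2 * int A \<le> t" "t \<le> 4 * int A" for t using that by blast
      have "{x \<in> {2 * int A..<2 * int A + int A}. int H dvd x - c0 \<and> red x = (\<not> c)} =
          {x \<in> {2 * int A..<2 * int A + int A}. int H dvd x - c0}" using F by force
      then have "A div H \<le> 2 * card {x \<in> {2 * int A..<2 * int A + int A}. int H dvd x - c0 \<and> red x = (\<not> c)}"
        using card_residue_class[OF H1, of A "2 * int A" c0] by simp
      from half[OF this] obtain X' where X': "X' \<subseteq> {x \<in> {2 * int A..<2 * int A + int A}. int H dvd x - c0}" "\<forall>x\<in>X'. red x = (\<not> c)" "A \<le> 8 * H * card X'"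
        by (elim exE conjE)
      have stay': "red (s + 1) = (\<not> c)" if s: "4 * int A \<le> s" "s < S" "red s = (\<not> c)" for s
      proof (rule ccontr)
        assume "red (s + 1) \<noteq> (\<not> c)"
        moreover have "X' \<subseteq> {int A..<s} \<inter> {..4 * int A}" using X'(1) s by force
        moreover have "\<forall>x\<in>X'. red x = (\<not> c) \<and> int H dvd x - c0" using X' by blast
        ultimately show False using nc[OF A'(1) sc, of X' s "\<not> c"] X'(3) KE'(1) s top[of s] A' by auto
      qed
      have "red u = (\<not> c)" if "4 * int A \<le> u" "u \<le> S" for u
        by (rule persist[of "4 * int A" u S "\<not> c"]) (use F[of "4 * int A"] that stay' in auto)
      then show False using mono_end by blast
    qed
  qed
  then show ?thesis
    by (intro exI[of _ h] exI[of _ "K + 1"] exI[of _ "A0 + nat s0 + 2 * H + 10"] allI impI) (rule main, assumption+)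
qed

section \<open>From exceptional numbers to the number of solutions\<close>

definition covered :: "int poly \<Rightarrow> nat \<Rightarrow> (nat \<Rightarrow> int) \<Rightarrow> nat set" where
  "covered p n \<phi> = \<Union> {S \<in> solutions p n. monochromatic \<phi> S}"

lemma finite_solutions: "finite (solutions p n)"
  unfolding solutions_def by (rule finite_subset[of _ "Pow {1..n}"]) auto

lemma card_covered: "finite (covered p n \<phi>)" "card (covered p n \<phi>) \<le> 3 * num_mono_solutions p n \<phi>"
proof -
  let ?M = "{S \<in> solutions p n. monochromatic \<phi> S}"
  have f: "finite ?M" using finite_solutions by auto
  have s: "finite S \<and> card S = 3" if "S \<in> ?M" for S
    using that unfolding solutions_def by (auto intro: finite_subset)
  then show "finite (covered p n \<phi>)" unfolding covered_def using f by blast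
  have "card (covered p n \<phi>) \<le> (\<Sum>S\<in>?M. card S)"
    unfolding covered_def using card_Union_le_sum_card s by blast
  also have "\<dots> = (\<Sum>S\<in>?M. 3)" using s by (intro sum.cong) auto
  finally show "card (covered p n \<phi>) \<le> 3 * num_mono_solutions p n \<phi>"
    unfolding num_mono_solutions_def by simp
qed

lemma mono_solution_mem:
  assumes \<phi>: "two_colouring n \<phi>"
    and "1 \<le> x" "x \<le> int n" "1 \<le> y" "y \<le> int n" "1 \<le> z" "z \<le> int n" "x \<noteq> y" "x \<noteq> z" "y \<noteq> z"
    and "x + y = poly p z" "(\<phi> (nat x) = 1) = (\<phi> (nat y) = 1)" "(\<phi> (nat y) = 1) = (\<phi> (nat z) = 1)"
  shows "{nat x, nat y, nat z} \<in> {S \<in> solutions p n. monochromatic \<phi> S}"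
proof -
  have r: "nat x \<in> {1..n}" "nat y \<in> {1..n}" "nat z \<in> {1..n}" using assms by auto
  have v: "\<phi> (nat x) \<in> {-1, 1}" "\<phi> (nat y) \<in> {-1, 1}" "\<phi> (nat z) \<in> {-1, 1}"
    using \<phi> r unfolding two_colouring_def by (blast dest: funcset_mem)+
  have "card {nat x, nat y, nat z} = 3" using assms by (simp add: card_insert_if eq_nat_nat_iff)
  moreover have "int (nat x) + int (nat y) = poly p (int (nat z))" using assms by simp
  ultimately have "{nat x, nat y, nat z} \<in> solutions p n" unfolding solutions_def using r by blast
  moreover have "\<phi> (nat x) = \<phi> (nat y)" "\<phi> (nat y) = \<phi> (nat z)" using v assms(12,13) by auto
  then have "monochromatic \<phi> {nat x, nat y, nat z}" unfolding monochromatic_def by auto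
  ultimately show ?thesis by blast
qed

lemma sparse_colouring_covered:
  assumes "two_colouring n \<phi>"
  shows "sparse_colouring (poly p) (int n) (\<lambda>k. \<phi> (nat k) = 1) (int ` covered p n \<phi>)"
proof
  show "finite (int ` covered p n \<phi>)" using card_covered by simp
  fix x y z
  assume a: "x \<notin> int ` covered p n \<phi>" "1 \<le> x" "x \<le> int n" "1 \<le> y" "y \<le> int n" "1 \<le> z" "z \<le> int n" "x \<noteq> y" "x \<noteq> z" "y \<noteq> z"
    "x + y = poly p z" "(\<phi> (nat x) = 1) = (\<phi> (nat y) = 1)" "(\<phi> (nat y) = 1) = (\<phi> (nat z) = 1)"
  have "nat x \<in> covered p n \<phi>" unfolding covered_def using mono_solution_mem[OF assms a(2-)] by blast
  then have "int (nat x) \<in> int ` covered p n \<phi>" by blast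
  then show False using a by simp
qed

lemma powr_root_le:
  assumes "0 \<le> x" "0 \<le> y" "1 \<le> D" "x \<le> y ^ D"
  shows "x powr (1 / real D) \<le> y"
proof (cases "y = 0")
  case True
  then show ?thesis using assms by (simp add: power_0_left)
next
  case False
  have "x powr (1 / real D) \<le> (y ^ D) powr (1 / real D)" using assms by (intro powr_mono2) auto
  also have "\<dots> = y" using False assms by (simp flip: powr_realpow add: powr_powr)
  finally show ?thesis .
qed

lemma le_powr_root:
  assumes "0 \<le> x" "0 \<le> y" "1 \<le> D" "1 \<le> C" "y ^ D \<le> C * x"
  shows "y \<le> C * x powr (1 / real D)"
proof (cases "y = 0")
  case True
  then show ?thesis using assms by simp
next
  case False
  have "y = (y ^ D) powr (1 / real D)" using False assms by (simp flip: powr_realpow add: powr_powr)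
  also have "\<dots> \<le> (C * x) powr (1 / real D)" using assms by (intro powr_mono2) auto
  also have "\<dots> = C powr (1 / real D) * x powr (1 / real D)" using assms by (simp add: powr_mult)
  also have "\<dots> \<le> C * x powr (1 / real D)"
    using assms powr_mono[of "1 / real D" 1 C] by (intro mult_right_mono) (auto simp: divide_le_eq)
  finally show ?thesis .
qed

lemma lower_bound_nonlinear:
  fixes p :: "int poly"
  assumes p: "degree p = d" "2 \<le> d" "lead_coeff p > 0" and ev: "even (poly p 1 * poly p 2)"
  shows "\<exists>c>0. \<forall>\<^sub>F n in sequentially. \<forall>\<phi>. two_colouring n \<phi> \<longrightarrow>
    c * real n powr (2 / real d ^ 3) \<le> real (num_mono_solutions p n \<phi>)"
proof -
  obtain h K A0 where ns: "\<And>A n red E. A0 \<le> A \<Longrightarrow> sparse_colouring (poly p) n red E \<Longrightarrow> K * card E \<le> A \<Longrightarrow>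
    poly p (poly p (4 * int A) + int h) \<le> n \<Longrightarrow> False"
    using no_sparse_colouring[OF p ev] by metis
  define a where "a = lead_coeff p"
  have a: "1 \<le> a" using p a_def by simp
  define D where "D = d ^ 2"
  have D: "1 \<le> D" "d * d = D" unfolding D_def using p by (simp_all add: power2_eq_square)
  obtain s0 where s0: "\<And>s. s0 \<le> s \<Longrightarrow> s \<le> fwd p s 1 \<and> 64 * s \<le> poly p s \<and> poly p s \<le> 2 * a * s ^ d"
    using eventually_conj[OF eventually_growth[OF p] eventually_poly_upper[OF p(3)]] p(1)
    unfolding eventually_at_top_linorder a_def by auto
  define C1 where "C1 = 2 * a * 4 ^ d + int h"
  define C2 where "C2 = 2 * a * C1 ^ d"
  have "1 * 1 \<le> 2 * a * 4 ^ d" using a by (intro mult_mono) auto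
  then have C1: "1 \<le> C1" unfolding C1_def by simp
  then have "1 * 1 \<le> 2 * a * C1 ^ d" using a by (intro mult_mono) auto
  then have C2: "1 \<le> C2" unfolding C2_def by simp
  have bound: "poly p (poly p (4 * int A) + int h) \<le> C2 * int A ^ D" if A: "nat s0 + 1 \<le> A" for A
  proof -
    define y where "y = poly p (4 * int A) + int h"
    have sA: "s0 \<le> 4 * int A" "1 \<le> int A" using A by auto
    have Ad: "1 \<le> int A ^ d" using sA by simp
    have "256 * int A \<le> poly p (4 * int A)" using s0[OF sA(1)] by simp
    then have y0: "s0 \<le> y" "0 \<le> y" unfolding y_def using sA by linarith+
    have "poly p (4 * int A) \<le> 2 * a * (4 * int A) ^ d" using s0[OF sA(1)] by blast
    also have "\<dots> = (2 * a * 4 ^ d) * int A ^ d" by (simp add: power_mult_distrib)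
    finally have "y \<le> (2 * a * 4 ^ d) * int A ^ d + int h * 1" unfolding y_def by simp
    also have "\<dots> \<le> (2 * a * 4 ^ d) * int A ^ d + int h * int A ^ d" using Ad by (intro add_left_mono mult_left_mono) auto
    also have "\<dots> = C1 * int A ^ d" unfolding C1_def by (simp add: distrib_right)
    finally have y: "y \<le> C1 * int A ^ d" .
    have "poly p y \<le> 2 * a * y ^ d" using s0[OF y0(1)] by blast
    also have "\<dots> \<le> 2 * a * (C1 * int A ^ d) ^ d" using y y0 a by (intro mult_left_mono power_mono) auto
    also have "\<dots> = C2 * int A ^ D" unfolding C2_def D(2)[symmetric] by (simp add: power_mult_distrib power_mult)
    finally show ?thesis unfolding y_def .
  qed
  define A1 where "A1 = A0 + nat s0 + 1"
  \<comment> \<open>The 6 combines the three members of a solution with the loss of 2 in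
    \<open>B \<le> 2 * A\<close>; \<open>K + 1\<close> keeps the denominator positive.\<close>
  define c where "c = 1 / (6 * real_of_int C2 * (real K + 1))"
  have c: "0 < c" unfolding c_def using C2 by simp
  have "c * real n powr (2 / real d ^ 3) \<le> real (num_mono_solutions p n \<phi>)"
    if n: "nat (C2 * int A1 ^ D) + 1 \<le> n" and \<phi>: "two_colouring n \<phi>" for n \<phi>
  proof -
    \<comment> \<open>\<open>A = B - 1\<close> is the last value with
      \<open>C2 * A ^ D \<le> n\<close>, and the failure at \<open>B\<close> bounds \<open>n\<close>
      by a constant times \<open>A ^ D\<close>.\<close>
    define B where "B = (LEAST B. int n < C2 * int B ^ D)"
    have ex: "int n < C2 * int (n + 1) ^ D"
    proof -
      have "int n < int (n + 1)" by simp
      also have "\<dots> \<le> int (n + 1) ^ D" using D by (intro self_le_power) auto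
      also have "\<dots> \<le> C2 * int (n + 1) ^ D" using C2 by (simp add: mult_le_cancel_right1)
      finally show ?thesis .
    qed
    have B: "int n < C2 * int B ^ D" unfolding B_def by (rule LeastI) (rule ex)
    have B1: "A1 < B"
    proof (rule ccontr)
      assume "\<not> A1 < B"
      then have "C2 * int B ^ D \<le> C2 * int A1 ^ D" using C2 by (intro mult_left_mono power_mono) auto
      then show False using B n by linarith
    qed
    define A where "A = B - 1"
    have A: "A1 \<le> A" "B = A + 1" "B \<le> 2 * A" using B1 unfolding A_def A1_def by auto
    have "\<not> int n < C2 * int A ^ D" unfolding B_def using not_less_Least[of A "\<lambda>B. int n < C2 * int B ^ D"] A(2) B_def by simp
    then have "poly p (poly p (4 * int A) + int h) \<le> int n" using bound[of A] A(1) unfolding A1_def by simp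
    then have "A < K * card (int ` covered p n \<phi>)"
      using ns[of A "int n" "\<lambda>k. \<phi> (nat k) = 1" "int ` covered p n \<phi>"] sparse_colouring_covered[OF \<phi>] A(1)
      unfolding A1_def by (meson add_leE not_le)
    also have "card (int ` covered p n \<phi>) \<le> 3 * num_mono_solutions p n \<phi>"
      using card_covered[of p n \<phi>] card_image_le[of "covered p n \<phi>" int] by linarith
    finally have AM: "A < K * (3 * num_mono_solutions p n \<phi>)" by simp
    have "int n \<le> (C2 * (2 * int A)) ^ D"
    proof -
      have "int n \<le> C2 * int B ^ D" using B by simp
      also have "\<dots> \<le> C2 ^ D * (2 * int A) ^ D" using C2 D A by (intro mult_mono power_mono) (auto intro: self_le_power)
      finally show ?thesis by (simp add: power_mult_distrib)
    qed
    then have "real_of_int (int n) \<le> real_of_int ((C2 * (2 * int A)) ^ D)" by (simp only: of_int_le_iff)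
    then have "real n \<le> (real_of_int C2 * (2 * real A)) ^ D" by simp
    then have "real n powr (1 / real D) \<le> real_of_int C2 * (2 * real A)"
      using C2 D by (intro powr_root_le) auto
    moreover have "real n powr (2 / real d ^ 3) \<le> real n powr (1 / real D)"
    proof (intro powr_mono)
      have "2 * (real d)\<^sup>2 \<le> real d ^ 3" using p(2) by (simp add: power3_eq_cube power2_eq_square)
      then show "2 / real d ^ 3 \<le> 1 / real D" unfolding D_def using p(2) by (simp add: field_simps)
      show "1 \<le> real n" using n by simp
    qed
    ultimately have 1: "real n powr (2 / real d ^ 3) \<le> real_of_int C2 * (2 * real A)" by linarith
    have "real A \<le> real (K * (3 * num_mono_solutions p n \<phi>))" using AM by (intro of_nat_mono) simp
    also have "\<dots> \<le> (real K + 1) * (3 * real (num_mono_solutions p n \<phi>))" by (simp add: algebra_simps)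
    finally have 2: "real A \<le> (real K + 1) * (3 * real (num_mono_solutions p n \<phi>))" .
    have "real n powr (2 / real d ^ 3) \<le> real_of_int C2 * (2 * ((real K + 1) * (3 * real (num_mono_solutions p n \<phi>))))"
      using 1 2 C2 by (intro order_trans[OF 1] mult_left_mono) auto
    also have "\<dots> = (6 * real_of_int C2 * (real K + 1)) * real (num_mono_solutions p n \<phi>)" by (simp add: algebra_simps)
    finally have "c * real n powr (2 / real d ^ 3) \<le> c * ((6 * real_of_int C2 * (real K + 1)) * real (num_mono_solutions p n \<phi>))"
      using c by (intro mult_left_mono) auto
    also have "\<dots> = real (num_mono_solutions p n \<phi>)" unfolding c_def using C2 by simp
    finally show ?thesis .
  qed
  then have "\<forall>\<^sub>F n in sequentially. \<forall>\<phi>. two_colouring n \<phi> \<longrightarrow>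
    c * real n powr (2 / real d ^ 3) \<le> real (num_mono_solutions p n \<phi>)"
    unfolding eventually_sequentially by blast
  then show ?thesis using c by blast
qed

section \<open>Linear polynomials\<close>

locale linear_colouring =
  fixes red :: "int \<Rightarrow> bool" and x0 a \<beta> :: int
  assumes a1: "1 \<le> a" and x01: "1 \<le> x0"
begin

definition g :: "int \<Rightarrow> bool" where "g i = red (x0 + a * i)"

text \<open>If \<open>2 * x0 + a * \<beta> = b\<close>, the elements of \<open>mono_pos z\<close> are the solutions \<open>x + y = a * z + b\<close> of the colour of
  \<open>z\<close> with \<open>x = x0 + a * i\<close> and \<open>y = x0 + a * (z + \<beta> - i)\<close>.\<close>

definition mono_pos :: "int \<Rightarrow> int set" where
  "mono_pos z = {i \<in> {0..z + \<beta>}. g i = red z \<and> g (z + \<beta> - i) = red z}"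

text \<open>The failures within \<open>{0..q}\<close> of the shift by \<open>\<delta>\<close> to
  preserve \<open>c\<close>. In the linear case such failures are counted instead of being
  avoided.\<close>

definition losses :: "bool \<Rightarrow> int \<Rightarrow> int \<Rightarrow> int set" where
  "losses c q \<delta> = {i \<in> {0..q - \<delta>}. g i = c \<and> g (i + \<delta>) \<noteq> c}"

lemma finite_mono_pos [simp]: "finite (mono_pos z)"
  unfolding mono_pos_def by (rule finite_subset[of _ "{0..z + \<beta>}"]) auto

lemma finite_losses [simp]: "finite (losses c q \<delta>)"
  unfolding losses_def by (rule finite_subset[of _ "{0..q - \<delta>}"]) auto

text \<open>The numbers \<open>z = x0 + a * k\<close> belong to the class of the summands, so most
  of them have the colour \<open>e\<close> as well. For each of these at most
  \<open>2 * card F\<close> positions fail, out of at least \<open>a * t\<close>.\<close>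

lemma many_mono_pos:
  assumes B: "80 * a * int (card {i \<in> {0..Q}. g i \<noteq> e}) \<le> Q" and Q: "16 * \<bar>x0 + \<beta>\<bar> + 16 * a \<le> Q" "x0 + a * Q \<le> W"
  shows "Q * Q \<le> 512 * a * (\<Sum>z=1..W. int (card (mono_pos z)))"
proof -
  \<comment> \<open>With \<open>8 * (a * t) \<le> Q\<close> and \<open>k \<le> 4 * t\<close>, the
    positions for \<open>z = x0 + a * k\<close> stay within \<open>{0..Q}\<close>, where
    \<open>g\<close> is controlled.\<close>
  define t where "t = Q div (8 * a)"
  define F where "F = {i \<in> {0..Q}. g i \<noteq> e}"
  have fF: "finite F" unfolding F_def by (rule finite_subset[of _ "{0..Q}"]) auto
  have "8 * a * t + Q mod (8 * a) = Q" unfolding t_def by (rule mult_div_mod_eq)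
  moreover have "0 \<le> Q mod (8 * a)" "Q mod (8 * a) < 8 * a" using a1 by auto
  ultimately have tQ: "8 * (a * t) \<le> Q" "Q < 8 * (a * t) + 8 * a" by (simp_all add: mult.assoc)
  define X where "X = \<bar>x0 + \<beta>\<bar>"
  have X: "0 \<le> X" "16 * X + 16 * a \<le> Q" using Q(1) unfolding X_def by simp_all
  then have at0: "a \<le> a * t" using tQ a1 by linarith
  then have t1: "1 \<le> t" using a1 by (simp add: mult_le_cancel_left1)
  then have at: "a \<le> a * t" "t \<le> a * t" using a1 by (auto simp: mult_le_cancel_left1 mult_le_cancel_right1)
  have "X \<le> a * t" using X tQ(2) at a1 by linarith
  then have xb: "\<bar>x0 + \<beta>\<bar> \<le> a * t" unfolding X_def .
  have Bt: "10 * int (card F) \<le> t"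
  proof -
    have "(8 * a) * (10 * int (card F)) < (8 * a) * (t + 1)" using B tQ(2) unfolding F_def by (simp add: algebra_simps)
    then show ?thesis using a1 by (simp only: mult_less_cancel_left) auto
  qed
  define K where "K = {k \<in> {2 * t..4 * t}. g k = e}"
  have K: "a * t \<le> 2 * int (card (mono_pos (x0 + a * k)))" "x0 + a * k \<in> {1..W}" if "k \<in> K" for k
  proof -
    have k: "2 * t \<le> k" "k \<le> 4 * t" "g k = e" using that unfolding K_def by auto
    have ak: "2 * (a * t) \<le> a * k" "a * k \<le> 4 * (a * t)"
      using mult_left_mono[OF k(1), of a] mult_left_mono[OF k(2), of a] a1 by (simp_all add: algebra_simps)
    define q where "q = x0 + a * k + \<beta>"
    have q: "a * t \<le> q" "q \<le> Q" using ak xb tQ at unfolding q_def by linarith+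
    have "{0..q} - (F \<union> (\<lambda>i. q - i) ` F) \<subseteq> mono_pos (x0 + a * k)"
    proof
      fix i assume i: "i \<in> {0..q} - (F \<union> (\<lambda>i. q - i) ` F)"
      have "q - i \<notin> F"
      proof
        assume "q - i \<in> F"
        then have "q - (q - i) \<in> (\<lambda>i. q - i) ` F" by (rule imageI)
        then show False using i by simp
      qed
      then have "g i = e" "g (q - i) = e" using i q unfolding F_def by auto
      moreover have "red (x0 + a * k) = e" using k(3) unfolding g_def .
      ultimately show "i \<in> mono_pos (x0 + a * k)" unfolding mono_pos_def using i q_def by auto
    qed
    then have "card ({0..q} - (F \<union> (\<lambda>i. q - i) ` F)) \<le> card (mono_pos (x0 + a * k))" by (intro card_mono) auto
    moreover have "card {0..q} - card (F \<union> (\<lambda>i. q - i) ` F) \<le> card ({0..q} - (F \<union> (\<lambda>i. q - i) ` F))"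
      using fF by (intro diff_card_le_card_Diff) auto
    moreover have "card (F \<union> (\<lambda>i. q - i) ` F) \<le> card F + card F"
      using card_Un_le[of F "(\<lambda>i. q - i) ` F"] card_image_le[OF fF, of "\<lambda>i. q - i"] by linarith
    moreover have "0 \<le> q" using q(1) at a1 by linarith
    then have "int (card {0..q}) = q + 1" by simp
    ultimately have "q + 1 - 2 * int (card F) \<le> int (card (mono_pos (x0 + a * k)))" by linarith
    then show "a * t \<le> 2 * int (card (mono_pos (x0 + a * k)))" using q(1) Bt at by linarith
    have "a * k \<le> a * Q" using k tQ at t1 a1 by (intro mult_left_mono) linarith+
    then have "x0 + a * k \<le> W" using Q(2) by linarith
    moreover have "1 \<le> x0 + a * k" using x01 ak at t1 by linarith
    ultimately show "x0 + a * k \<in> {1..W}" by simp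
  qed
  have "t \<le> int (card K)"
  proof -
    have "{2 * t..4 * t} - F \<subseteq> K"
    proof
      fix k assume k: "k \<in> {2 * t..4 * t} - F"
      then have "2 * t \<le> k" "k \<le> 4 * t" by auto
      then have "0 \<le> k" "k \<le> Q" using tQ at t1 by linarith+
      then show "k \<in> K" using k unfolding K_def F_def by auto
    qed
    moreover have "finite K" unfolding K_def by (rule finite_subset[of _ "{2 * t..4 * t}"]) auto
    ultimately have "card ({2 * t..4 * t} - F) \<le> card K" by (intro card_mono) auto
    moreover have "card {2 * t..4 * t} - card F \<le> card ({2 * t..4 * t} - F)" using fF by (rule diff_card_le_card_Diff)
    moreover have "int (card {2 * t..4 * t}) = 2 * t + 1" using t1 by simp
    ultimately show ?thesis using Bt t1 by linarith
  qed
  then have "t * (a * t) \<le> int (card K) * (a * t)" using a1 t1 by (intro mult_right_mono) auto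
  also have "\<dots> = (\<Sum>k\<in>K. a * t)" by simp
  also have "\<dots> \<le> (\<Sum>k\<in>K. 2 * int (card (mono_pos (x0 + a * k))))" using K(1) by (rule sum_mono)
  also have "\<dots> = 2 * (\<Sum>z\<in>(\<lambda>k. x0 + a * k) ` K. int (card (mono_pos z)))"
    using a1 by (subst sum.reindex) (auto simp: inj_on_def sum_distrib_left)
  also have "\<dots> \<le> 2 * (\<Sum>z=1..W. int (card (mono_pos z)))"
    using K(2) by (intro mult_left_mono sum_mono2) auto
  finally have s: "t * (a * t) \<le> 2 * (\<Sum>z=1..W. int (card (mono_pos z)))" .
  have "0 \<le> Q" using X a1 by linarith
  moreover have "Q \<le> 16 * (a * t)" using tQ(2) at by linarith
  ultimately have "Q * Q \<le> (16 * (a * t)) * (16 * (a * t))" by (intro mult_mono) auto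
  also have "\<dots> = 256 * a * (t * (a * t))" by (simp add: algebra_simps)
  also have "\<dots> \<le> 256 * a * (2 * (\<Sum>z=1..W. int (card (mono_pos z))))" using s a1 by (intro mult_left_mono) auto
  finally show ?thesis by (simp add: algebra_simps)
qed

section \<open>Losses of a colour under shifts\<close>

lemma card_losses_add:
  assumes "0 \<le> \<delta>" "0 \<le> \<delta>'"
  shows "card (losses c q (\<delta> + \<delta>')) \<le> card (losses c q \<delta>) + card (losses c q \<delta>')"
proof -
  have "losses c q (\<delta> + \<delta>') \<subseteq> losses c q \<delta> \<union> (\<lambda>i. i - \<delta>) ` losses c q \<delta>'"
  proof
    fix i assume i: "i \<in> losses c q (\<delta> + \<delta>')"
    show "i \<in> losses c q \<delta> \<union> (\<lambda>i. i - \<delta>) ` losses c q \<delta>'"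
    proof (cases "g (i + \<delta>) = c")
      case True
      then have "i + \<delta> \<in> losses c q \<delta>'" using i assms unfolding losses_def by (auto simp: algebra_simps)
      then have "i + \<delta> - \<delta> \<in> (\<lambda>i. i - \<delta>) ` losses c q \<delta>'" by (rule imageI)
      then show ?thesis by simp
    next
      case False
      then show ?thesis using i assms unfolding losses_def by auto
    qed
  qed
  then have "card (losses c q (\<delta> + \<delta>')) \<le> card (losses c q \<delta> \<union> (\<lambda>i. i - \<delta>) ` losses c q \<delta>')" by (intro card_mono) auto
  also have "\<dots> \<le> card (losses c q \<delta>) + card ((\<lambda>i. i - \<delta>) ` losses c q \<delta>')" by (rule card_Un_le)
  also have "\<dots> \<le> card (losses c q \<delta>) + card (losses c q \<delta>')" by (intro add_left_mono card_image_le) auto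
  finally show ?thesis .
qed

lemma card_losses_mult:
  assumes "0 \<le> \<delta>" "0 \<le> k"
  shows "card (losses c q (int j * \<delta> + k)) \<le> j * card (losses c q \<delta>) + card (losses c q k)"
proof (induction j)
  case (Suc j)
  have e: "int (Suc j) * \<delta> + k = \<delta> + (int j * \<delta> + k)" by (simp add: algebra_simps)
  have "card (losses c q (\<delta> + (int j * \<delta> + k))) \<le> card (losses c q \<delta>) + card (losses c q (int j * \<delta> + k))"
    using assms by (intro card_losses_add) auto
  then show ?case unfolding e using Suc by simp
qed simp

text \<open>Losses of the two colours balance up to the boundary: together with \<open>U\<close>
  they count the places of colour \<open>c\<close>, once in \<open>{\<delta>..q}\<close> and once in
  \<open>{0..q - \<delta>}\<close>.\<close>

lemma card_losses_compl:
  assumes "0 \<le> \<delta>"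
  shows "int (card (losses (\<not> c) q \<delta>)) \<le> int (card (losses c q \<delta>)) + \<delta>"
proof -
  define U where "U = {i \<in> {0..q - \<delta>}. g i = c \<and> g (i + \<delta>) = c}"
  have fU: "finite U" unfolding U_def by (rule finite_subset[of _ "{0..q - \<delta>}"]) auto
  have "(\<lambda>i. i + \<delta>) ` (losses (\<not> c) q \<delta> \<union> U) \<subseteq> (losses c q \<delta> \<union> U) \<union> {q - \<delta> + 1..q}"
    using assms unfolding losses_def U_def by auto
  then have "card ((\<lambda>i. i + \<delta>) ` (losses (\<not> c) q \<delta> \<union> U)) \<le> card ((losses c q \<delta> \<union> U) \<union> {q - \<delta> + 1..q})"
    using fU by (intro card_mono) auto
  also have "card ((\<lambda>i. i + \<delta>) ` (losses (\<not> c) q \<delta> \<union> U)) = card (losses (\<not> c) q \<delta> \<union> U)"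
    by (intro card_image) (auto simp: inj_on_def)
  also have "\<dots> = card (losses (\<not> c) q \<delta>) + card U" 
    by (rule card_Un_disjoint[OF finite_losses fU]) (auto simp: losses_def U_def)
  also have "card ((losses c q \<delta> \<union> U) \<union> {q - \<delta> + 1..q}) \<le> card (losses c q \<delta>) + card U + card {q - \<delta> + 1..q}"
    using card_Un_le[of "losses c q \<delta> \<union> U" "{q - \<delta> + 1..q}"] card_Un_le[of "losses c q \<delta>" U] by linarith
  finally show ?thesis using assms by simp
qed

text \<open>Going up by \<open>k\<close> is going down by \<open>\<delta> - k\<close> and then up by
  \<open>\<delta>\<close>. A loss of \<open>c\<close> on the way down is a loss of the other colour
  on the way up, converted by \<open>card_losses_compl\<close> at the price of
  \<open>\<delta> - k\<close>; as many places again have no room to go down.\<close>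

lemma card_losses_diff:
  assumes "0 \<le> k" "k \<le> \<delta>"
  shows "int (card (losses c q k)) \<le> int (card (losses c q \<delta>)) + int (card (losses c q (\<delta> - k))) + 2 * \<delta>"
proof -
  have "losses c q k \<subseteq> {0..<\<delta> - k} \<union> (\<lambda>j. j + (\<delta> - k)) ` (losses c q \<delta> \<union> losses (\<not> c) q (\<delta> - k))"
  proof
    fix i assume i: "i \<in> losses c q k"
    show "i \<in> {0..<\<delta> - k} \<union> (\<lambda>j. j + (\<delta> - k)) ` (losses c q \<delta> \<union> losses (\<not> c) q (\<delta> - k))"
    proof (cases "i < \<delta> - k")
      case True
      then show ?thesis using i unfolding losses_def by simp
    next
      case False
      define j where "j = i + k - \<delta>"
      have "j \<in> losses c q \<delta> \<union> losses (\<not> c) q (\<delta> - k)"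
      proof (cases "g j = c")
        case True
        then have "j \<in> losses c q \<delta>" using i False assms unfolding losses_def j_def by auto
        then show ?thesis by simp
      next
        case f: False
        then have "j \<in> losses (\<not> c) q (\<delta> - k)" using i False assms unfolding losses_def j_def by auto
        then show ?thesis by simp
      qed
      then have "j + (\<delta> - k) \<in> (\<lambda>j. j + (\<delta> - k)) ` (losses c q \<delta> \<union> losses (\<not> c) q (\<delta> - k))" by (rule imageI)
      then show ?thesis unfolding j_def by simp
    qed
  qed
  then have "card (losses c q k) \<le> card ({0..<\<delta> - k} \<union> (\<lambda>j. j + (\<delta> - k)) ` (losses c q \<delta> \<union> losses (\<not> c) q (\<delta> - k)))"
    by (intro card_mono) auto
  also have "\<dots> \<le> card {0..<\<delta> - k} + card ((\<lambda>j. j + (\<delta> - k)) ` (losses c q \<delta> \<union> losses (\<not> c) q (\<delta> - k)))" by (rule card_Un_le)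
  also have "card ((\<lambda>j. j + (\<delta> - k)) ` (losses c q \<delta> \<union> losses (\<not> c) q (\<delta> - k))) \<le> card (losses c q \<delta> \<union> losses (\<not> c) q (\<delta> - k))"
    by (intro card_image_le) auto
  also have "\<dots> \<le> card (losses c q \<delta>) + card (losses (\<not> c) q (\<delta> - k))" by (rule card_Un_le)
  finally have "int (card (losses c q k)) \<le> (\<delta> - k) + (int (card (losses c q \<delta>)) + int (card (losses (\<not> c) q (\<delta> - k))))"
    using assms by simp
  then show ?thesis using card_losses_compl[of "\<delta> - k" c q] assms by linarith
qed

text \<open>The partner of \<open>i\<close> for \<open>z\<close> is also that of
  \<open>i + (z' - z)\<close> for \<open>z'\<close>; if \<open>i\<close> is a loss, either colour of
  this partner produces a monochromatic position.\<close>

lemma card_losses_le_mono_pos: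
  assumes "z < z'" "q \<le> z + \<beta>" "red z = c" "red z' \<noteq> c"
  shows "card (losses c q (z' - z)) \<le> card (mono_pos z) + card (mono_pos z')"
proof -
  have "losses c q (z' - z) \<subseteq> mono_pos z \<union> (\<lambda>i. i - (z' - z)) ` mono_pos z'"
  proof
    fix i assume i: "i \<in> losses c q (z' - z)"
    show "i \<in> mono_pos z \<union> (\<lambda>i. i - (z' - z)) ` mono_pos z'"
    proof (cases "g (z + \<beta> - i) = c")
      case True
      then show ?thesis using i assms unfolding losses_def mono_pos_def by auto
    next
      case False
      then have "i + (z' - z) \<in> mono_pos z'" using i assms unfolding losses_def mono_pos_def by (auto simp: algebra_simps)
      then have "i + (z' - z) - (z' - z) \<in> (\<lambda>i. i - (z' - z)) ` mono_pos z'" by (rule imageI)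
      then show ?thesis by simp
    qed
  qed
  then have "card (losses c q (z' - z)) \<le> card (mono_pos z \<union> (\<lambda>i. i - (z' - z)) ` mono_pos z')" by (intro card_mono) auto
  also have "\<dots> \<le> card (mono_pos z) + card ((\<lambda>i. i - (z' - z)) ` mono_pos z')" by (rule card_Un_le)
  also have "\<dots> \<le> card (mono_pos z) + card (mono_pos z')" by (intro add_left_mono card_image_le) auto
  finally show ?thesis .
qed

text \<open>For \<open>i\<close> and \<open>i'\<close> of colour \<open>c\<close>, either \<open>i'\<close> is part of a monochromatic solution with \<open>z\<close>, or
  \<open>z + \<beta> - i'\<close> has the other colour and \<open>c\<close> is lost on the way from \<open>i\<close> to it.\<close>

lemma low_part:
  assumes "red z = c" "X \<subseteq> {i \<in> {0..Q}. g i = c}" "2 * Q + \<delta> \<le> z + \<beta>" "0 \<le> \<delta>"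
  shows "card X * card X \<le> card X * card (mono_pos z) + (\<Sum>\<delta>'=\<delta>..z + \<beta>. card (losses c (z + \<beta>) \<delta>'))"
proof -
  define q where "q = z + \<beta>"
  have fX: "finite X" using assms(2) by (rule finite_subset) (rule finite_subset[of _ "{0..Q}"], auto)
  have "X \<times> X \<subseteq> (X \<times> mono_pos z) \<union> (\<lambda>(\<delta>', i). (i, q - i - \<delta>')) ` (SIGMA \<delta>':{\<delta>..q}. losses c q \<delta>')"
  proof
    fix y assume "y \<in> X \<times> X"
    then obtain i i' where y: "y = (i, i')" "i \<in> X" "i' \<in> X" by blast
    have i: "0 \<le> i" "i \<le> Q" "g i = c" "0 \<le> i'" "i' \<le> Q" "g i' = c" using y assms(2) by auto
    show "y \<in> (X \<times> mono_pos z) \<union> (\<lambda>(\<delta>', i). (i, q - i - \<delta>')) ` (SIGMA \<delta>':{\<delta>..q}. losses c q \<delta>')"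
    proof (cases "g (q - i') = c")
      case True
      then have "i' \<in> mono_pos z" using i assms unfolding mono_pos_def q_def by auto
      then show ?thesis using y by simp
    next
      case False
      then have "i \<in> losses c q (q - i' - i)" using i assms unfolding losses_def q_def by auto
      moreover have "q - i' - i \<in> {\<delta>..q}" using i assms unfolding q_def by simp
      ultimately have "(q - i' - i, i) \<in> (SIGMA \<delta>':{\<delta>..q}. losses c q \<delta>')" by blast
      then have "(\<lambda>(\<delta>', i). (i, q - i - \<delta>')) (q - i' - i, i) \<in> (\<lambda>(\<delta>', i). (i, q - i - \<delta>')) ` (SIGMA \<delta>':{\<delta>..q}. losses c q \<delta>')"
        by (rule imageI)
      then show ?thesis using y by simp
    qed
  qed
  then have "card (X \<times> X) \<le> card ((X \<times> mono_pos z) \<union> (\<lambda>(\<delta>', i). (i, q - i - \<delta>')) ` (SIGMA \<delta>':{\<delta>..q}. losses c q \<delta>'))"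
    using fX by (intro card_mono) auto
  also have "\<dots> \<le> card (X \<times> mono_pos z) + card ((\<lambda>(\<delta>', i). (i, q - i - \<delta>')) ` (SIGMA \<delta>':{\<delta>..q}. losses c q \<delta>'))" by (rule card_Un_le)
  also have "\<dots> \<le> card (X \<times> mono_pos z) + card (SIGMA \<delta>':{\<delta>..q}. losses c q \<delta>')" by (intro add_left_mono card_image_le) auto
  also have "\<dots> = card X * card (mono_pos z) + (\<Sum>\<delta>'=\<delta>..q. card (losses c q \<delta>'))"
    by (simp add: card_cartesian_product)
  finally show ?thesis unfolding q_def by (simp add: card_cartesian_product)
qed

text \<open>By itself the pair \<open>z1\<close>, \<open>z2\<close> controls only multiples of its
  distance \<open>\<delta>0\<close>. A shift \<open>k \<le> \<delta>0\<close> is controlled if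
  \<open>z1 + k\<close> is not exceptional, by comparison with \<open>z1\<close> or
  \<open>z2\<close> according to colour. Sums of two such \<open>k\<close> cover
  \<open>[h, h + \<delta>0]\<close>, hence all residues modulo \<open>\<delta>0\<close>; about
  \<open>q / \<delta>0\<close> further steps cost \<open>2 * e\<close> each.\<close>

lemma card_losses_bound:
  assumes z: "z1 < z2" "red z1 = c" "red z2 \<noteq> c"
    and good: "card (mono_pos z1) \<le> e" "card (mono_pos z2) \<le> e"
    and bad: "card {z \<in> {z1..z2}. e < card (mono_pos z)} \<le> e"
    and m: "m \<le> 2 * (z2 - z1)" "z2 - z1 \<le> m" "8 * int e + 16 \<le> m"
    and \<delta>: "z2 - z1 \<le> \<delta>" "\<delta> \<le> q" and q: "q = z1 + \<beta>"
  shows "m * int (card (losses c q \<delta>)) \<le> 4 * (q * int e) + m * (8 * int e + 4 * m)"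
proof -
  define \<delta>0 where "\<delta>0 = z2 - z1"
  define h where "h = \<delta>0 div 2"
  define v where "v k = int (card (losses c q k))" for k
  define Bad where "Bad = {z \<in> {z1..z2}. e < card (mono_pos z)}"
  have \<delta>0: "0 < \<delta>0" "\<delta>0 \<le> m" "m \<le> 2 * \<delta>0" "\<delta>0 \<le> 2 * h + 1" "2 * h \<le> \<delta>0" using z m unfolding \<delta>0_def h_def by auto
  have fBad: "finite Bad" unfolding Bad_def by (rule finite_subset[of _ "{z1..z2}"]) auto
  have v0: "v \<delta>0 \<le> 2 * int e"
    using card_losses_le_mono_pos[OF z(1), of q c] z good q unfolding v_def \<delta>0_def by simp
  have v1: "v k \<le> 4 * int e + 2 * m" if k: "0 \<le> k" "k \<le> \<delta>0" "z1 + k \<notin> Bad" for k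
  proof -
    have gk: "card (mono_pos (z1 + k)) \<le> e" using k unfolding Bad_def \<delta>0_def by auto
    show ?thesis
    proof (cases "red (z1 + k) = c")
      case True
      then have "z1 + k \<noteq> z2" using z(3) by auto
      then have "z1 + k < z2" using k unfolding \<delta>0_def by simp
      then have "card (losses c q (z2 - (z1 + k))) \<le> card (mono_pos (z1 + k)) + card (mono_pos z2)"
        using True z k q by (intro card_losses_le_mono_pos) auto
      moreover have "z2 - (z1 + k) = \<delta>0 - k" unfolding \<delta>0_def by simp
      ultimately have "v (\<delta>0 - k) \<le> 2 * int e" using gk good(2) unfolding v_def by simp
      moreover have "v k \<le> v \<delta>0 + v (\<delta>0 - k) + 2 * \<delta>0" unfolding v_def by (rule card_losses_diff[OF k(1,2)])
      ultimately show ?thesis using v0 \<delta>0 by linarith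
    next
      case False
      then have "k \<noteq> 0" using z by auto
      then have "card (losses c q (z1 + k - z1)) \<le> card (mono_pos z1) + card (mono_pos (z1 + k))"
        using False z k q by (intro card_losses_le_mono_pos) auto
      then have "v k \<le> 2 * int e" using gk good(1) unfolding v_def by simp
      then show ?thesis using m by linarith
    qed
  qed
  have v2: "v k \<le> 8 * int e + 4 * m" if k: "h \<le> k" "k \<le> h + \<delta>0" for k
  proof -
    \<comment> \<open>The admissible first parts of decompositions of \<open>k\<close>: there are
      more than \<open>h\<close>, and exceptional numbers spoil at most
      \<open>2 * e < h + 1\<close>.\<close>
    define Kc where "Kc = {max 0 (k - \<delta>0)..min \<delta>0 k}"
    have "\<exists>k1\<in>Kc. z1 + k1 \<notin> Bad \<and> z1 + (k - k1) \<notin> Bad"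
    proof (rule ccontr)
      assume n: "\<not> (\<exists>k1\<in>Kc. z1 + k1 \<notin> Bad \<and> z1 + (k - k1) \<notin> Bad)"
      have "Kc \<subseteq> (\<lambda>z. z - z1) ` Bad \<union> (\<lambda>z. k - (z - z1)) ` Bad"
      proof
        fix k1 assume "k1 \<in> Kc"
        then consider "z1 + k1 \<in> Bad" | "z1 + (k - k1) \<in> Bad" using n by blast
        then show "k1 \<in> (\<lambda>z. z - z1) ` Bad \<union> (\<lambda>z. k - (z - z1)) ` Bad"
        proof cases
          case 1
          then show ?thesis by (intro UnI1 image_eqI[of _ _ "z1 + k1"]) auto
        next
          case 2
          then show ?thesis by (intro UnI2 image_eqI[of _ _ "z1 + (k - k1)"]) auto
        qed
      qed
      then have "card Kc \<le> card ((\<lambda>z. z - z1) ` Bad \<union> (\<lambda>z. k - (z - z1)) ` Bad)" using fBad by (intro card_mono) auto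
      also have "\<dots> \<le> card ((\<lambda>z. z - z1) ` Bad) + card ((\<lambda>z. k - (z - z1)) ` Bad)" by (rule card_Un_le)
      also have "\<dots> \<le> card Bad + card Bad" by (intro add_mono card_image_le fBad)
      also have "\<dots> \<le> 2 * e" using bad unfolding Bad_def by simp
      finally have "card Kc \<le> 2 * e" .
      moreover have "h + 1 \<le> int (card Kc)" unfolding Kc_def using k \<delta>0 by (auto simp: max_def min_def)
      ultimately show False using m \<delta>0 by linarith
    qed
    then obtain k1 where k1: "k1 \<in> Kc" "z1 + k1 \<notin> Bad" "z1 + (k - k1) \<notin> Bad" by blast
    have r: "0 \<le> k1" "k1 \<le> \<delta>0" "0 \<le> k - k1" "k - k1 \<le> \<delta>0" using k1(1) unfolding Kc_def by auto
    have "v (k1 + (k - k1)) \<le> v k1 + v (k - k1)" unfolding v_def using card_losses_add[OF r(1,3), of c q] by linarith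
    then show ?thesis using v1[OF r(1,2) k1(2)] v1[OF r(3,4) k1(3)] by simp
  qed
  define j where "j = nat ((\<delta> - h) div \<delta>0)"
  define k where "k = h + (\<delta> - h) mod \<delta>0"
  have hd: "0 \<le> \<delta> - h" "0 \<le> h" using \<delta> \<delta>0 unfolding \<delta>0_def by linarith+
  have j: "int j = (\<delta> - h) div \<delta>0" unfolding j_def using hd \<delta>0 by (simp add: pos_imp_zdiv_nonneg_iff)
  have md: "0 \<le> (\<delta> - h) mod \<delta>0" "(\<delta> - h) mod \<delta>0 < \<delta>0" using \<delta>0 by auto
  have jk: "\<delta> = int j * \<delta>0 + k" unfolding j k_def using div_mult_mod_eq[of "\<delta> - h" \<delta>0] by linarith
  have k: "h \<le> k" "k \<le> h + \<delta>0" "0 \<le> k" unfolding k_def using md hd by linarith+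
  have "card (losses c q \<delta>) \<le> j * card (losses c q \<delta>0) + card (losses c q k)"
    unfolding jk using \<delta>0 k by (intro card_losses_mult) auto
  then have "int (card (losses c q \<delta>)) \<le> int (j * card (losses c q \<delta>0) + card (losses c q k))" by (simp only: of_nat_le_iff)
  then have "int (card (losses c q \<delta>)) \<le> int j * v \<delta>0 + v k" unfolding v_def by simp
  also have "\<dots> \<le> int j * (2 * int e) + (8 * int e + 4 * m)" using v0 v2[OF k(1,2)] by (intro add_mono mult_left_mono) auto
  finally have "m * int (card (losses c q \<delta>)) \<le> m * (int j * (2 * int e) + (8 * int e + 4 * m))"
    using m by (intro mult_left_mono) auto
  also have "\<dots> = (int j * m) * (2 * int e) + m * (8 * int e + 4 * m)" by (simp add: algebra_simps)
  also have "(int j * m) * (2 * int e) \<le> (2 * q) * (2 * int e)"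
  proof (intro mult_right_mono)
    have "int j * m \<le> int j * (2 * \<delta>0)" using \<delta>0 by (intro mult_left_mono) auto
    also have "\<dots> = 2 * (int j * \<delta>0)" by simp
    also have "\<dots> \<le> 2 * q" using jk k \<delta> by simp
    finally show "int j * m \<le> 2 * q" .
  qed auto
  also have "(2 * q) * (2 * int e) = 4 * (q * int e)" by simp
  finally show ?thesis by simp
qed

text \<open>A closest pair of opposite colours outside \<open>Bad\<close> has only bad numbers in
  between, so it is at most \<open>e + 1\<close> apart. A good number at distance between
  \<open>m / 2\<close> and \<open>m\<close> from both, on the side with room, is opposite to one of
  them. The distance must not be small, since the number of steps in
  \<open>card_losses_bound\<close> is inversely proportional to it.\<close>

lemma close_change:
  assumes bad: "finite Bad" "card Bad \<le> e" and m: "8 * int e + 16 \<le> m" "l + 2 * m \<le> W"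
    and z: "z \<in> {l..W} - Bad" "z' \<in> {l..W} - Bad" "red z \<noteq> red z'"
  obtains z1 z2 where "z1 < z2" "z1 \<in> {l..W} - Bad" "z2 \<in> {l..W} - Bad" "red z1 \<noteq> red z2" "m \<le> 2 * (z2 - z1)" "z2 - z1 \<le> m"
proof -
  define pr where "pr y \<longleftrightarrow> fst y < snd y \<and> fst y \<in> {l..W} - Bad \<and> snd y \<in> {l..W} - Bad \<and> red (fst y) \<noteq> red (snd y)" for y :: "int \<times> int"
  have "\<exists>y. pr y"
  proof (cases "z < z'")
    case True
    then show ?thesis using z by (intro exI[of _ "(z, z')"]) (simp add: pr_def)
  next
    case False
    then have "z' < z" using z(3) by (cases "z = z'") auto
    then show ?thesis using z by (intro exI[of _ "(z', z)"]) (auto simp add: pr_def)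
  qed
  then obtain y where y: "pr y" "\<And>y'. pr y' \<Longrightarrow> nat (snd y - fst y) \<le> nat (snd y' - fst y')"
    using ex_has_least_nat[of pr _ "\<lambda>y. nat (snd y - fst y)"] by metis
  define u where "u = fst y"
  define v where "v = snd y"
  have uv: "u < v" "u \<in> {l..W} - Bad" "v \<in> {l..W} - Bad" "red u \<noteq> red v" using y(1) unfolding pr_def u_def v_def by auto
  have "{u<..<v} \<subseteq> Bad"
  proof
    fix w assume w: "w \<in> {u<..<v}"
    show "w \<in> Bad"
    proof (rule ccontr)
      assume nb: "w \<notin> Bad"
      show False
      proof (cases "red w = red u")
        case True
        then have "pr (w, v)" using w nb uv unfolding pr_def by auto
        then show False using y(2)[of "(w, v)"] w unfolding u_def v_def by auto
      next
        case False
        then have "pr (u, w)" using w nb uv unfolding pr_def by auto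
        then show False using y(2)[of "(u, w)"] w unfolding u_def v_def by auto
      qed
    qed
  qed
  then have "card {u<..<v} \<le> e" using bad card_mono[of Bad "{u<..<v}"] by linarith
  then have vu: "v - u - 1 \<le> int e" by simp
  have pick: "\<exists>w\<in>{x..y}. w \<notin> Bad" if "x + int e \<le> y" for x y
  proof (rule ccontr)
    assume "\<not> (\<exists>w\<in>{x..y}. w \<notin> Bad)"
    then have "{x..y} \<subseteq> Bad" by blast
    then have "card {x..y} \<le> e" using bad card_mono[of Bad "{x..y}"] by linarith
    then show False using that by simp
  qed
  define hm where "hm = (m + 1) div 2"
  have hm: "m \<le> 2 * hm" "2 * hm \<le> m + 1" unfolding hm_def by auto
  show ?thesis
  proof (cases "v + m \<le> W")
    case True
    obtain w where w: "w \<in> {v + hm..u + m}" "w \<notin> Bad" using pick[of "v + hm" "u + m"] vu hm m by auto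
    then have wW: "w \<in> {l..W} - Bad" using uv True hm m by auto
    show ?thesis
    proof (cases "red w = red u")
      case True
      then show ?thesis using that[of v w] uv w wW hm m by auto
    next
      case False
      then show ?thesis using that[of u w] uv w wW hm m by auto
    qed
  next
    case False
    obtain w where w: "w \<in> {v - m..u - hm}" "w \<notin> Bad" using pick[of "v - m" "u - hm"] vu hm m by auto
    then have wW: "w \<in> {l..W} - Bad" using uv False hm m by auto
    show ?thesis
    proof (cases "red w = red u")
      case True
      then show ?thesis using that[of w v] uv w wW hm m by auto
    next
      case False
      then show ?thesis using that[of w u] uv w wW hm m by auto
    qed
  qed
qed

text \<open>Here \<open>\<eta> * W\<close> bounds the number of exceptional \<open>z\<close> as well as the number of monochromatic solutions
  with any other \<open>z\<close>, only \<open>z \<ge> \<alpha> * W\<close> are used to create shifts, and \<open>\<zeta> * W\<close> with \<open>\<zeta> = \<xi>\<^sup>2\<close> and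
  \<open>\<eta> = \<zeta>\<^sup>2\<close> is the distance of the two differently coloured \<open>z\<close>.\<close>

lemma mono_pos_sum_large:
  fixes W :: int
  defines "A \<equiv> real_of_int a"
  defines "\<alpha> \<equiv> 1 / (400 * A\<^sup>2)"
  defines "\<xi> \<equiv> \<alpha> / (6400 * A\<^sup>2)"
  defines "\<eta> \<equiv> \<xi> ^ 4"
  assumes W: "1000 * (A + \<bar>real_of_int x0\<bar> + \<bar>real_of_int \<beta>\<bar> + 1) \<le> \<eta> * real_of_int W"
  shows "\<eta>\<^sup>2 * (real_of_int W)\<^sup>2 < real (\<Sum>z=1..W. card (mono_pos z))"
proof (rule ccontr)
  assume "\<not> ?thesis"
  then have total: "real (\<Sum>z=1..W. card (mono_pos z)) \<le> \<eta>\<^sup>2 * (real_of_int W)\<^sup>2" by simp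
  define w where "w = real_of_int W"
  \<comment> \<open>The powers balance the errors: shifts of about \<open>\<zeta> * w\<close> lose
    of the order \<open>(\<eta> / \<zeta> + \<zeta>) * w\<close> places, and
    \<open>\<eta> = \<zeta>\<^sup>2\<close> equalises the two terms. As \<open>low_part\<close>
    bounds a squared count, the root \<open>\<xi>\<close> of \<open>\<zeta>\<close> is what must be
    small against \<open>\<alpha>\<close>.\<close>
  define \<zeta> where "\<zeta> = \<xi>\<^sup>2"
  have A: "1 \<le> A" unfolding A_def using a1 by simp
  then have A2: "1 \<le> A\<^sup>2" by simp
  have \<alpha>: "400 * A\<^sup>2 * \<alpha> = 1" "0 < \<alpha>" unfolding \<alpha>_def using A by auto
  have \<xi>: "6400 * A\<^sup>2 * \<xi> = \<alpha>" "0 < \<xi>" unfolding \<xi>_def using A \<alpha> by auto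
  have \<alpha>4: "400 * \<alpha> \<le> 1"
  proof -
    have "400 * \<alpha> \<le> 400 * \<alpha> * A\<^sup>2" using A2 \<alpha> by (simp add: mult_le_cancel_left1)
    then show ?thesis using \<alpha>(1) by (simp add: mult.commute mult.left_commute)
  qed
  have \<xi>6: "6400 * \<xi> \<le> \<alpha>"
  proof -
    have "6400 * \<xi> \<le> 6400 * \<xi> * A\<^sup>2" using A2 \<xi> by (simp add: mult_le_cancel_left1)
    then show ?thesis using \<xi>(1) by (simp add: mult.commute mult.left_commute)
  qed
  have \<xi>1: "\<xi> \<le> 1 / 1000" using \<xi>6 \<alpha>4 by linarith
  have \<zeta>\<xi>: "\<zeta> \<le> \<xi> / 1000" unfolding \<zeta>_def power2_eq_square using mult_left_mono[OF \<xi>1, of \<xi>] \<xi> by simp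
  have \<zeta>0: "0 < \<zeta>" unfolding \<zeta>_def using \<xi> by simp
  have \<eta>\<zeta>: "\<eta> = \<zeta>\<^sup>2" unfolding \<eta>_def \<zeta>_def by (simp flip: power_mult)
  have \<zeta>1: "\<zeta> \<le> 1 / 1000" using \<zeta>\<xi> \<xi>1 \<xi> by linarith
  have \<eta>\<zeta>': "\<eta> \<le> \<zeta> / 1000" unfolding \<eta>\<zeta> power2_eq_square using mult_left_mono[OF \<zeta>1, of \<zeta>] \<zeta>0 by simp
  have \<eta>0: "0 < \<eta>" unfolding \<eta>\<zeta> using \<zeta>0 by simp
  have x0r: "\<bar>real_of_int x0\<bar> = real_of_int x0" using x01 by simp
  have big: "1000 * A + 1000 * real_of_int x0 + 1000 * \<bar>real_of_int \<beta>\<bar> + 1000 \<le> \<eta> * w"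
    using W unfolding w_def x0r by (simp add: algebra_simps)
  have \<eta>w: "1000 \<le> \<eta> * w" using big A x01 by (smt (verit) of_int_pos)
  have w0: "0 < w" using \<eta>w \<eta>0 by (smt (verit) mult_nonneg_nonpos)
  have \<zeta>w: "\<eta> * w \<le> \<zeta> * w / 1000" using mult_right_mono[OF \<eta>\<zeta>', of w] w0 by simp
  have \<xi>w: "\<zeta> * w \<le> \<xi> * w / 1000" using mult_right_mono[OF \<zeta>\<xi>, of w] w0 by simp
  have \<alpha>w: "6400 * (\<xi> * w) \<le> \<alpha> * w" using mult_right_mono[OF \<xi>6, of w] w0 by simp
  have ww: "400 * (\<alpha> * w) \<le> w" using mult_right_mono[OF \<alpha>4, of w] w0 by simp
  define e where "e = nat \<lfloor>\<eta> * w\<rfloor>"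
  have e: "real e \<le> \<eta> * w" "\<eta> * w < real e + 1" unfolding e_def using \<eta>w by linarith+
  define Bad where "Bad = {z \<in> {1..W}. e < card (mono_pos z)}"
  have fBad: "finite Bad" unfolding Bad_def by (rule finite_subset[of _ "{1..W}"]) auto
  \<comment> \<open>Markov's inequality: every bad \<open>z\<close> contributes more than
    \<open>e\<close> to a total of at most \<open>(\<eta> * w)\<^sup>2\<close>.\<close>
  have "real (card Bad) * (\<eta> * w) \<le> (\<eta> * w) * (\<eta> * w)"
  proof -
    have "card Bad * (e + 1) = (\<Sum>z\<in>Bad. e + 1)" by simp
    also have "\<dots> \<le> (\<Sum>z\<in>Bad. card (mono_pos z))" by (intro sum_mono) (auto simp: Bad_def)
    also have "\<dots> \<le> (\<Sum>z=1..W. card (mono_pos z))" by (intro sum_mono2) (auto simp: Bad_def)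
    finally have "real (card Bad * (e + 1)) \<le> \<eta>\<^sup>2 * w\<^sup>2" using total unfolding w_def by linarith
    moreover have "real (card Bad) * (\<eta> * w) \<le> real (card Bad) * (real e + 1)" using e by (intro mult_left_mono) auto
    ultimately show ?thesis by (simp add: power2_eq_square algebra_simps)
  qed
  then have "real (card Bad) \<le> \<eta> * w" using \<eta>w by (simp add: mult_le_cancel_right)
  then have cBad: "card Bad \<le> e" using e by linarith
  define m where "m = \<lfloor>\<zeta> * w\<rfloor>"
  have m: "real_of_int m \<le> \<zeta> * w" "\<zeta> * w \<le> 2 * real_of_int m" unfolding m_def using \<zeta>w \<eta>w by linarith+
  have me: "8 * int e + 16 \<le> m" 
  proof -
    have "8 * real e + 16 \<le> real_of_int m" using e m(2) \<zeta>w \<eta>w by linarith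
    then show ?thesis by linarith
  qed
  define l where "l = \<lceil>\<alpha> * w\<rceil>"
  have l: "\<alpha> * w \<le> real_of_int l" "real_of_int l < \<alpha> * w + 1" unfolding l_def by linarith+
  have l1: "1 \<le> l" using l(1) \<alpha>w \<xi>w \<zeta>w \<eta>w by linarith
  have lm: "l + 2 * m \<le> W"
  proof -
    have "real_of_int l + 2 * real_of_int m \<le> w" using l m ww \<alpha>w \<xi>w \<zeta>w \<eta>w by linarith
    then show ?thesis unfolding w_def by linarith
  qed
  have sumW: "real_of_int (\<Sum>z=1..W. int (card (mono_pos z))) \<le> \<eta>\<^sup>2 * w\<^sup>2" using total unfolding w_def by simp
  \<comment> \<open>Both cases below make \<open>g\<close> almost constant on a range
    \<open>{0..Q}\<close> with \<open>Q\<close> at least of order \<open>\<alpha> * w / A\<close>.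
    The resulting number of positions contradicts the assumed total, because
    \<open>\<eta> \<le> \<xi>\<close> is small against \<open>\<alpha>\<close>.\<close>
  have fin: False if Q: "80 * a * int (card {i \<in> {0..Q}. g i \<noteq> c}) \<le> Q" "16 * \<bar>x0 + \<beta>\<bar> + 16 * a \<le> Q" "x0 + a * Q \<le> W"
    and Qw: "\<alpha> * w \<le> 8 * A * real_of_int Q" for Q c
  proof -
    have "real_of_int (Q * Q) \<le> real_of_int (512 * a * (\<Sum>z=1..W. int (card (mono_pos z))))"
      using many_mono_pos[OF Q] by (simp only: of_int_le_iff)
    then have "(real_of_int Q)\<^sup>2 \<le> 512 * A * real_of_int (\<Sum>z=1..W. int (card (mono_pos z)))"
      unfolding A_def by (simp add: power2_eq_square)
    also have "\<dots> \<le> 512 * A * (\<eta>\<^sup>2 * w\<^sup>2)" using A sumW by (intro mult_left_mono) auto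
    finally have QQ: "(real_of_int Q)\<^sup>2 \<le> 512 * A * (\<eta>\<^sup>2 * w\<^sup>2)" .
    have "(\<alpha> * w)\<^sup>2 \<le> (8 * A * real_of_int Q)\<^sup>2" using Qw \<alpha> w0 by (intro power_mono) auto
    also have "\<dots> = 64 * A\<^sup>2 * (real_of_int Q)\<^sup>2" by (simp add: power2_eq_square)
    also have "\<dots> \<le> 64 * A\<^sup>2 * (512 * A * (\<eta>\<^sup>2 * w\<^sup>2))" using QQ by (intro mult_left_mono) auto
    also have "\<dots> = (32768 * A ^ 3 * \<eta>\<^sup>2) * w\<^sup>2" by (simp add: power2_eq_square power3_eq_cube)
    finally have "\<alpha>\<^sup>2 * w\<^sup>2 \<le> (32768 * A ^ 3 * \<eta>\<^sup>2) * w\<^sup>2" by (simp add: power_mult_distrib)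
    then have 1: "\<alpha>\<^sup>2 \<le> 32768 * A ^ 3 * \<eta>\<^sup>2" using w0 by (simp add: mult_le_cancel_right)
    have "\<eta> \<le> \<xi>" using \<eta>\<zeta>' \<zeta>\<xi> \<xi> \<zeta>0 by linarith
    then have "\<eta>\<^sup>2 \<le> \<xi>\<^sup>2" using \<eta>0 by (intro power_mono) auto
    then have "32768 * A ^ 3 * \<eta>\<^sup>2 \<le> 32768 * A ^ 4 * \<xi>\<^sup>2"
      using A by (intro mult_mono) (auto intro: power_increasing)
    also have "\<dots> < (6400 * A\<^sup>2 * \<xi>)\<^sup>2"
    proof -
      have "0 < A ^ 4 * \<xi>\<^sup>2" using A \<xi> by simp
      moreover have "(6400 * A\<^sup>2 * \<xi>)\<^sup>2 = 40960000 * (A ^ 4 * \<xi>\<^sup>2)" by (simp add: power_mult_distrib flip: power_mult)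
      moreover have "32768 * A ^ 4 * \<xi>\<^sup>2 = 32768 * (A ^ 4 * \<xi>\<^sup>2)" by simp
      ultimately show ?thesis by linarith
    qed
    also have "\<dots> = \<alpha>\<^sup>2" using \<xi>(1) by simp
    finally show False using 1 by simp
  qed
  have "16 * \<bar>x0 + \<beta>\<bar> \<le> 16 * (\<bar>x0\<bar> + \<bar>\<beta>\<bar>)" by (intro mult_left_mono abs_triangle_ineq) simp
  then have tri: "16 * \<bar>x0 + \<beta>\<bar> \<le> 16 * \<bar>x0\<bar> + 16 * \<bar>\<beta>\<bar>" by (simp only: distrib_left)
  show False
  proof (cases "\<exists>z z'. z \<in> {l..W} - Bad \<and> z' \<in> {l..W} - Bad \<and> red z \<noteq> red z'")
    case False
    then obtain c where c: "\<And>z. z \<in> {l..W} - Bad \<Longrightarrow> red z = c" by blast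
    define Q where "Q = (W - x0) div a"
    have "a * Q = (W - x0) - (W - x0) mod a" unfolding Q_def by (simp add: minus_mod_eq_mult_div)
    moreover have "0 \<le> (W - x0) mod a" "(W - x0) mod a < a" using a1 by auto
    ultimately have aQ: "a * Q \<le> W - x0" "W - x0 < a * Q + a" by linarith+
    then have "real_of_int (W - x0) < real_of_int (a * Q + a)" by (simp only: of_int_less_iff)
    then have "w - real_of_int x0 < A * real_of_int Q + A" unfolding w_def A_def by simp
    then have QA: "w \<le> 2 * (A * real_of_int Q)" using big \<eta>w \<zeta>w \<xi>w \<alpha>w ww A x01 by linarith
    \<comment> \<open>A failure comes from a number that is bad or below \<open>l\<close>, and
      \<open>l\<close> is about \<open>\<alpha> * w\<close>. The 400 in \<open>\<alpha>\<close>
      makes these few enough for the factor 80 in \<open>many_mono_pos\<close>.\<close>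
    define F where "F = {i \<in> {0..Q}. g i \<noteq> c}"
    have "(\<lambda>i. x0 + a * i) ` F \<subseteq> {1..<l} \<union> Bad"
    proof
      fix z assume "z \<in> (\<lambda>i. x0 + a * i) ` F"
      then obtain i where i: "z = x0 + a * i" "0 \<le> i" "i \<le> Q" "g i \<noteq> c" unfolding F_def by auto
      have "a * i \<le> a * Q" "0 \<le> a * i" using i a1 by (auto intro: mult_left_mono)
      then have z: "1 \<le> z" "z \<le> W" using i(1) aQ x01 by linarith+
      have "red z \<noteq> c" using i(1,4) unfolding g_def by simp
      then have "z \<notin> {l..W} - Bad" using c by blast
      then show "z \<in> {1..<l} \<union> Bad" using z by auto
    qed
    then have "card ((\<lambda>i. x0 + a * i) ` F) \<le> card ({1..<l} \<union> Bad)" using fBad by (intro card_mono) auto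
    also have "card ((\<lambda>i. x0 + a * i) ` F) = card F" using a1 by (intro card_image) (auto simp: inj_on_def)
    also have "card ({1..<l} \<union> Bad) \<le> card {1..<l} + card Bad" by (rule card_Un_le)
    finally have "int (card F) \<le> (l - 1) + int e" using cBad l1 by simp
    then have "real_of_int (int (card F)) \<le> real_of_int ((l - 1) + int e)" by (simp only: of_int_le_iff)
    then have cF: "real (card F) \<le> 2 * (\<alpha> * w)" using l e \<zeta>w \<xi>w \<alpha>w by simp
    have "(160 * A\<^sup>2) * (real (card F)) \<le> (160 * A\<^sup>2) * (2 * (\<alpha> * w))" using cF by (intro mult_left_mono) auto
    also have "\<dots> = (400 * A\<^sup>2 * \<alpha>) * (w * (4 / 5))" by simp
    also have "\<dots> \<le> w" using \<alpha>(1) w0 by simp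
    also have "\<dots> \<le> 2 * (A * real_of_int Q)" by (rule QA)
    finally have "A * (80 * A * real (card F)) \<le> A * real_of_int Q" by (simp add: power2_eq_square algebra_simps)
    then have "80 * A * real (card F) \<le> real_of_int Q" using A by (simp add: mult_le_cancel_left)
    then have "real_of_int (80 * a * int (card F)) \<le> real_of_int Q" unfolding A_def by simp
    then have q1: "80 * a * int (card F) \<le> Q" by (simp only: of_int_le_iff)
    have Qw: "\<alpha> * w \<le> 8 * A * real_of_int Q" using QA ww \<alpha>w \<xi>w \<zeta>w \<eta>w by linarith
    have "A * (16 * (\<bar>real_of_int x0\<bar> + \<bar>real_of_int \<beta>\<bar>) + 16 * A) \<le> A * real_of_int Q"
    proof -
      have "2 * (A * (16 * (\<bar>real_of_int x0\<bar> + \<bar>real_of_int \<beta>\<bar>) + 16 * A)) \<le> 2 * (A * (\<eta> * w))"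
        using big A x0r by (intro mult_left_mono) auto
      also have "\<dots> \<le> w"
      proof -
        have "A * \<eta> \<le> A\<^sup>2 * \<alpha>"
        proof (rule mult_mono)
          show "A \<le> A\<^sup>2" using A by (simp add: power2_eq_square)
          show "\<eta> \<le> \<alpha>" using \<eta>\<zeta>' \<zeta>\<xi> \<xi>6 \<xi> \<zeta>0 by linarith
        qed (use A \<eta>0 in auto)
        then have "A * \<eta> \<le> 1 / 400" using \<alpha>(1) by simp
        then have "(A * \<eta>) * w \<le> (1 / 400) * w" using w0 by (intro mult_right_mono) auto
        then show ?thesis using w0 by (simp add: mult.assoc)
      qed
      also have "\<dots> \<le> 2 * (A * real_of_int Q)" by (rule QA)
      finally show ?thesis by simp
    qed
    then have "16 * (\<bar>real_of_int x0\<bar> + \<bar>real_of_int \<beta>\<bar>) + 16 * A \<le> real_of_int Q" using A by (simp add: mult_le_cancel_left)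
    then have "real_of_int (16 * \<bar>x0\<bar> + 16 * \<bar>\<beta>\<bar> + 16 * a) \<le> real_of_int Q" unfolding A_def by simp
    then have "16 * \<bar>x0\<bar> + 16 * \<bar>\<beta>\<bar> + 16 * a \<le> Q" by (simp only: of_int_le_iff)
    then have q2: "16 * \<bar>x0 + \<beta>\<bar> + 16 * a \<le> Q" by (rule order_trans[OF add_right_mono[OF tri]])
    have q3: "x0 + a * Q \<le> W" using aQ(1) by linarith
    show False by (rule fin[OF q1[unfolded F_def] q2 q3 Qw])
  next
    case True
    then obtain z z' where zz: "z \<in> {l..W} - Bad" "z' \<in> {l..W} - Bad" "red z \<noteq> red z'" by blast
    obtain z1 z2 where z: "z1 < z2" "z1 \<in> {l..W} - Bad" "z2 \<in> {l..W} - Bad" "red z1 \<noteq> red z2" "m \<le> 2 * (z2 - z1)" "z2 - z1 \<le> m"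
      by (rule close_change[OF fBad cBad me lm zz])
    define c where "c = red z1"
    define q where "q = z1 + \<beta>"
    define Q where "Q = \<lfloor>\<alpha> * w / (4 * A)\<rfloor>"
    \<comment> \<open>As \<open>c\<close> survives all longer shifts up to few losses,
      \<open>low_part\<close> shows that it is rare on \<open>{0..Q}\<close>; the opposite colour is
      then almost constant there.\<close>
    define X where "X = {i \<in> {0..Q}. g i = c}"
    have A\<alpha>: "1000 * A \<le> \<alpha> * w" using big \<eta>w \<zeta>w \<xi>w \<alpha>w A x01 by linarith
    have q4: "8 \<le> \<alpha> * w / A" using A\<alpha> A by (simp add: le_divide_eq)
    have Q: "real_of_int Q \<le> \<alpha> * w / (4 * A)" "\<alpha> * w / (8 * A) \<le> real_of_int Q"
    proof -
      show "real_of_int Q \<le> \<alpha> * w / (4 * A)" unfolding Q_def by linarith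
      have "\<alpha> * w / (4 * A) - 1 \<le> real_of_int Q" unfolding Q_def by linarith
      moreover have "\<alpha> * w / (8 * A) = (\<alpha> * w / A) / 8" "\<alpha> * w / (4 * A) = (\<alpha> * w / A) / 4" by simp_all
      ultimately show "\<alpha> * w / (8 * A) \<le> real_of_int Q" using q4 by linarith
    qed
    have Qw: "\<alpha> * w \<le> 8 * A * real_of_int Q" using Q(2) A by (simp add: divide_le_eq algebra_simps)
    have AQ: "4 * (A * real_of_int Q) \<le> \<alpha> * w" using Q(1) A by (simp add: le_divide_eq algebra_simps)
    have Q0: "0 \<le> real_of_int Q" using Q(2) \<alpha> w0 A by (smt (verit) divide_nonneg_pos mult_nonneg_nonneg)
    have Q4: "4 * real_of_int Q \<le> \<alpha> * w" using AQ mult_right_mono[OF A Q0] by linarith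
    have z1: "\<alpha> * w \<le> real_of_int z1" "real_of_int z1 \<le> w" using z(2) l(1) unfolding w_def by (auto intro: order_trans)
    have q: "real_of_int q \<le> 2 * w - 1" "0 \<le> q" "2 * Q + (z2 - z1) \<le> q"
    proof -
      have qr: "real_of_int q = real_of_int z1 + real_of_int \<beta>" unfolding q_def by simp
      show "real_of_int q \<le> 2 * w - 1" unfolding qr using z1(2) big \<eta>w \<zeta>w \<xi>w \<alpha>w ww A x01 by linarith
      have "real_of_int (z2 - z1) \<le> real_of_int m" using z(6) by (simp only: of_int_le_iff)
      then have "2 * real_of_int Q + real_of_int (z2 - z1) \<le> real_of_int q"
        unfolding qr using Q4 z1(1) m(1) big \<eta>w \<zeta>w \<xi>w \<alpha>w A x01 by linarith
      then have "real_of_int (2 * Q + (z2 - z1)) \<le> real_of_int q" by simp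
      then show "2 * Q + (z2 - z1) \<le> q" by (simp only: of_int_le_iff)
      then show "0 \<le> q" using Q0 z(1) by linarith
    qed
    have gd: "card (mono_pos z1) \<le> e" "card (mono_pos z2) \<le> e" using z l1 unfolding Bad_def by auto
    have "{z \<in> {z1..z2}. e < card (mono_pos z)} \<subseteq> Bad" using z l1 unfolding Bad_def by auto
    then have bd: "card {z \<in> {z1..z2}. e < card (mono_pos z)} \<le> e" using cBad card_mono[OF fBad] by (meson order_trans)
    have dr: "m * int (card (losses c q \<delta>)) \<le> 4 * (q * int e) + m * (8 * int e + 4 * m)" if "\<delta> \<in> {z2 - z1..q}" for \<delta>
      using card_losses_bound[OF z(1) _ _ gd bd z(5,6) me, of c \<delta> q] that z(4) q_def c_def by auto
    define V where "V = 4 * (q * int e) + m * (8 * int e + 4 * m)"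
    have V0: "0 \<le> V" unfolding V_def using q(2) me by (intro add_nonneg_nonneg mult_nonneg_nonneg) auto
    have X: "card X * card X \<le> card X * card (mono_pos z1) + (\<Sum>\<delta>=z2 - z1..q. card (losses c q \<delta>))"
      unfolding q_def using q(3) z(1) unfolding q_def by (intro low_part[of z1 c X Q]) (auto simp: X_def c_def)
    have "m * int (card X * card X) \<le> m * int (card X * card (mono_pos z1) + (\<Sum>\<delta>=z2 - z1..q. card (losses c q \<delta>)))"
      using X me by (intro mult_left_mono) (auto simp only: of_nat_le_iff)
    also have "\<dots> = m * int (card X * card (mono_pos z1)) + (\<Sum>\<delta>=z2 - z1..q. m * int (card (losses c q \<delta>)))"
      by (simp add: algebra_simps sum_distrib_left)
    also have "\<dots> \<le> m * int (card X * e) + (\<Sum>\<delta>=z2 - z1..q. V)"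
      unfolding V_def using gd(1) me dr by (intro add_mono mult_left_mono sum_mono) (auto simp only: of_nat_le_iff intro: mult_left_mono)
    also have "(\<Sum>\<delta>=z2 - z1..q. V) \<le> (q + 1) * V" using V0 z(1) q(2) by (auto intro: mult_right_mono)
    finally have "m * int (card X * card X) \<le> m * int (card X * e) + (q + 1) * V" by simp
    then have "real_of_int (m * int (card X * card X)) \<le> real_of_int (m * int (card X * e) + (q + 1) * V)" by (simp only: of_int_le_iff)
    then have XX: "real_of_int m * (real (card X))\<^sup>2 \<le> real_of_int m * (real (card X) * real e) + (real_of_int q + 1) * real_of_int V"
      by (simp add: power2_eq_square)
    have cX: "real (card X) \<le> w"
    proof -
      have "card X \<le> card {0..Q}" unfolding X_def by (intro card_mono) auto
      then have "real (card X) \<le> real_of_int Q + 1" using Q0 by simp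
      then show ?thesis using Q4 ww \<alpha>w \<xi>w \<zeta>w \<eta>w by linarith
    qed
    have m0: "0 \<le> real_of_int m" using me by simp
    have q0: "0 \<le> real_of_int q" using q(2) by simp
    have ez: "real e \<le> \<zeta>\<^sup>2 * w" using e(1) \<eta>\<zeta> by simp
    have "real_of_int V = 4 * (real_of_int q * real e) + real_of_int m * (8 * real e + 4 * real_of_int m)" unfolding V_def by simp
    also have "\<dots> \<le> 4 * ((2 * w) * (\<zeta>\<^sup>2 * w)) + (\<zeta> * w) * (8 * (\<zeta>\<^sup>2 * w) + 4 * (\<zeta> * w))"
      using q q0 ez m m0 w0 \<zeta>0 by (intro add_mono mult_mono) auto
    also have "\<dots> = (12 + 8 * \<zeta>) * (\<zeta>\<^sup>2 * w\<^sup>2)" by (simp add: power2_eq_square algebra_simps)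
    also have "\<dots> \<le> 13 * (\<zeta>\<^sup>2 * w\<^sup>2)" using \<zeta>1 by (intro mult_right_mono) auto
    finally have Vr: "real_of_int V \<le> 13 * (\<zeta>\<^sup>2 * w\<^sup>2)" .
    have "(\<zeta> * w) * (real (card X))\<^sup>2 \<le> 2 * (real_of_int m * (real (card X))\<^sup>2)"
      using mult_right_mono[OF m(2), of "(real (card X))\<^sup>2"] by simp
    also have "\<dots> \<le> 2 * (real_of_int m * (real (card X) * real e) + (real_of_int q + 1) * real_of_int V)"
      using XX by simp
    also have "\<dots> \<le> 2 * ((\<zeta> * w) * (w * (\<zeta>\<^sup>2 * w)) + (2 * w) * (13 * (\<zeta>\<^sup>2 * w\<^sup>2)))"
      using cX ez m m0 q q0 Vr V0 w0 \<zeta>0 by (intro mult_left_mono add_mono mult_mono) auto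
    also have "\<dots> = (\<zeta> * w) * ((2 * \<zeta> + 52) * (\<zeta> * w\<^sup>2))" by (simp add: power2_eq_square algebra_simps)
    finally have "(real (card X))\<^sup>2 \<le> (2 * \<zeta> + 52) * (\<zeta> * w\<^sup>2)" using \<zeta>0 w0 by (simp add: mult_le_cancel_left)
    also have "\<dots> \<le> 64 * (\<zeta> * w\<^sup>2)" using \<zeta>1 \<zeta>0 by (intro mult_right_mono) auto
    also have "\<dots> = (8 * \<xi> * w)\<^sup>2" unfolding \<zeta>_def by (simp add: power_mult_distrib)
    finally have cX8: "real (card X) \<le> 8 * \<xi> * w" using \<xi> w0 by (simp add: power2_le_iff_abs_le)
    \<comment> \<open>From \<open>card X \<le> 8 * \<xi> * w\<close> and
      \<open>\<alpha> * w \<le> 8 * A * Q\<close>, the factor 80 is met if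
      \<open>5120 * A\<^sup>2 * \<xi> \<le> \<alpha>\<close>; this is the origin of the 6400 in
      \<open>\<xi>\<close>.\<close>
    have "(80 * A * real (card X)) * (8 * A) \<le> (80 * A * (8 * \<xi> * w)) * (8 * A)" using cX8 A by (intro mult_right_mono mult_left_mono) auto
    also have "\<dots> = (6400 * A\<^sup>2 * \<xi>) * w * (4 / 5)" by (simp add: power2_eq_square)
    also have "\<dots> \<le> \<alpha> * w" using \<xi>(1) \<alpha> w0 by simp
    also have "\<dots> \<le> real_of_int Q * (8 * A)" using Qw by (simp add: mult.commute)
    finally have "80 * A * real (card X) \<le> real_of_int Q" using A by (simp add: mult_le_cancel_right)
    then have "real_of_int (80 * a * int (card X)) \<le> real_of_int Q" unfolding A_def by simp
    then have q1: "80 * a * int (card X) \<le> Q" by (simp only: of_int_le_iff)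
    have X': "X = {i \<in> {0..Q}. g i \<noteq> (\<not> c)}" unfolding X_def by auto
    have "8 * (A * (16 * (\<bar>real_of_int x0\<bar> + \<bar>real_of_int \<beta>\<bar>) + 16 * A)) \<le> 8 * (A * (\<eta> * w))"
      using big A x0r by (intro mult_left_mono) auto
    also have "\<dots> \<le> \<alpha> * w"
    proof -
      have "8 * (A * \<eta>) \<le> 6400 * (A\<^sup>2 * \<xi>)"
      proof (rule mult_mono)
        show "A * \<eta> \<le> A\<^sup>2 * \<xi>"
        proof (rule mult_mono)
          show "A \<le> A\<^sup>2" using A by (simp add: power2_eq_square)
          show "\<eta> \<le> \<xi>" using \<eta>\<zeta>' \<zeta>\<xi> \<xi> \<zeta>0 by linarith
        qed (use A \<eta>0 in auto)
      qed (use A \<eta>0 in auto)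
      also have "\<dots> = \<alpha>" using \<xi>(1) by (simp only: mult.assoc)
      finally have "8 * (A * \<eta>) \<le> \<alpha>" .
      then have "8 * (A * \<eta>) * w \<le> \<alpha> * w" using w0 by (intro mult_right_mono) auto
      then show ?thesis by (simp add: mult.assoc)
    qed
    also have "\<dots> \<le> 8 * (A * real_of_int Q)" using Qw by simp
    finally have "16 * (\<bar>real_of_int x0\<bar> + \<bar>real_of_int \<beta>\<bar>) + 16 * A \<le> real_of_int Q" using A by (simp add: mult_le_cancel_left)
    then have "real_of_int (16 * \<bar>x0\<bar> + 16 * \<bar>\<beta>\<bar> + 16 * a) \<le> real_of_int Q" unfolding A_def by simp
    then have "16 * \<bar>x0\<bar> + 16 * \<bar>\<beta>\<bar> + 16 * a \<le> Q" by (simp only: of_int_le_iff)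
    then have q2: "16 * \<bar>x0 + \<beta>\<bar> + 16 * a \<le> Q" by (rule order_trans[OF add_right_mono[OF tri]])
    have "real_of_int x0 + A * real_of_int Q \<le> w" using AQ big \<eta>w \<zeta>w \<xi>w \<alpha>w ww A by linarith
    then have "real_of_int (x0 + a * Q) \<le> real_of_int W" unfolding A_def w_def by simp
    then have q3: "x0 + a * Q \<le> W" by (simp only: of_int_le_iff)
    show False using fin[OF q1[unfolded X'] q2 q3 Qw] .
  qed
qed

end

section \<open>From monochromatic positions to solutions of linear equations\<close>

lemma sum_mono_pos_le:
  fixes W x0 a \<beta> b :: int
  assumes a: "1 \<le> a" "1 \<le> x0" "2 * x0 + a * \<beta> = b" and \<phi>: "two_colouring n \<phi>"
    and W: "0 \<le> W" "W \<le> int n" "x0 + a * (W + \<beta>) \<le> int n"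
  shows "(\<Sum>z=1..W. card (linear_colouring.mono_pos (\<lambda>k. \<phi> (nat k) = 1) x0 a \<beta> z)) \<le> 9 * num_mono_solutions [:b, a:] n \<phi> + 3 * nat W"
proof -
  interpret linear_colouring "\<lambda>k. \<phi> (nat k) = 1" x0 a \<beta> by standard (use a in auto)
  define T where "T = (SIGMA z:{1..W}. mono_pos z)"
  \<comment> \<open>\<open>D1\<close>, \<open>D2\<close> and \<open>D3\<close> are the coincidences
    \<open>x = y\<close>, \<open>x = z\<close> and \<open>y = z\<close>. In each of them
    \<open>z\<close> determines the position, whence the term \<open>3 * W\<close>.\<close>
  define D1 where "D1 = {y \<in> T. 2 * snd y = fst y + \<beta>}"
  define D2 where "D2 = {y \<in> T. x0 + a * snd y = fst y}"
  define D3 where "D3 = {y \<in> T. x0 + a * (fst y + \<beta> - snd y) = fst y}"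
  define G where "G = T - (D1 \<union> D2 \<union> D3)"
  define M where "M = {S \<in> solutions [:b, a:] n. monochromatic \<phi> S}"
  have fT: "finite T" unfolding T_def by (intro finite_SigmaI) auto
  have deg: "card D \<le> nat W" if D: "D \<subseteq> T" and i: "inj_on fst D" for D :: "(int \<times> int) set"
  proof -
    have "fst ` D \<subseteq> {1..W}" using D unfolding T_def by auto
    then have "card D \<le> card {1..W}" using i by (intro card_inj_on_le[of fst]) auto
    then show ?thesis by simp
  qed
  have "card D1 \<le> nat W" unfolding D1_def by (rule deg) (auto simp: inj_on_def)
  moreover have "card D2 \<le> nat W" unfolding D2_def by (rule deg) (use a in \<open>auto simp: inj_on_def\<close>)
  moreover have "card D3 \<le> nat W"
  proof -
    have "inj_on fst {y \<in> T. x0 + a * (fst y + \<beta> - snd y) = fst y}"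
    proof (rule inj_onI)
      fix y y' assume y: "y \<in> {y \<in> T. x0 + a * (fst y + \<beta> - snd y) = fst y}"
        "y' \<in> {y \<in> T. x0 + a * (fst y + \<beta> - snd y) = fst y}" "fst y = fst y'"
      then have "x0 + a * (fst y + \<beta> - snd y) = fst y" "x0 + a * (fst y + \<beta> - snd y') = fst y" by simp_all
      then have "a * (fst y + \<beta> - snd y) = a * (fst y + \<beta> - snd y')" by linarith
      then have "fst y + \<beta> - snd y = fst y + \<beta> - snd y'" using a(1) by (simp only: mult_cancel_left) simp
      then show "y = y'" using y(3) by (simp add: prod_eq_iff)
    qed
    then show ?thesis unfolding D3_def by (intro deg) auto
  qed
  moreover have "card G \<le> 9 * num_mono_solutions [:b, a:] n \<phi>"
  proof -
    \<comment> \<open>The set alone forgets the labelling; attaching \<open>(x, z)\<close>, a member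
      of \<open>S \<times> S\<close>, restores injectivity and produces the factor 9.\<close>
    define f where "f y = ({nat (x0 + a * snd y), nat (x0 + a * (fst y + \<beta> - snd y)), nat (fst y)}, (nat (x0 + a * snd y), nat (fst y)))" for y
    have pos: "1 \<le> fst y" "fst y \<le> W" "0 \<le> snd y" "snd y \<le> fst y + \<beta>" if "y \<in> G" for y
      using that unfolding G_def T_def mono_pos_def by auto
    have pos': "1 \<le> x0 + a * snd y" "1 \<le> x0 + a * (fst y + \<beta> - snd y)" if "y \<in> G" for y
      using pos[OF that] a by (auto intro: order_trans[OF a(2)])
    have "inj_on f G"
    proof (rule inj_onI)
      fix y y' assume y: "y \<in> G" "y' \<in> G" "f y = f y'"
      then have "nat (x0 + a * snd y) = nat (x0 + a * snd y')" "nat (fst y) = nat (fst y')" unfolding f_def by simp_all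
      then have "x0 + a * snd y = x0 + a * snd y'" "fst y = fst y'"
        using pos[OF y(1)] pos[OF y(2)] pos'[OF y(1)] pos'[OF y(2)] by (simp_all add: eq_nat_nat_iff)
      then show "y = y'" using a by (simp add: prod_eq_iff)
    qed
    moreover have "f ` G \<subseteq> (SIGMA S:M. S \<times> S)"
    proof
      fix v assume "v \<in> f ` G"
      then obtain y where y: "y \<in> G" "v = f y" by (elim imageE) simp
      define x where "x = x0 + a * snd y"
      define x' where "x' = x0 + a * (fst y + \<beta> - snd y)"
      note p = pos[OF y(1)] pos'[OF y(1), folded x_def x'_def]
      have top: "x0 + a * t \<le> int n" if "t \<le> W + \<beta>" for t
      proof -
        have "a * t \<le> a * (W + \<beta>)" using that a by (intro mult_left_mono) auto
        then show ?thesis using W(3) by linarith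
      qed
      have "x \<le> int n" "x' \<le> int n" unfolding x_def x'_def using p by (auto intro!: top)
      moreover have "x \<noteq> x'"
      proof
        assume "x = x'"
        then have "snd y = fst y + \<beta> - snd y" unfolding x_def x'_def using a by simp
        then show False using y(1) unfolding G_def D1_def by auto
      qed
      moreover have "x \<noteq> fst y" "x' \<noteq> fst y" using y(1) unfolding G_def D2_def D3_def x_def x'_def by auto
      moreover have "x + x' = poly [:b, a:] (fst y)"
        unfolding x_def x'_def using a(3) by (simp add: algebra_simps)
      moreover have "(\<phi> (nat x) = 1) = (\<phi> (nat (fst y)) = 1)" "(\<phi> (nat x') = 1) = (\<phi> (nat (fst y)) = 1)"
        using y(1) unfolding G_def T_def mono_pos_def g_def x_def x'_def by auto
      ultimately have "{nat x, nat x', nat (fst y)} \<in> M"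
        unfolding M_def using p W by (intro mono_solution_mem[OF \<phi>]) auto
      then show "v \<in> (SIGMA S:M. S \<times> S)" using y(2) unfolding f_def x_def x'_def by auto
    qed
    moreover have fM: "finite M" unfolding M_def using finite_solutions by auto
    have S3: "finite S \<and> card S = 3" if "S \<in> M" for S
      using that unfolding M_def solutions_def by (auto intro: finite_subset)
    then have "finite (SIGMA S:M. S \<times> S)" using fM by (intro finite_SigmaI) auto
    ultimately have "card G \<le> card (SIGMA S:M. S \<times> S)" by (intro card_inj_on_le[of f])
    also have "\<dots> = (\<Sum>S\<in>M. card (S \<times> S))" using fM S3 by (intro card_SigmaI) auto
    also have "\<dots> = (\<Sum>S\<in>M. 9)" using S3 by (intro sum.cong) (auto simp: card_cartesian_product)
    finally show ?thesis unfolding num_mono_solutions_def M_def by simp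
  qed
  moreover have "card T \<le> card G + (card D1 + card D2 + card D3)"
  proof -
    have "T \<subseteq> G \<union> (D1 \<union> D2 \<union> D3)" unfolding G_def by auto
    moreover have "finite (G \<union> (D1 \<union> D2 \<union> D3))" using fT unfolding G_def D1_def D2_def D3_def by auto
    ultimately have "card T \<le> card (G \<union> (D1 \<union> D2 \<union> D3))" by (rule card_mono[rotated])
    then show ?thesis using card_Un_le[of G "D1 \<union> D2 \<union> D3"] card_Un_le[of "D1 \<union> D2" D3] card_Un_le[of D1 D2] by linarith
  qed
  moreover have "card T = (\<Sum>z=1..W. card (mono_pos z))" unfolding T_def by (intro card_SigmaI) auto
  ultimately show ?thesis by linarith
qed

lemma lower_bound_linear:
  fixes p :: "int poly"
  assumes p: "degree p = 1" "lead_coeff p > 0" and ev: "even (poly p 1 * poly p 2)"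
  shows "\<exists>c>0. \<forall>\<^sub>F n in sequentially. \<forall>\<phi>. two_colouring n \<phi> \<longrightarrow>
    c * (real n)\<^sup>2 \<le> real (num_mono_solutions p n \<phi>)"
proof -
  obtain b q where q: "p = pCons b q" by (cases p)
  then have "degree q = 0" using p(1) by (auto split: if_splits)
  then obtain a where "q = [:a:]" by (rule degree_eq_zeroE)
  then have pab: "p = [:b, a:]" using q by simp
  have a1: "1 \<le> a" using p pab by (auto split: if_splits)
  have ev': "even ((a + b) * (2 * a + b))" using ev pab by (simp add: algebra_simps)
  \<comment> \<open>The equation \<open>2 * x0 + a * \<beta> = b\<close> has the solution
    \<open>(t, b)\<close> because \<open>b - a * b = 2 * t\<close> is even; adding \<open>k\<close>
    times the homogeneous solution \<open>(a, -2)\<close> makes \<open>x0\<close> positive.\<close>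
  define k where "k = \<bar>b - a * b\<bar> + 1"
  define \<beta> where "\<beta> = b - 2 * k"
  have "even (b - a * b)" using ev' by auto
  then obtain t where t: "b - a * b = 2 * t" by (rule evenE)
  define x0 where "x0 = t + a * k"
  have xb: "2 * x0 + a * \<beta> = b" unfolding x0_def \<beta>_def using t by (simp add: algebra_simps)
  have "\<bar>t\<bar> \<le> \<bar>2 * t\<bar>" by simp
  also have "\<dots> = k - 1" unfolding k_def t by simp
  finally have tk: "\<bar>t\<bar> \<le> k - 1" .
  moreover have "0 \<le> \<bar>t\<bar>" by simp
  ultimately have "k \<le> a * k" using a1 by (simp add: mult_le_cancel_right1)
  then have x01: "1 \<le> x0" unfolding x0_def using tk by linarith
  define A where "A = real_of_int a"
  define \<eta> where "\<eta> = (1 / (400 * A\<^sup>2) / (6400 * A\<^sup>2)) ^ 4"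
  have A: "1 \<le> A" unfolding A_def using a1 by simp
  have \<eta>: "0 < \<eta>" unfolding \<eta>_def using A by (intro zero_less_power divide_pos_pos) auto
  define R where "R = real_of_int (x0 + a * \<bar>\<beta>\<bar> + a)"
  \<comment> \<open>The summands ensure that \<open>R\<close> is at most half of \<open>n\<close>,
    that \<open>W\<close> is large enough for \<open>mono_pos_sum_large\<close>, and that the
    degenerate \<open>3 * w\<close> is at most half of
    \<open>\<eta>\<^sup>2 * w\<^sup>2\<close>.\<close>
  define N where "N = 2 * R + 2 * A * (1000 * (A + \<bar>real_of_int x0\<bar> + \<bar>real_of_int \<beta>\<bar> + 1)) / \<eta> + 2 * A * 6 / \<eta>\<^sup>2 + 1"
  define c where "c = \<eta>\<^sup>2 / (72 * A\<^sup>2)"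
  have c: "0 < c" unfolding c_def using \<eta> A by simp
  have "c * (real n)\<^sup>2 \<le> real (num_mono_solutions p n \<phi>)" if n: "N \<le> real n" and \<phi>: "two_colouring n \<phi>" for n \<phi>
  proof -
    \<comment> \<open>For \<open>z \<le> W\<close> the summands \<open>x0 + a * i\<close> with
      \<open>i \<le> z + \<beta>\<close> do not exceed \<open>n\<close>, whatever the sign of
      \<open>\<beta>\<close>.\<close>
    define W where "W = (int n - x0 - a * \<bar>\<beta>\<bar>) div a"
    have "a * W = (int n - x0 - a * \<bar>\<beta>\<bar>) - (int n - x0 - a * \<bar>\<beta>\<bar>) mod a" unfolding W_def by (simp add: minus_mod_eq_mult_div)
    moreover have "0 \<le> (int n - x0 - a * \<bar>\<beta>\<bar>) mod a" "(int n - x0 - a * \<bar>\<beta>\<bar>) mod a < a" using a1 by auto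
    ultimately have aW: "a * W \<le> int n - x0 - a * \<bar>\<beta>\<bar>" "int n \<le> a * W + (x0 + a * \<bar>\<beta>\<bar> + a)" by linarith+
    define w where "w = real_of_int W"
    have R0: "0 \<le> R" unfolding R_def using a1 x01 by simp
    have N1: "2 * R \<le> N" "2 * A * (1000 * (A + \<bar>real_of_int x0\<bar> + \<bar>real_of_int \<beta>\<bar> + 1)) / \<eta> \<le> N" "2 * A * 6 / \<eta>\<^sup>2 \<le> N"
    proof -
      have "0 \<le> 2 * A * (1000 * (A + \<bar>real_of_int x0\<bar> + \<bar>real_of_int \<beta>\<bar> + 1)) / \<eta>" "0 \<le> 2 * A * 6 / \<eta>\<^sup>2" using A \<eta> by simp_all
      then show "2 * R \<le> N" "2 * A * (1000 * (A + \<bar>real_of_int x0\<bar> + \<bar>real_of_int \<beta>\<bar> + 1)) / \<eta> \<le> N" "2 * A * 6 / \<eta>\<^sup>2 \<le> N"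
        unfolding N_def using R0 by linarith+
    qed
    have "real_of_int (int n) \<le> real_of_int (a * W + (x0 + a * \<bar>\<beta>\<bar> + a))" using aW(2) by (simp only: of_int_le_iff)
    then have "real n \<le> A * w + R" unfolding A_def w_def R_def by simp
    then have nw: "real n \<le> 2 * A * w" using N1(1) n by linarith
    have w1: "1000 * (A + \<bar>real_of_int x0\<bar> + \<bar>real_of_int \<beta>\<bar> + 1) \<le> \<eta> * w"
    proof -
      have "2 * A * (1000 * (A + \<bar>real_of_int x0\<bar> + \<bar>real_of_int \<beta>\<bar> + 1)) / \<eta> \<le> 2 * A * w" using N1(2) n nw by linarith
      then have "2 * A * (1000 * (A + \<bar>real_of_int x0\<bar> + \<bar>real_of_int \<beta>\<bar> + 1)) \<le> 2 * A * (\<eta> * w)"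
        using \<eta> by (simp add: divide_le_eq mult.commute mult.left_commute)
      moreover have "0 < 2 * A" using A by simp
      ultimately show ?thesis by (simp only: mult_le_cancel_left_pos)
    qed
    have w2: "6 \<le> \<eta>\<^sup>2 * w"
    proof -
      have "2 * A * 6 / \<eta>\<^sup>2 \<le> 2 * A * w" using N1(3) n nw by linarith
      then have "2 * A * 6 \<le> 2 * A * (\<eta>\<^sup>2 * w)" using \<eta> by (simp add: divide_le_eq mult.commute mult.left_commute)
      moreover have "0 < 2 * A" using A by simp
      ultimately show ?thesis by (simp only: mult_le_cancel_left_pos)
    qed
    have w0: "0 < w" using w2 \<eta> by (smt (verit) mult_nonneg_nonpos zero_le_power2)
    have W0: "0 \<le> W" using w0 unfolding w_def by simp
    have "W \<le> int n \<and> x0 + a * (W + \<beta>) \<le> int n"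
      if "W \<le> a * W" "0 \<le> Y" "a * \<beta> \<le> Y" "a * W \<le> int n - x0 - Y" for Y
      using that x01 unfolding distrib_left by linarith
    from this[OF _ _ _ aW(1)] have Wn: "0 \<le> W" "W \<le> int n" "x0 + a * (W + \<beta>) \<le> int n"
      using W0 a1 by (simp_all add: mult_le_cancel_right1 mult_left_mono)
    have le: "(\<Sum>z=1..W. card (linear_colouring.mono_pos (\<lambda>k. \<phi> (nat k) = 1) x0 a \<beta> z)) \<le> 9 * num_mono_solutions p n \<phi> + 3 * nat W"
      unfolding pab by (intro sum_mono_pos_le[OF a1 x01 xb \<phi> Wn])
    interpret linear_colouring "\<lambda>k. \<phi> (nat k) = 1" x0 a \<beta> by standard (use a1 x01 in auto)
    have "\<eta>\<^sup>2 * w\<^sup>2 < real (\<Sum>z=1..W. card (mono_pos z))"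
      using mono_pos_sum_large[of W] w1 unfolding \<eta>_def A_def w_def by simp
    also have "\<dots> \<le> real (9 * num_mono_solutions p n \<phi> + 3 * nat W)" using le by (simp only: of_nat_le_iff)
    also have "\<dots> = 9 * real (num_mono_solutions p n \<phi>) + 3 * w" using Wn(1) unfolding w_def by simp
    finally have 1: "\<eta>\<^sup>2 * w\<^sup>2 < 9 * real (num_mono_solutions p n \<phi>) + 3 * w" .
    have "6 * w \<le> (\<eta>\<^sup>2 * w) * w" using w2 w0 by (intro mult_right_mono) auto
    then have 2: "6 * w \<le> \<eta>\<^sup>2 * w\<^sup>2" by (simp add: power2_eq_square)
    have 3: "\<eta>\<^sup>2 * w\<^sup>2 \<le> 18 * real (num_mono_solutions p n \<phi>)" using 1 2 by linarith
    have "(real n)\<^sup>2 \<le> (2 * A * w)\<^sup>2" using nw by (intro power_mono) auto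
    then have "c * (real n)\<^sup>2 \<le> c * (2 * A * w)\<^sup>2" using c by (intro mult_left_mono) auto
    also have "\<dots> = \<eta>\<^sup>2 * w\<^sup>2 / 18" unfolding c_def using A by (simp add: power_mult_distrib field_simps)
    also have "\<dots> \<le> real (num_mono_solutions p n \<phi>)" using 3 by simp
    finally show ?thesis .
  qed
  moreover have "\<forall>\<^sub>F n in sequentially. N \<le> real n" using filterlim_real_sequentially unfolding filterlim_at_top by blast
  ultimately have "\<forall>\<^sub>F n in sequentially. \<forall>\<phi>. two_colouring n \<phi> \<longrightarrow> c * (real n)\<^sup>2 \<le> real (num_mono_solutions p n \<phi>)"
    by (auto elim: eventually_mono)
  then show ?thesis using c by blast
qed

section \<open>The upper bound\<close>

lemma upper_bound:
  fixes p :: "int poly"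
  assumes p: "degree p = d" "1 \<le> d" "lead_coeff p > 0"
  shows "\<exists>C. \<forall>n. \<exists>\<phi>. two_colouring n \<phi> \<and> real (num_mono_solutions p n \<phi>) \<le> C * real n powr (2 / real d ^ 2)"
proof -
  define P where "P = poly p"
  have "\<forall>\<^sub>F s in at_top. (int d * 1 * lead_coeff p * s ^ (d - 1) \<le> 2 * fwd p s 1 \<and>
    fwd p s 1 \<le> 2 * (int d * 1 * lead_coeff p) * s ^ (d - 1)) \<and> lead_coeff p * s ^ degree p \<le> 2 * poly p s"
    using p by (intro eventually_conj fwd_bounds eventually_poly_lower) auto
  then obtain z' where z': "\<And>s. z' \<le> s \<Longrightarrow> int d * 1 * lead_coeff p * s ^ (d - 1) \<le> 2 * fwd p s 1 \<and> lead_coeff p * s ^ degree p \<le> 2 * poly p s"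
    unfolding eventually_at_top_linorder by blast
  define z0 where "z0 = max z' 1"
  have inc1: "P z < P (z + 1)" if "z0 \<le> z" for z
  proof -
    have "0 < int d * 1 * lead_coeff p * z ^ (d - 1)" using p that unfolding z0_def by simp
    also have "\<dots> \<le> 2 * fwd p z 1" using z' that unfolding z0_def by simp
    finally show ?thesis unfolding fwd_def P_def by simp
  qed
  have inc: "P z < P w" if "z0 \<le> z" "z < w" for z w
    using that(2)
  proof (induction w rule: int_gr_induct)
    case (step i)
    then show ?case using inc1[of i] that by simp
  qed (use inc1 that in simp)
  have low: "z ^ d \<le> 2 * P z" if "z0 \<le> z" for z
  proof -
    have "z ^ d \<le> lead_coeff p * z ^ d" using p that unfolding z0_def by (simp add: mult_le_cancel_right1)
    also have "\<dots> \<le> 2 * P z" using z'[of z] that p unfolding z0_def P_def by simp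
    finally show ?thesis .
  qed
  have low1: "z \<le> 2 * P z" if "z0 \<le> z" for z
  proof -
    have "z \<le> z ^ d" using that p unfolding z0_def by (intro self_le_power) auto
    then show ?thesis using low[OF that] by simp
  qed
  \<comment> \<open>From \<open>z1\<close> on, \<open>P A\<close> dominates all values of
    \<open>P\<close> on \<open>{1..A}\<close>, including the initial ones where \<open>P\<close>
    need not be monotone.\<close>
  define z1 where "z1 = 4 * z0 + 2 * (\<Sum>z\<in>{1..z0}. \<bar>P z\<bar>)"
  have sum0: "0 \<le> (\<Sum>z\<in>{1..z0}. \<bar>P z\<bar>)" by (intro sum_nonneg) auto
  have z01: "1 \<le> z0" unfolding z0_def by simp
  have z1: "z0 \<le> z1" unfolding z1_def using sum0 z01 by simp
  have Pz1: "2 * z0 + (\<Sum>z\<in>{1..z0}. \<bar>P z\<bar>) \<le> P A" if "z1 \<le> A" for A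
    using low1[of A] that z1 unfolding z1_def by simp
  have halfP: "z0 \<le> P A div 2" if "z1 \<le> A" for A
    using zdiv_mono1[of "2 * z0" "P A" 2] Pz1[OF that] sum0 by simp
  have Pmax: "P z \<le> P A" if "1 \<le> z" "z \<le> A" "z1 \<le> A" for z A
  proof (cases "z \<le> z0")
    case True
    have "P z \<le> \<bar>P z\<bar>" by simp
    also have "\<dots> \<le> (\<Sum>z\<in>{1..z0}. \<bar>P z\<bar>)" using True that by (intro member_le_sum) auto
    finally show ?thesis using Pz1[OF that(3)] z01 by simp
  next
    case False
    then show ?thesis using inc[of z A] that by (cases "z = A") auto
  qed
  define D where "D = d ^ 2"
  have D: "1 \<le> D" "d * d = D" unfolding D_def using p by (simp_all add: power2_eq_square)
  define C where "C = (real_of_int z1 + 1 + 4 ^ (d + 1)) ^ 2"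
  have "\<exists>\<phi>. two_colouring n \<phi> \<and> real (num_mono_solutions p n \<phi>) \<le> C * real n powr (2 / real d ^ 2)" for n
  proof (cases "n = 0")
    case True
    then have "solutions p n = {}" unfolding solutions_def by (auto dest: card_mono[rotated])
    then show ?thesis using True unfolding two_colouring_def num_mono_solutions_def by (intro exI[of _ "\<lambda>_. 1"]) simp
  next
    case False
    \<comment> \<open>The cut points are \<open>A\<close> and \<open>P A div 2\<close>; the
      condition makes \<open>P\<close> exceed \<open>2 * n\<close> beyond the second one, so no
      larger \<open>z\<close> occurs in a solution.\<close>
    define Q where "Q A \<longleftrightarrow> z1 \<le> int A \<and> 2 * int n < P (P (int A) div 2 + 1)" for A :: nat
    define A where "A = (LEAST A. Q A)"
    have "Q (nat z1 + 16 * n + 16)"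
    proof -
      define A where "A = nat z1 + 16 * n + 16"
      have A: "z1 \<le> int A" "16 * int n + 16 \<le> int A" unfolding A_def by auto
      have 1: "int A \<le> 2 * P (int A)" using low1 A z1 by simp
      then have "4 * int n \<le> P (int A) div 2" using A by simp
      moreover have "z0 \<le> P (int A) div 2" by (rule halfP[OF A(1)])
      ultimately have "4 * int n + 1 \<le> 2 * P (P (int A) div 2 + 1)" using low1[of "P (int A) div 2 + 1"] by simp
      then have "2 * int n < P (P (int A) div 2 + 1)" by simp
      then show ?thesis using A unfolding Q_def A_def by simp
    qed
    then have QA: "Q A" unfolding A_def by (rule LeastI)
    define B where "B = P (int A) div 2"
    have A: "z1 \<le> int A" "2 * int n < P (B + 1)" using QA unfolding Q_def B_def by auto
    have zB: "z0 \<le> B" unfolding B_def by (rule halfP[OF A(1)])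
    have PA: "P (int A) \<le> 2 * B + 1" "2 * B \<le> P (int A)" unfolding B_def by auto
    define \<phi> :: "nat \<Rightarrow> int" where "\<phi> x = (if x \<le> A \<or> B < int x then 1 else - 1)" for x
    have \<phi>: "two_colouring n \<phi>" unfolding two_colouring_def \<phi>_def by auto
    have sub: "{S \<in> solutions p n. monochromatic \<phi> S} \<subseteq> (\<lambda>(w, z). {w, nat (P (int z) - int w), z}) ` ({1..A} \<times> {1..A})"
    proof
      fix S assume "S \<in> {S \<in> solutions p n. monochromatic \<phi> S}"
      then have S': "S \<in> solutions p n" "monochromatic \<phi> S" by simp_all
      then have S'': "S \<subseteq> {1..n}" "card S = 3" "\<exists>x y z. S = {x, y, z} \<and> int x + int y = P (int z)"
        unfolding solutions_def P_def by simp_all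
      then obtain x y z where xyz: "S = {x, y, z}" "int x + int y = P (int z)" by (elim exE conjE)
      note S = xyz(1) S''(1,2) xyz(2) S'(2)
      have xy: "x \<noteq> y"
      proof
        assume "x = y"
        then have "S = {y, z}" using S(1) by simp
        then have "card S \<le> 2" by (simp add: card_insert_if)
        then show False using S(3) by simp
      qed
      have r: "1 \<le> x" "x \<le> n" "1 \<le> y" "y \<le> n" "1 \<le> z" "z \<le> n" using S(2) unfolding S(1) by simp_all
      have col: "\<phi> x = \<phi> z" "\<phi> y = \<phi> z" using S(5) unfolding monochromatic_def S(1) by blast+
      have zle: "int z \<le> B"
      proof (rule ccontr)
        assume "\<not> int z \<le> B"
        then have "P (B + 1) \<le> P (int z)" using inc[of "B + 1" "int z"] zB by (cases "int z = B + 1") auto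
        then show False using A(2) S(4) r by linarith
      qed
      have zA: "z \<le> A"
      proof (rule ccontr)
        assume z: "\<not> z \<le> A"
        then have "\<phi> z = - 1" using zle unfolding \<phi>_def by simp
        then have "int x \<le> B" "int y \<le> B" using col unfolding \<phi>_def by (auto split: if_splits)
        moreover have "P (int A) < P (int z)" using inc z A z1 by simp
        ultimately show False using S(4) PA by linarith
      qed
      then have "\<phi> z = 1" unfolding \<phi>_def by simp
      then have xA: "x \<le> A \<or> B < int x" "y \<le> A \<or> B < int y" using col unfolding \<phi>_def by (auto split: if_splits)
      have "P (int z) \<le> P (int A)" using Pmax zA r A by simp
      then have "x \<le> A \<or> y \<le> A" using xA S(4) PA xy by linarith
      then show "S \<in> (\<lambda>(w, z). {w, nat (P (int z) - int w), z}) ` ({1..A} \<times> {1..A})"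
      proof
        assume "x \<le> A"
        moreover have "y = nat (P (int z) - int x)" using S(4) by simp
        ultimately show ?thesis using S(1) zA r by (intro image_eqI[of _ _ "(x, z)"]) auto
      next
        assume "y \<le> A"
        moreover have "x = nat (P (int z) - int y)" using S(4) by simp
        ultimately show ?thesis using S(1) zA r by (intro image_eqI[of _ _ "(y, z)"]) auto
      qed
    qed
    have "num_mono_solutions p n \<phi> \<le> card ((\<lambda>(w, z). {w, nat (P (int z) - int w), z}) ` ({1..A} \<times> {1..A}))"
      unfolding num_mono_solutions_def by (intro card_mono sub) auto
    also have "\<dots> \<le> card ({1..A} \<times> {1..A})" by (intro card_image_le) auto
    also have "\<dots> = A * A" by (simp add: card_cartesian_product)
    finally have M: "real (num_mono_solutions p n \<phi>) \<le> real A ^ 2" by (metis of_nat_le_iff of_nat_mult power2_eq_square)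
    define R where "R = real n powr (1 / real D)"
    have R1: "1 \<le> R" unfolding R_def using False by (intro ge_one_powr_ge_zero) auto
    have "real A \<le> (real_of_int z1 + 1 + 4 ^ (d + 1)) * R"
    proof (cases "z1 \<le> int A - 1")
      case False
      then have "real A \<le> real_of_int z1 + 1" by linarith
      also have "\<dots> \<le> (real_of_int z1 + 1 + 4 ^ (d + 1)) * 1" by simp
      also have "\<dots> \<le> (real_of_int z1 + 1 + 4 ^ (d + 1)) * R" using R1 z1 z01 by (intro mult_left_mono) auto
      finally show ?thesis .
    next
      case True
      \<comment> \<open>Minimality of \<open>A\<close> fails the condition at \<open>A - 1\<close>,
        so applying the lower bound for \<open>P\<close> twice shows that \<open>(A - 1) ^ D\<close>
        is at most a constant times \<open>n\<close>.\<close>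
      define A' where "A' = A - 1"
      have A': "A = A' + 1" "z1 \<le> int A'" using True z1 z01 unfolding A'_def by auto
      then have "\<not> Q A'" using not_less_Least[of A' Q] unfolding A_def[symmetric] by simp
      then have le: "P (P (int A') div 2 + 1) \<le> 2 * int n" using A' unfolding Q_def by simp
      define y where "y = P (int A') div 2 + 1"
      have y: "z0 \<le> y" "P (int A') \<le> 2 * y" unfolding y_def using halfP[OF A'(2)] by auto
      have "int A' ^ d \<le> 4 * y" using low[of "int A'"] A' z1 y by simp
      then have "(int A' ^ d) ^ d \<le> (4 * y) ^ d" by (intro power_mono) auto
      also have "\<dots> = 4 ^ d * y ^ d" by (simp add: power_mult_distrib)
      also have "\<dots> \<le> 4 ^ d * (2 * P y)" using low[OF y(1)] by (intro mult_left_mono) auto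
      also have "\<dots> \<le> 4 ^ d * (4 * int n)" using le unfolding y_def by simp
      finally have "int A' ^ D \<le> 4 ^ (d + 1) * int n" unfolding D(2)[symmetric] by (simp add: power_mult)
      then have "real_of_int (int A' ^ D) \<le> real_of_int (4 ^ (d + 1) * int n)" by (simp only: of_int_le_iff)
      then have "real A' ^ D \<le> 4 ^ (d + 1) * real n" by simp
      moreover have "(1 :: real) \<le> 4 ^ (d + 1)" by (rule one_le_power) simp
      ultimately have "real A' \<le> 4 ^ (d + 1) * R" unfolding R_def using D(1) by (intro le_powr_root) simp_all
      then have "real A \<le> 4 ^ (d + 1) * R + 1 * R" using R1 A' by simp
      also have "\<dots> \<le> (real_of_int z1 + 1 + 4 ^ (d + 1)) * R" using R1 z1 z01 by (simp add: algebra_simps)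
      finally show ?thesis .
    qed
    then have "real A ^ 2 \<le> ((real_of_int z1 + 1 + 4 ^ (d + 1)) * R) ^ 2" by (intro power_mono) auto
    also have "\<dots> = C * R ^ 2" unfolding C_def by (simp add: power_mult_distrib)
    also have "R ^ 2 = real n powr (2 / real d ^ 2)"
      unfolding R_def D_def using False by (simp add: powr_powr flip: powr_realpow)
    finally have "real A ^ 2 \<le> C * real n powr (2 / real d ^ 2)" .
    then show ?thesis using order_trans[OF M] \<phi> by blast
  qed
  then show ?thesis by blast
qed

theorem theorem1p1:
  fixes p :: "int poly" and d :: nat
  assumes "degree p = d" and "d \<ge> 1" and "lead_coeff p > 0"
    and "2 dvd poly p 1 * poly p 2"
  shows "(\<exists>\<epsilon> :: nat \<Rightarrow> real. \<epsilon> \<longlonglongrightarrow> 0 \<and>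
            (\<forall>\<^sub>F n in sequentially. \<forall>\<phi>. two_colouring n \<phi> \<longrightarrow>
               real (num_mono_solutions p n \<phi>) \<ge> real n powr (2 / real d ^ 3 - \<epsilon> n)))
       \<and> (\<exists>C :: real. \<forall>n. \<exists>\<phi>. two_colouring n \<phi> \<and>
            real (num_mono_solutions p n \<phi>) \<le> C * real n powr (2 / real d ^ 2))"
proof (rule conjI[OF _ upper_bound[OF assms(1-3)]])
  have "\<exists>c>0. \<forall>\<^sub>F n in sequentially. \<forall>\<phi>. two_colouring n \<phi> \<longrightarrow>
    c * real n powr (2 / real d ^ 3) \<le> real (num_mono_solutions p n \<phi>)"
  proof (cases "d = 1")
    case True
    have "degree p = 1" using assms(1) True by simp
    then obtain c where c: "0 < c" "\<forall>\<^sub>F n in sequentially. \<forall>\<phi>. two_colouring n \<phi> \<longrightarrow> c * (real n)\<^sup>2 \<le> real (num_mono_solutions p n \<phi>)"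
      using lower_bound_linear[OF _ assms(3,4)] by blast
    have "\<forall>\<^sub>F n in sequentially. \<forall>\<phi>. two_colouring n \<phi> \<longrightarrow>
      c * real n powr (2 / real d ^ 3) \<le> real (num_mono_solutions p n \<phi>)"
      using c(2) eventually_gt_at_top[of 0] by eventually_elim (simp add: True)
    then show ?thesis using c(1) by blast
  next
    case False
    then show ?thesis using assms by (intro lower_bound_nonlinear) auto
  qed
  then obtain c0 where c0: "0 < c0" "\<forall>\<^sub>F n in sequentially. \<forall>\<phi>. two_colouring n \<phi> \<longrightarrow>
    c0 * real n powr (2 / real d ^ 3) \<le> real (num_mono_solutions p n \<phi>)" by blast
  \<comment> \<open>Chosen so that \<open>n powr (- \<epsilon> n) = c0\<close>: the constant factor
    becomes a vanishing change of the exponent.\<close>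
  define \<epsilon> where "\<epsilon> n = - ln c0 / ln (real n)" for n :: nat
  have "\<epsilon> \<longlonglongrightarrow> 0"
    unfolding \<epsilon>_def
    by (intro tendsto_divide_0[OF tendsto_const] filterlim_at_top_imp_at_infinity
        filterlim_compose[OF ln_at_top filterlim_real_sequentially])
  moreover have "\<forall>\<^sub>F n in sequentially. \<forall>\<phi>. two_colouring n \<phi> \<longrightarrow>
      real (num_mono_solutions p n \<phi>) \<ge> real n powr (2 / real d ^ 3 - \<epsilon> n)"
    using c0(2) eventually_gt_at_top[of 1]
  proof eventually_elim
    case (elim n)
    have "real n powr (- \<epsilon> n) = c0" using elim(2) c0(1) unfolding \<epsilon>_def powr_def by simp
    then have "real n powr (2 / real d ^ 3 - \<epsilon> n) = c0 * real n powr (2 / real d ^ 3)"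
      using powr_add[of "real n" "2 / real d ^ 3" "- \<epsilon> n"] by simp
    then show ?case using elim(1) by simp
  qed
  ultimately show "\<exists>\<epsilon> :: nat \<Rightarrow> real. \<epsilon> \<longlonglongrightarrow> 0 \<and>
            (\<forall>\<^sub>F n in sequentially. \<forall>\<phi>. two_colouring n \<phi> \<longrightarrow>
               real (num_mono_solutions p n \<phi>) \<ge> real n powr (2 / real d ^ 3 - \<epsilon> n))"
    by blast
qed

end
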